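(* Assume the setting below (Pollack condition, $r<\#\mathrm{Crit}(\Pi)$, and the given $p$-adic $L$-functions $L_p^{(\alpha)},L_p^{(\beta)}$). Then $\log^{\pm}_{\Pi}\in\mathscr{R}^+_{\#\mathrm{Crit}(\Pi)/2}$, and there exist unique distributions $L_p^{+},L_p^{-}\in\mathscr{D}(\mathbb{Z}_p^\times,\mathbb{C}_p)$ such that for every character $\psi$ of $(\mathbb{Z}/p\mathbb{Z})^\times$ $$\mathscr{M}(G^{\pm})_\psi=\log^{\pm}_{\Pi}\cdot\mathscr{M}(L_p^{\pm})_\psi,\qquad\text{where } G^{\pm}=\tfrac12\big(L_p^{(\alpha)}\pm L_p^{(\beta)}\big).$$ These satisfy: (i) $\mathscr{M}(L_p^{(\alpha)})_\psi=\log^{+}_{\Pi}\cdot\mathscr{M}(L_p^{+})_\psi+\log^{-}_{\Pi}\cdot\mathscr{M}(L_p^{-})_\psi$ for every $\psi$; (ii) $L_p^{\pm}\in\mathscr{D}^{\,r-\#\mathrm{Crit}(\Pi)/2}(\mathbb{Z}_p^\times,\mathbb{C}_p)$; in particular, if $r=\#\mathrm{Crit}(\Pi)/2$ (i.e. $v_p(\alpha_{n+2}\cdots\alpha_{2n})$ is minimal, equal to $h_{n+2}+\cdots+h_{2n}$), then $L_p^{+}$ and $L_p^{-}$ are bounded distributions; (iii) for every $j\in\mathrm{Crit}(\Pi)$ and every finite-order character $\theta$ of $\mathbb{Z}_p^\times$ of conductor $p^m$: if $m\ge2$ is even, then $\int_{\mathbb{Z}_p^\times}x^j\theta(x)\log^{+}_{\Pi}(x)\neq0$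 and $$\int_{\mathbb{Z}_p^\times}x^j\theta(x)L_p^{+}(x)=\frac{\xi_{\infty,j}\,c_{x^j\theta}\,\alpha^{-m}\,L(\Pi\otimes\theta,j+\tfrac12)}{\int_{\mathbb{Z}_p^\times}x^j\theta(x)\log^{+}_{\Pi}(x)};$$ if $m\ge1$ is odd, then $\int_{\mathbb{Z}_p^\times}x^j\theta(x)\log^{-}_{\Pi}(x)\neq0$ and $$\int_{\mathbb{Z}_p^\times}x^j\theta(x)L_p^{-}(x)=\frac{\xi_{\infty,j}\,c_{x^j\theta}\,\alpha^{-m}\,L(\Pi\otimes\theta,j+\tfrac12)}{\int_{\mathbb{Z}_p^\times}x^j\theta(x)\log^{-}_{\Pi}(x)}.$$
   Context: Let $p$ be an odd prime and $n\ge 1$. Fix an isomorphism $\overline{\mathbb{Q}}_p\cong\mathbb{C}$; $v_p$ denotes the $p$-adic valuation on $\mathbb{C}_p$ normalised by $v_p(p)=1$. Let $\Pi$ be a cuspidal automorphic representation of $\mathrm{GL}_{2n}(\mathbb{A}_{\mathbb{Q}})$ which is cohomological with respect to an integral weight $\mu=(\mu_1,\dots,\mu_{2n})\in\mathbb{Z}^{2n}$, which is the transfer of a globally generic cuspidal automorphic representation of $\mathrm{GSpin}_{2n+1}(\mathbb{A}_{\mathbb{Q}})$, and which is unramified at $p$. Then $\mu$ is dominant ($\mu_1\ge\cdots\ge\mu_{2n}$) and pure: there is an integer $w$ (the purity weight) with $\mu_i+\mu_{2n+1-i}=w$ for all $i$. The Hodge–Tate weights are $h_i=\mu_i+2n-i$.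 Set $\mathrm{Crit}(\Pi)=\{j\in\mathbb{Z}:\mu_n\ge j\ge\mu_{n+1}\}$, so $\#\mathrm{Crit}(\Pi)=h_n-h_{n+1}$. The Satake parameters $\alpha_1,\dots,\alpha_{2n}$ of $\Pi_p$ (with $\Pi_p\cong\mathrm{Ind}_{B(\mathbb{Q}_p)}^{\mathrm{GL}_{2n}(\mathbb{Q}_p)}(|\cdot|^{(2n-1)/2}\lambda_p)$, $\alpha_i=\lambda_{p,i}(p)$) are indexed so that $v_p(\alpha_1)\ge\cdots\ge v_p(\alpha_{2n})$ and $\alpha_i\alpha_{2n+1-i}=\lambda$ for a fixed $\lambda$ with $v_p(\lambda)=2n-1+w$. Known fact (Hida): the Newton polygon through $(0,0)$, $(j,\sum_{i=1}^{j}v_p(\alpha_{2n+1-i}))$ lies on or above the Hodge polygon through $(0,0)$, $(j,\sum_{i=1}^{j}h_{2n+1-i})$, with the same endpoints. Distributions: for a complete extension $L$ of $\mathbb{Q}_p$, $\mathscr{D}(\mathbb{Z}_p^\times,L)$ is the continuous dual of the space of locally analytic $L$-valued functions on $\mathbb{Z}_p^\times$, an algebra under convolution. Fix a topological generator $\gamma$ of $1+p\mathbb{Z}_p$; write $x=\omega(x)\langle x\rangle$ with $\omega(x)$ the $(p-1)$-st root of unity congruent to $x$ mod $p$ and $\langle x\rangle=\gamma^{s(x)}$, $s(x)\in\mathbb{Z}_p$. For $\mu\in\mathscr{D}(\mathbb{Z}_p^\times,L)$ and a character $\psi$ of $(\mathbb{Z}/p\mathbb{Z})^\times$, $\mathscr{M}(\mu)_\psi(X)=\int_{\mathbb{Z}_p^\times}\psi(x)(1+X)^{s(x)}\mu(x)$,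 a power series converging on the open unit disc $\{v_p(X)>0\}$. The map $\mu\mapsto(\mathscr{M}(\mu)_\psi)_\psi$ is injective, sends convolution to product, and every tuple of power series converging on the open unit disc arises; for $j\in\mathbb{Z}$ and a finite-order character $\theta$, $\int x^j\theta(x)\mu(x)=\mathscr{M}(\mu)_\psi(\gamma^j\theta(\gamma)-1)$ with $\psi(x)=\omega(x)^j\theta(\omega(x))$. Let $\ell(k)=\min\{m\ge0:k<p^m\}$; for real $s\ge0$, $\mathscr{R}^+_s$ is the set of power series $\sum a_kX^k$ over $L$ with $v_p(a_k)+s\,\ell(k)$ bounded below, and $\mathscr{D}^s(\mathbb{Z}_p^\times,L)$ (order $s$ distributions) is the set of $\mu$ with $\mathscr{M}(\mu)_\psi\in\mathscr{R}^+_s$ for all $\psi$; $\mathscr{D}^0$ is the space of bounded distributions. Logarithms: $\Phi_k(Y)=\sum_{i=0}^{p-1}Y^{ip^{k-1}}$; for $j\in\mathbb{Z}$, $\log^{+}_{p,j}(X)=\frac1p\prod_{m\ge1}\frac{\Phi_{2m}(\gamma^{-j}(1+X))}{p}$, $\log^{-}_{p,j}(X)=\frac1p\prod_{m\ge1}\frac{\Phi_{2m-1}(\gamma^{-j}(1+X))}{p}$, and $\log^{\pm}_{\Pi}=\prod_{j\in\mathrm{Crit}(\Pi)}\log^{\pm}_{p,j}$; we also write $\log^{\pm}_{\Pi}$ for the distribution $\nu$ with $\mathscr{M}(\nu)_\psi=\log^{\pm}_\Pi$ for every $\psi$. Standing assumptions: $\Pi$ satisfies the Pollack condition $\alpha_n+\alpha_{n+1}=0$;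 $\alpha=\alpha_{n+1}\alpha_{n+2}\cdots\alpha_{2n}$, $\beta=\alpha_n\alpha_{n+2}\cdots\alpha_{2n}$ (so $\beta=-\alpha$); $r=v_p(\alpha)-\sum_{i=n+1}^{2n}h_i$, and $r<\#\mathrm{Crit}(\Pi)$. We are given (by the construction of Barrera–Dimitrov–Williams) distributions $L_p^{(\alpha)},L_p^{(\beta)}\in\mathscr{D}^r(\mathbb{Z}_p^\times,\mathbb{C}_p)$ such that for every $j\in\mathrm{Crit}(\Pi)$ and every finite-order character $\theta:\mathbb{Z}_p^\times\to\overline{\mathbb{Q}}_p^\times$ of conductor $p^m$ with $m\ge1$, $\int x^j\theta(x)L_p^{(\alpha)}(x)=\xi_{\infty,j}c_{x^j\theta}\,\alpha^{-m}L(\Pi\otimes\theta,j+\tfrac12)$ and $\int x^j\theta(x)L_p^{(\beta)}(x)=\xi_{\infty,j}c_{x^j\theta}\,\beta^{-m}L(\Pi\otimes\theta,j+\tfrac12)$, where $\xi_{\infty,j}$ is a nonzero constant depending only on $j$, $c_{x^j\theta}$ is a nonzero constant depending only on $x^j\theta$, and complex values are viewed in $\mathbb{C}_p$ via the fixed isomorphism. *)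

theory Defs
  imports Complex_Main
    "HOL-Computational_Algebra.Formal_Power_Series"
    "HOL-Computational_Algebra.Polynomial"
    "HOL-Computational_Algebra.Primes"
    "HOL-Library.Extended_Real"
begin

text \<open>Abstract model of C_p: a field K of characteristic 0 with a valuation
 v : K -> ereal (v 0 = infinity), normalised by v p = 1, restricting to the p-adic
 valuation on the rationals, complete and algebraically closed.\<close>

definition lim_v :: "('k::field \<Rightarrow> ereal) \<Rightarrow> (nat \<Rightarrow> 'k) \<Rightarrow> 'k \<Rightarrow> bool" where
  "lim_v v x l \<longleftrightarrow> (\<forall>e::real. \<exists>N. \<forall>M\<ge>N. v (x M - l) \<ge> ereal e)"

definition Cp_field :: "nat \<Rightarrow> ('k::field_char_0 \<Rightarrow> ereal) \<Rightarrow> bool" where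
  "Cp_field p v \<longleftrightarrow>
     (\<forall>x. v x = \<infinity> \<longleftrightarrow> x = 0) \<and> (\<forall>x. v x \<noteq> -\<infinity>) \<and>
     (\<forall>x y. v (x * y) = v x + v y) \<and>
     (\<forall>x y. v (x + y) \<ge> min (v x) (v y)) \<and>
     v (of_nat p) = 1 \<and>
     (\<forall>q::nat. prime q \<and> q \<noteq> p \<longrightarrow> v (of_nat q) = 0) \<and>
     (\<forall>x::nat \<Rightarrow> 'k. (\<forall>e::real. \<exists>N. \<forall>m\<ge>N. \<forall>n\<ge>N. v (x m - x n) \<ge> ereal e)
                 \<longrightarrow> (\<exists>l. lim_v v x l)) \<and>
     (\<forall>P::'k poly. degree P > 0 \<longrightarrow> (\<exists>z. poly P z = 0))"

text \<open>Z_p inside K (closure of the integers), its units, and the subgroups U_m = 1 + p^m Z_p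
 (U_0 = Z_p^x).\<close>

definition Zp :: "('k::field_char_0 \<Rightarrow> ereal) \<Rightarrow> 'k set" where
  "Zp v = {x. \<forall>e::real. \<exists>k::int. v (x - of_int k) \<ge> ereal e}"

definition Zpu :: "('k::field_char_0 \<Rightarrow> ereal) \<Rightarrow> 'k set" where
  "Zpu v = {x \<in> Zp v. v x = 0}"

definition Um :: "('k::field_char_0 \<Rightarrow> ereal) \<Rightarrow> nat \<Rightarrow> 'k set" where
  "Um v m = {x \<in> Zpu v. v (x - 1) \<ge> ereal (real m)}"

definition top_gen :: "('k::field_char_0 \<Rightarrow> ereal) \<Rightarrow> 'k \<Rightarrow> bool" where
  "top_gen v \<gamma> \<longleftrightarrow> \<gamma> \<in> Um v 1 \<and>
     (\<forall>u \<in> Um v 1. \<forall>e::real. \<exists>k::nat. v (\<gamma> ^ k - u) \<ge> ereal e)"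

definition fo_char :: "('k::field_char_0 \<Rightarrow> ereal) \<Rightarrow> ('k \<Rightarrow> 'k) \<Rightarrow> bool" where
  "fo_char v \<theta> \<longleftrightarrow> (\<forall>x\<in>Zpu v. \<forall>y\<in>Zpu v. \<theta> (x * y) = \<theta> x * \<theta> y) \<and>
     (\<exists>N>0. \<forall>x\<in>Zpu v. \<theta> x ^ N = 1)"

definition conductor_exp :: "('k::field_char_0 \<Rightarrow> ereal) \<Rightarrow> ('k \<Rightarrow> 'k) \<Rightarrow> nat \<Rightarrow> bool" where
  "conductor_exp v \<theta> m \<longleftrightarrow> m \<ge> 1 \<and> (\<forall>x\<in>Um v m. \<theta> x = 1) \<and> \<not> (\<forall>x\<in>Um v (m - 1). \<theta> x = 1)"

text \<open>Characters of (Z/pZ)^x, as Dirichlet-style functions on nat (0 on multiples of p).\<close>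
definition dchar :: "nat \<Rightarrow> (nat \<Rightarrow> 'k::field) \<Rightarrow> bool" where
  "dchar p \<chi> \<longleftrightarrow> (\<forall>a. \<chi> a = \<chi> (a mod p)) \<and> (\<forall>a. p dvd a \<longrightarrow> \<chi> a = 0) \<and> \<chi> 1 = 1 \<and>
     (\<forall>a b. \<chi> (a * b) = \<chi> a * \<chi> b)"

definition teich :: "nat \<Rightarrow> ('k::field_char_0 \<Rightarrow> ereal) \<Rightarrow> nat \<Rightarrow> 'k" where
  "teich p v a = (THE t. t ^ (p - 1) = 1 \<and> v (t - of_nat a) > 0)"

definition psi_of :: "nat \<Rightarrow> ('k::field_char_0 \<Rightarrow> ereal) \<Rightarrow> int \<Rightarrow> ('k \<Rightarrow> 'k) \<Rightarrow> nat \<Rightarrow> 'k" where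
  "psi_of p v j \<theta> a = (if p dvd a then 0 else teich p v a powi j * \<theta> (teich p v a))"

definition peval :: "('k::field_char_0 \<Rightarrow> ereal) \<Rightarrow> 'k fps \<Rightarrow> 'k \<Rightarrow> 'k" where
  "peval v f x = (THE l. lim_v v (\<lambda>N. \<Sum>k<N. fps_nth f k * x ^ k) l)"

definition conv_disc :: "('k::field_char_0 \<Rightarrow> ereal) \<Rightarrow> 'k fps \<Rightarrow> bool" where
  "conv_disc v f \<longleftrightarrow> (\<forall>x. v x > 0 \<longrightarrow> (\<exists>l. lim_v v (\<lambda>N. \<Sum>k<N. fps_nth f k * x ^ k) l))"

definition ell :: "nat \<Rightarrow> nat \<Rightarrow> nat" where
  "ell p k = (LEAST m. k < p ^ m)"

definition Rplus :: "nat \<Rightarrow> ('k::field_char_0 \<Rightarrow> ereal) \<Rightarrow> real \<Rightarrow> 'k fps \<Rightarrow> bool" where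
  "Rplus p v s f \<longleftrightarrow> (\<exists>B::real. \<forall>k. v (fps_nth f k) + ereal (s * real (ell p k)) \<ge> ereal B)"

text \<open>A distribution on Z_p^x is represented by its Mellin transform
 psi |-> M(mu)_psi (a bijection onto tuples of power series converging on the open disc).\<close>
type_synonym 'k dist = "(nat \<Rightarrow> 'k) \<Rightarrow> 'k fps"

definition is_dist :: "nat \<Rightarrow> ('k::field_char_0 \<Rightarrow> ereal) \<Rightarrow> 'k dist \<Rightarrow> bool" where
  "is_dist p v M \<longleftrightarrow> (\<forall>\<psi>. dchar p \<psi> \<longrightarrow> conv_disc v (M \<psi>))"

definition in_Ds :: "nat \<Rightarrow> ('k::field_char_0 \<Rightarrow> ereal) \<Rightarrow> real \<Rightarrow> 'k dist \<Rightarrow> bool" where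
  "in_Ds p v s M \<longleftrightarrow> is_dist p v M \<and> (\<forall>\<psi>. dchar p \<psi> \<longrightarrow> Rplus p v s (M \<psi>))"

text \<open>int x^j theta(x) mu(x) = M(mu)_psi(gamma^j theta(gamma) - 1).\<close>
definition integ :: "nat \<Rightarrow> ('k::field_char_0 \<Rightarrow> ereal) \<Rightarrow> 'k \<Rightarrow> 'k dist \<Rightarrow> int \<Rightarrow> ('k \<Rightarrow> 'k) \<Rightarrow> 'k" where
  "integ p v \<gamma> M j \<theta> = peval v (M (psi_of p v j \<theta>)) (\<gamma> powi j * \<theta> \<gamma> - 1)"

text \<open>Phi_k(gamma^{-j}(1+X)) as a power series in X.\<close>
definition Phi_shift :: "nat \<Rightarrow> 'k::field_char_0 \<Rightarrow> nat \<Rightarrow> int \<Rightarrow> 'k fps" where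
  "Phi_shift p \<gamma> k j = Abs_fps (\<lambda>n. \<Sum>i<p. \<gamma> powi (- (j * int (i * p ^ (k - 1))))
                                          * of_nat ((i * p ^ (k - 1)) choose n))"

text \<open>log^+_{p,j} (pos = True, factors Phi_{2m}) and log^-_{p,j} (pos = False, factors
 Phi_{2m-1}); the infinite product is the coefficientwise limit of the partial products.\<close>
definition log_pj :: "nat \<Rightarrow> ('k::field_char_0 \<Rightarrow> ereal) \<Rightarrow> 'k \<Rightarrow> bool \<Rightarrow> int \<Rightarrow> 'k fps" where
  "log_pj p v \<gamma> pos j = Abs_fps (\<lambda>n. THE l. lim_v v
      (\<lambda>M. fps_nth (fps_const (1 / of_nat p) *
           (\<Prod>m\<in>{1..M}. fps_const (1 / of_nat p) *
               Phi_shift p \<gamma> (if pos then 2 * m else 2 * m - 1) j)) n) l)"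

definition log_Pi :: "nat \<Rightarrow> ('k::field_char_0 \<Rightarrow> ereal) \<Rightarrow> 'k \<Rightarrow> bool \<Rightarrow> int set \<Rightarrow> 'k fps" where
  "log_Pi p v \<gamma> pos Crit = (\<Prod>j\<in>Crit. log_pj p v \<gamma> pos j)"

end

theory Submission
  imports Defs "HOL-Computational_Algebra.Polynomial_FPS"
begin

text \<open>
  The zeros of the plus (minus) logarithm are the points \<open>\<gamma>\<^sup>j \<zeta> - 1\<close> with \<open>j\<close> critical and \<open>\<zeta>\<close> of order
  an even (odd) power of \<open>p\<close>.  Such a \<open>\<zeta>\<close> is the value at \<open>\<gamma>\<close> of a character of odd (even)
  conductor exponent \<open>m\<close>, and there the interpolation formulas cancel because \<open>\<beta> = -\<alpha>\<close>.  A power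
  series \<open>f\<close> that vanishes at \<open>a\<close> is divisible by \<open>X - a\<close>, and the division lowers its Gauss
  valuation at radius \<open>\<rho>\<close> by exactly \<open>min \<rho> (v a)\<close>.  Dividing by the partial products of the
  logarithm and passing to the limit gives the quotient together with its growth: order \<open>s\<close> means
  that the Gauss valuation at radius \<open>p\<^sup>-\<^sup>h\<close> is at least \<open>-s h\<close> up to a constant, and of the factors
  \<open>\<Phi>\<^sub>k / p\<close> only the about \<open>h / 2\<close> ones with \<open>k \<le> h\<close> of the right parity contribute, each
  about \<open>-1\<close>.
\<close>

unbundle fps_syntax

section \<open>Valuations and limits\<close>

text \<open>The bound in \<open>divide_linear\<close> concerns a single quotient and holds at every
  radius at once. Hence the quotients by the partial products are bounded independently of the
  number of factors, and a limit can be taken without any general theory of divisors on the open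
  disc. The obstacle is that the interpolation formulas speak of characters, whereas every component
  \<psi> must be shown to vanish at every zero of the logarithm. For prescribed \<psi>, j and root
  of unity z, a finite-order character must therefore be built; this is the purpose of the
  Teichmueller representatives and of the approximation of 1-units by powers of \<gamma>. Natural
  exponents of \<gamma> at finite precision replace the p-adic exponent s(x). Zeros belonging to
  different j are distinct because \<gamma> has infinite order, so only simple zeros are divided
  out. Oddness of p enters through val (\<gamma>^(p^k) - 1) = k + 1. The passage from order r to
  Gauss bounds is made for r \<ge> 0, and this inequality comes from Hida's inequality together with
  purity and the Pollack condition.\<close>

locale padic_field =
  fixes p :: nat and v :: "'k::field_char_0 \<Rightarrow> ereal"
  assumes prime_p: "prime p" and odd_p: "odd p" and Cp: "Cp_field p v"
begin

text \<open>The value \<open>val 0 = 0\<close> is junk; lower bounds that include \<open>0\<close> are expressed by \<open>vge\<close>.\<close>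

definition val :: "'k \<Rightarrow> real" where "val x = real_of_ereal (v x)"

definition vge :: "'k \<Rightarrow> real \<Rightarrow> bool" where "vge x b \<longleftrightarrow> ereal b \<le> v x"

lemma p_ge_3: "p \<ge> 3"
  using prime_ge_2_nat[OF prime_p] odd_p by (cases "p = 2") auto

lemma p_pos [simp]: "p > 0" and p_nz [simp]: "p \<noteq> 0"
  using p_ge_3 by simp_all

lemma v_eq_infinity_iff: "v x = \<infinity> \<longleftrightarrow> x = 0"
  using Cp unfolding Cp_field_def by blast

lemma v_0 [simp]: "v 0 = \<infinity>"
  by (simp add: v_eq_infinity_iff)

lemma v_eq_val: "x \<noteq> 0 \<Longrightarrow> v x = ereal (val x)"
  using Cp v_eq_infinity_iff[of x] unfolding Cp_field_def val_def by (cases "v x") auto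

lemma v_mult: "v (x * y) = v x + v y"
  using Cp unfolding Cp_field_def by blast

lemma vge_iff: "x \<noteq> 0 \<Longrightarrow> vge x b \<longleftrightarrow> b \<le> val x"
  by (simp add: vge_def v_eq_val)

lemma vge_0 [simp]: "vge 0 b"
  by (simp add: vge_def)

lemma val_mult: "x \<noteq> 0 \<Longrightarrow> y \<noteq> 0 \<Longrightarrow> val (x * y) = val x + val y"
  using v_mult[of x y] by (simp add: v_eq_val)

lemma val_1 [simp]: "val 1 = 0"
  using val_mult[of 1 1] by simp

lemma val_uminus [simp]: "val (- x) = val x"
proof (cases "x = 0")
  case False
  have "val (-1) = 0" using val_mult[of "-1" "-1"] by simp
  then show ?thesis using val_mult[of "-1" x] False by simp
qed simp

lemma val_inverse: "x \<noteq> 0 \<Longrightarrow> val (inverse x) = - val x"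
  using val_mult[of x "inverse x"] by simp

lemma val_divide: "x \<noteq> 0 \<Longrightarrow> y \<noteq> 0 \<Longrightarrow> val (x / y) = val x - val y"
  by (simp add: divide_inverse val_mult val_inverse)

lemma val_power: "x \<noteq> 0 \<Longrightarrow> val (x ^ n) = real n * val x"
  by (induction n) (auto simp: val_mult algebra_simps)

lemma val_prod: "finite A \<Longrightarrow> (\<And>i. i \<in> A \<Longrightarrow> f i \<noteq> 0) \<Longrightarrow> val (\<Prod>i\<in>A. f i) = (\<Sum>i\<in>A. val (f i))"
  by (induction A rule: finite_induct) (auto simp: val_mult)

lemma val_p [simp]: "val (of_nat p) = 1"
  using Cp unfolding Cp_field_def val_def by (simp add: one_ereal_def)

lemma vge_val: "vge x (val x)"
  by (cases "x = 0") (auto simp: vge_iff)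

lemma vge_mono: "vge x b \<Longrightarrow> a \<le> b \<Longrightarrow> vge x a"
  unfolding vge_def by (meson ereal_less_eq(3) order_trans)

lemma vge_1: "vge 1 0"
  by (simp add: vge_iff)

lemma vge_mult: "vge x a \<Longrightarrow> vge y b \<Longrightarrow> vge (x * y) (a + b)"
  by (cases "x = 0 \<or> y = 0") (auto simp: vge_iff val_mult)

lemma vge_uminus [simp]: "vge (- x) b \<longleftrightarrow> vge x b"
  by (cases "x = 0") (auto simp: vge_iff)

lemma vge_add: "vge x b \<Longrightarrow> vge y b \<Longrightarrow> vge (x + y) b"
  using Cp unfolding Cp_field_def vge_def by (meson min.boundedI order_trans)

lemma vge_diff: "vge x b \<Longrightarrow> vge y b \<Longrightarrow> vge (x - y) b"
  using vge_add[of x b "- y"] by simp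

lemma vge_diff_commute: "vge (x - y) b \<longleftrightarrow> vge (y - x) b"
  using vge_uminus[of "x - y" b] by simp

lemma vge_trans_diff: "vge (x - y) b \<Longrightarrow> vge (y - z) b \<Longrightarrow> vge (x - z) b"
  using vge_add[of "x - y" b "y - z"] by simp

lemma vge_sum: "(\<And>i. i \<in> A \<Longrightarrow> vge (f i) b) \<Longrightarrow> vge (\<Sum>i\<in>A. f i) b"
  by (induction A rule: infinite_finite_induct) (auto intro: vge_add)

lemma vge_power: "vge x b \<Longrightarrow> vge (x ^ n) (real n * b)"
proof (induction n)
  case (Suc n)
  then show ?case using vge_mult[of x b "x ^ n" "real n * b"] by (simp add: algebra_simps)
qed (simp add: vge_1)

lemma vge_of_nat [simp]: "vge (of_nat n) 0"
  by (induction n) (auto intro: vge_add vge_1)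

lemma vge_of_int [simp]: "vge (of_int n) 0"
  by (cases n) (auto simp del: of_nat_Suc)

lemma vge_p: "vge (of_nat p) 1"
  by (simp add: vge_iff)

lemma vge_mult_p: "vge x b \<Longrightarrow> vge (of_nat p * x) (b + 1)"
  using vge_mult[OF vge_p, of x b] by (simp add: add.commute)

lemma vge_all_imp_0: "(\<And>b. vge x b) \<Longrightarrow> x = 0"
  using vge_iff[of x "val x + 1"] by force

lemma vge_of_int_dvd: "int p dvd n \<Longrightarrow> vge (of_int n) 1"
proof -
  assume "int p dvd n"
  then obtain k where "n = int p * k" by blast
  then show ?thesis using vge_mult_p[of "of_int k" 0] by simp
qed

lemma vge_of_nat_dvd: "p ^ e dvd n \<Longrightarrow> vge (of_nat n) (real e)"
proof -
  assume "p ^ e dvd n"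
  then obtain k where "n = p ^ e * k" by blast
  then show ?thesis using vge_mult[OF vge_power[OF vge_p, of e] vge_of_nat[of k]] by simp
qed

text \<open>The ultrametric isosceles principle: in x = (x - y) + y the first summand has strictly
  larger valuation. It yields nonvanishing together with the exact valuation, which is how
  congruences become equalities of valuations below.\<close>

lemma val_close:
  assumes "vge (x - y) b" "y \<noteq> 0" "val y < b"
  shows "x \<noteq> 0" "val x = val y"
proof -
  show x: "x \<noteq> 0" using assms vge_iff[of "-y" b] by auto
  have "vge ((x - y) + y) (val y)" using assms vge_mono[OF assms(1)] by (intro vge_add vge_val) auto
  then have 1: "val y \<le> val x" using x by (simp add: vge_iff)
  have "\<not> val x > val y"
  proof
    assume *: "val x > val y"
    have "vge (x - (x - y)) (min (val x) b)"
      by (intro vge_diff vge_mono[OF vge_val] vge_mono[OF assms(1)]) auto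
    then show False using * assms by (simp add: vge_iff)
  qed
  then show "val x = val y" using 1 by simp
qed

lemma val_of_nat_coprime: "\<not> p dvd a \<Longrightarrow> val (of_nat a) = 0"
proof (induction a rule: prime_divisors_induct)
  case (factor q a)
  have q: "q \<noteq> p" "\<not> p dvd a" using factor by auto
  have "v (of_nat q) = 0" using Cp q factor unfolding Cp_field_def by auto
  then have "val (of_nat q) = 0" by (simp add: val_def)
  moreover have "a \<noteq> 0" using q(2) by (cases "a = 0") auto
  moreover have "q \<noteq> 0" using factor(1) by (auto simp: prime_gt_0_nat)
  ultimately show ?case using factor.IH q by (simp add: val_mult)
next
  case (unit x)
  then have "x = 1" by auto
  then show ?case by simp
qed auto

lemma vge_of_int_iff: "vge (of_int a) b \<Longrightarrow> b > 0 \<Longrightarrow> int p dvd a"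
proof (rule ccontr)
  assume *: "vge (of_int a) b" "b > 0" "\<not> int p dvd a"
  then have "\<not> p dvd nat \<bar>a\<bar>" by (simp add: int_dvd_int_iff[symmetric])
  from val_of_nat_coprime[OF this] have "val (of_int \<bar>a\<bar>) = 0" by (simp add: of_nat_nat)
  moreover have "vge (of_int \<bar>a\<bar>) b" using *(1) by (cases "a \<ge> 0") auto
  moreover have "a \<noteq> 0" using *(3) by auto
  ultimately show False using *(2) by (simp add: vge_iff)
qed

lemma vge_of_nat_diff_imp:
  assumes "vge (of_nat a - of_nat b) e" "e > 0"
  shows "a mod p = b mod p"
proof -
  have "vge (of_int (int a - int b)) e" using assms by simp
  from vge_of_int_iff[OF this assms(2)] have "int a mod int p = int b mod int p"
    by (simp add: mod_eq_dvd_iff)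
  then show ?thesis by (metis nat_int zmod_int)
qed

section \<open>Limits in the valuation topology and completeness\<close>

definition limK :: "(nat \<Rightarrow> 'k) \<Rightarrow> 'k \<Rightarrow> bool" where
  "limK x l \<longleftrightarrow> (\<forall>e. \<forall>\<^sub>F n in sequentially. vge (x n - l) e)"

lemma lim_v_iff: "lim_v v x l \<longleftrightarrow> limK x l"
  by (simp add: lim_v_def limK_def vge_def eventually_sequentially)

lemma limK_unique: "limK x l \<Longrightarrow> limK x l' \<Longrightarrow> l = l'"
proof -
  assume *: "limK x l" "limK x l'"
  have "vge (l - l') e" for e
  proof -
    have "\<forall>\<^sub>F n in sequentially. vge (x n - l) e \<and> vge (x n - l') e"
      using * unfolding limK_def by (intro eventually_conj) auto
    then obtain n where "vge (x n - l) e" "vge (x n - l') e"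
      by (auto simp: eventually_sequentially)
    then show ?thesis using vge_diff[of "x n - l'" e "x n - l"] by simp
  qed
  then show ?thesis using vge_all_imp_0[of "l - l'"] by simp
qed

lemma The_limK: "limK x l \<Longrightarrow> (THE l. lim_v v x l) = l"
  unfolding lim_v_iff using limK_unique by blast

lemma limK_const: "limK (\<lambda>n. l) l"
  by (simp add: limK_def)

lemma limK_add: "limK x l \<Longrightarrow> limK y m \<Longrightarrow> limK (\<lambda>n. x n + y n) (l + m)"
proof (unfold limK_def, intro allI)
  fix e
  assume *: "\<forall>e. \<forall>\<^sub>F n in sequentially. vge (x n - l) e" "\<forall>e. \<forall>\<^sub>F n in sequentially. vge (y n - m) e"
  show "\<forall>\<^sub>F n in sequentially. vge (x n + y n - (l + m)) e"
    using *(1)[rule_format, of e] *(2)[rule_format, of e]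
  proof eventually_elim
    case (elim n)
    then show ?case using vge_add[of "x n - l" e "y n - m"] by (simp add: algebra_simps)
  qed
qed

lemma limK_cmult: "limK x l \<Longrightarrow> limK (\<lambda>n. c * x n) (c * l)"
proof (unfold limK_def, intro allI)
  fix e
  assume *: "\<forall>e. \<forall>\<^sub>F n in sequentially. vge (x n - l) e"
  show "\<forall>\<^sub>F n in sequentially. vge (c * x n - c * l) e"
    using *[rule_format, of "e - val c"]
  proof eventually_elim
    case (elim n)
    then show ?case using vge_mult[OF vge_val[of c] elim] by (simp add: algebra_simps)
  qed
qed

lemma limK_closed: "limK x l \<Longrightarrow> \<forall>\<^sub>F n in sequentially. vge (x n - a) b \<Longrightarrow> vge (l - a) b"
proof -
  assume *: "limK x l" "\<forall>\<^sub>F n in sequentially. vge (x n - a) b"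
  have "\<forall>\<^sub>F n in sequentially. vge (x n - l) b \<and> vge (x n - a) b"
    using * unfolding limK_def by (intro eventually_conj) auto
  then obtain n where "vge (x n - l) b" "vge (x n - a) b"
    by (auto simp: eventually_sequentially)
  then show ?thesis using vge_diff[of "x n - a" b "x n - l"] by simp
qed

text \<open>Consecutive differences suffice: by the ultrametric inequality a telescoping sum is no
  worse than its worst term, so the bound for x (N + i) - x N does not deteriorate with i.\<close>

lemma complete_Cauchy:
  assumes "\<And>e. \<forall>\<^sub>F n in sequentially. vge (x (Suc n) - x n) e"
  obtains l where "limK x l"
proof -
  have "\<exists>N. \<forall>m\<ge>N. \<forall>n\<ge>N. v (x m - x n) \<ge> ereal e" for e :: real
  proof -
    obtain N where N: "\<And>n. n \<ge> N \<Longrightarrow> vge (x (Suc n) - x n) e"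
      using assms[of e] by (auto simp: eventually_sequentially)
    have *: "vge (x (N + i) - x N) e" for i
    proof (induction i)
      case (Suc i)
      show ?case using vge_trans_diff[OF N[of "N + i"] Suc] by simp
    qed simp
    have "vge (x m - x n) e" if "m \<ge> N" "n \<ge> N" for m n
      using vge_trans_diff[OF *[of "m - N"] *[of "n - N", unfolded vge_diff_commute[of _ "x N"]]] that by simp
    then show ?thesis unfolding vge_def by blast
  qed
  then obtain l where "lim_v v x l" using Cp unfolding Cp_field_def by blast
  then show ?thesis using that lim_v_iff by blast
qed


section \<open>Gauss bounds and evaluation of power series\<close>

lemma limK_mult:
  assumes "limK x l" "limK y m"
  shows "limK (\<lambda>n. x n * y n) (l * m)"
proof -
  have "limK (\<lambda>n. (x n - l) * (y n - m)) 0"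
    unfolding limK_def
  proof
    fix e
    have "\<forall>\<^sub>F n in sequentially. vge (x n - l) e \<and> vge (y n - m) 0"
      using assms unfolding limK_def by (intro eventually_conj) auto
    then show "\<forall>\<^sub>F n in sequentially. vge ((x n - l) * (y n - m) - 0) e"
      by eventually_elim (use vge_mult[of _ e _ 0] in auto)
  qed
  from limK_add[OF limK_add[OF this limK_cmult[OF assms(2), of l]] limK_cmult[OF assms(1), of m]]
  have "limK (\<lambda>n. x n * y n + l * m) (l * m + l * m)"
    by (simp add: algebra_simps)
  from limK_add[OF this limK_const[of "- (l * m)"]] show ?thesis by simp
qed

lemma limK_diff: "limK x l \<Longrightarrow> limK y m \<Longrightarrow> limK (\<lambda>n. x n - y n) (l - m)"
  using limK_add[of x l "\<lambda>n. - 1 * y n" "- m"] limK_cmult[of y m "-1"] by simp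

lemma limK_vge: "limK x l \<Longrightarrow> (\<And>n. vge (x n) b) \<Longrightarrow> vge l b"
  using limK_closed[of x l 0 b] by simp

lemma limK_power: "limK x l \<Longrightarrow> limK (\<lambda>n. x n ^ k) (l ^ k)"
  by (induction k) (auto intro: limK_const limK_mult)

lemma eventually_linear_ge:
  "c > 0 \<Longrightarrow> \<forall>\<^sub>F n in sequentially. e \<le> B + real n * c"
proof -
  assume "c > 0"
  then show ?thesis
    unfolding eventually_sequentially
    by (intro exI[of _ "nat \<lceil>(e - B) / c\<rceil>"]) (auto simp: field_simps nat_le_iff ceiling_le_iff)
qed

text \<open>\<open>gauss_ge \<rho> B f\<close>: on the circle of elements of valuation \<open>\<rho>\<close> the Gauss valuation of
  \<open>f\<close> is at least \<open>B\<close>.\<close>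

definition gauss_ge :: "real \<Rightarrow> real \<Rightarrow> 'k fps \<Rightarrow> bool" where
  "gauss_ge \<rho> B f \<longleftrightarrow> (\<forall>k. vge (fps_nth f k) (B - real k * \<rho>))"

lemma gauss_ge_mono: "gauss_ge \<rho> B f \<Longrightarrow> C \<le> B \<Longrightarrow> gauss_ge \<rho> C f"
  unfolding gauss_ge_def by (meson diff_right_mono vge_mono)

lemma gauss_ge_nth: "gauss_ge \<rho> B f \<Longrightarrow> vge (fps_nth f k) (B - real k * \<rho>)"
  by (simp add: gauss_ge_def)

lemma gauss_ge_0 [simp]: "gauss_ge \<rho> B 0"
  by (simp add: gauss_ge_def)

lemma gauss_ge_add: "gauss_ge \<rho> B f \<Longrightarrow> gauss_ge \<rho> B g \<Longrightarrow> gauss_ge \<rho> B (f + g)"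
  by (auto simp: gauss_ge_def intro: vge_add)

lemma gauss_ge_diff: "gauss_ge \<rho> B f \<Longrightarrow> gauss_ge \<rho> B g \<Longrightarrow> gauss_ge \<rho> B (f - g)"
  by (auto simp: gauss_ge_def intro: vge_diff)

lemma gauss_ge_diff_commute: "gauss_ge \<rho> B (f - g) \<longleftrightarrow> gauss_ge \<rho> B (g - f)"
  by (simp add: gauss_ge_def vge_diff_commute)

lemma gauss_ge_sum: "(\<And>i. i \<in> A \<Longrightarrow> gauss_ge \<rho> B (f i)) \<Longrightarrow> gauss_ge \<rho> B (\<Sum>i\<in>A. f i)"
  by (induction A rule: infinite_finite_induct) (auto intro: gauss_ge_add)

lemma gauss_ge_mult: "gauss_ge \<rho> B f \<Longrightarrow> gauss_ge \<rho> C g \<Longrightarrow> gauss_ge \<rho> (B + C) (f * g)"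
  unfolding gauss_ge_def fps_mult_nth
proof (intro allI vge_sum)
  fix k i :: nat
  assume *: "\<forall>k. vge (f $ k) (B - real k * \<rho>)" "\<forall>k. vge (g $ k) (C - real k * \<rho>)" "i \<in> {0..k}"
  have "vge (f $ i * g $ (k - i)) ((B - real i * \<rho>) + (C - real (k - i) * \<rho>))"
    using *(1,2) by (intro vge_mult) blast+
  also have "(B - real i * \<rho>) + (C - real (k - i) * \<rho>) = B + C - real k * \<rho>"
    using *(3) by (simp add: of_nat_diff algebra_simps)
  finally show "vge (f $ i * g $ (k - i)) (B + C - real k * \<rho>)" .
qed

lemma gauss_ge_const: "vge c B \<Longrightarrow> gauss_ge \<rho> B (fps_const c)"
  by (auto simp: gauss_ge_def)

lemma gauss_ge_1: "gauss_ge \<rho> 0 1"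
  using gauss_ge_const[OF vge_1] by simp

lemma gauss_ge_prod:
  "(\<And>i. i \<in> A \<Longrightarrow> gauss_ge \<rho> (B i) (f i)) \<Longrightarrow> gauss_ge \<rho> (\<Sum>i\<in>A. B i) (\<Prod>i\<in>A. f i)"
  by (induction A rule: infinite_finite_induct) (auto intro: gauss_ge_mult gauss_ge_1)

lemma gauss_ge_X: "gauss_ge \<rho> \<rho> fps_X"
  by (auto simp: gauss_ge_def fps_X_def vge_1)

lemma gauss_ge_linear: "gauss_ge \<rho> (min \<rho> (val a)) (fps_X - fps_const a)"
  by (intro gauss_ge_diff gauss_ge_mono[OF gauss_ge_X] gauss_ge_mono[OF gauss_ge_const[OF vge_val]]) auto

text \<open>A Gauss bound at every positive radius is the form of convergence on the open disc that
  sums, products and quotients inherit directly. It gives \<open>conv_disc\<close>, because a bound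
  at \<rho> makes the terms tend to 0 at points of valuation larger than \<rho>.\<close>

definition disc_conv :: "'k fps \<Rightarrow> bool" where
  "disc_conv f \<longleftrightarrow> (\<forall>\<rho>>0. \<exists>B. gauss_ge \<rho> B f)"

lemma disc_conv_add: "disc_conv f \<Longrightarrow> disc_conv g \<Longrightarrow> disc_conv (f + g)"
  unfolding disc_conv_def by (meson gauss_ge_add gauss_ge_mono min.cobounded1 min.cobounded2)

lemma disc_conv_diff: "disc_conv f \<Longrightarrow> disc_conv g \<Longrightarrow> disc_conv (f - g)"
  unfolding disc_conv_def by (meson gauss_ge_diff gauss_ge_mono min.cobounded1 min.cobounded2)

lemma disc_conv_mult: "disc_conv f \<Longrightarrow> disc_conv g \<Longrightarrow> disc_conv (f * g)"
  unfolding disc_conv_def by (meson gauss_ge_mult)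

lemma disc_conv_const: "disc_conv (fps_const c)"
  unfolding disc_conv_def using gauss_ge_const[OF vge_val] by blast

lemma disc_conv_X: "disc_conv fps_X"
  unfolding disc_conv_def using gauss_ge_X by blast

lemma disc_conv_linear: "disc_conv (fps_X - fps_const a)"
  by (intro disc_conv_diff disc_conv_X disc_conv_const)

lemma disc_conv_prod: "(\<And>i. i \<in> A \<Longrightarrow> disc_conv (f i)) \<Longrightarrow> disc_conv (\<Prod>i\<in>A. f i)"
proof (induction A rule: infinite_finite_induct)
  case (insert x F) then show ?case by (auto intro: disc_conv_mult)
qed (use disc_conv_const[of 1] in auto)

definition psum :: "'k fps \<Rightarrow> 'k \<Rightarrow> nat \<Rightarrow> 'k" where
  "psum f x N = (\<Sum>k<N. fps_nth f k * x ^ k)"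

lemma gauss_ge_term: "gauss_ge \<rho> B f \<Longrightarrow> vge x \<sigma> \<Longrightarrow> vge (fps_nth f k * x ^ k) (B + real k * (\<sigma> - \<rho>))"
  using vge_mult[of "fps_nth f k" "B - real k * \<rho>" "x ^ k" "real k * \<sigma>"] vge_power[of x \<sigma> k]
  by (simp add: gauss_ge_def algebra_simps)

lemma limK_peval:
  assumes "disc_conv f" "vge x \<sigma>" "\<sigma> > 0"
  shows "limK (psum f x) (peval v f x)"
proof -
  \<comment> \<open>The bound is taken at \<sigma>/2 so that the n-th term at x has valuation at
    least B + n \<sigma>/2; a bound at \<sigma> itself would only keep the terms bounded.\<close>
  obtain B where B: "gauss_ge (\<sigma>/2) B f" using assms unfolding disc_conv_def by (meson half_gt_zero)
  have "\<forall>\<^sub>F n in sequentially. vge (psum f x (Suc n) - psum f x n) e" for e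
    using eventually_linear_ge[OF half_gt_zero[OF assms(3)], of e B]
  proof eventually_elim
    case (elim n)
    have "vge (fps_nth f n * x ^ n) e"
      by (rule vge_mono[OF gauss_ge_term[OF B assms(2)]]) (use elim in simp)
    then show ?case by (simp add: psum_def)
  qed
  then obtain l where l: "limK (psum f x) l" by (rule complete_Cauchy)
  then show ?thesis using The_limK[OF l] by (simp add: peval_def psum_def[abs_def])
qed

lemma conv_disc_if_disc_conv: "disc_conv f \<Longrightarrow> conv_disc v f"
  unfolding conv_disc_def
proof (intro allI impI)
  fix x assume *: "disc_conv f" "v x > 0"
  obtain \<sigma> where "\<sigma> > 0" "vge x \<sigma>"
  proof (cases "x = 0")
    case True
    then show ?thesis using that[of 1] by simp
  next
    case False
    then show ?thesis using that[of "val x"] * by (simp add: vge_val v_eq_val)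
  qed
  from limK_peval[OF *(1) this(2,1)] show "\<exists>l. lim_v v (\<lambda>N. \<Sum>k<N. f $ k * x ^ k) l"
    by (auto simp: lim_v_iff psum_def[abs_def])
qed

context
  fixes x :: 'k and \<sigma> :: real
  assumes x: "vge x \<sigma>" and \<sigma>: "\<sigma> > 0"
begin

lemma peval_eqI: "disc_conv f \<Longrightarrow> limK (psum f x) l \<Longrightarrow> peval v f x = l"
  using limK_peval[OF _ x \<sigma>] limK_unique by blast

lemma peval_add: "disc_conv f \<Longrightarrow> disc_conv g \<Longrightarrow> peval v (f + g) x = peval v f x + peval v g x"
  using limK_add[OF limK_peval[OF _ x \<sigma>] limK_peval[OF _ x \<sigma>], of f g]
  by (intro peval_eqI disc_conv_add) (auto simp: psum_def[abs_def] sum.distrib algebra_simps)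

lemma peval_diff: "disc_conv f \<Longrightarrow> disc_conv g \<Longrightarrow> peval v (f - g) x = peval v f x - peval v g x"
  using limK_diff[OF limK_peval[OF _ x \<sigma>] limK_peval[OF _ x \<sigma>], of f g]
  by (intro peval_eqI disc_conv_diff) (auto simp: psum_def[abs_def] sum_subtractf algebra_simps)

lemma peval_const: "peval v (fps_const c) x = c"
proof (rule peval_eqI[OF disc_conv_const])
  have "psum (fps_const c) x (Suc N) = c" for N
    unfolding psum_def by (induction N) auto
  then have "\<forall>\<^sub>F n in sequentially. psum (fps_const c) x n = c"
    unfolding eventually_sequentially by (intro exI[of _ 1]) (metis Suc_le_D One_nat_def)
  then show "limK (psum (fps_const c) x) c"
    unfolding limK_def by (auto elim: eventually_mono)
qed

lemma peval_X: "peval v fps_X x = x"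
proof (rule peval_eqI[OF disc_conv_X])
  have "psum fps_X x (Suc (Suc N)) = x" for N
    unfolding psum_def by (induction N) auto
  then have "\<forall>\<^sub>F n in sequentially. psum fps_X x n = x"
    unfolding eventually_sequentially by (intro exI[of _ 2]) (metis Suc_le_D numeral_2_eq_2 Suc_le_mono)
  then show "limK (psum fps_X x) x"
    unfolding limK_def by (auto elim: eventually_mono)
qed

lemma peval_linear: "peval v (fps_X - fps_const a) x = x - a"
  by (simp add: peval_diff disc_conv_X disc_conv_const peval_X peval_const)

text \<open>The product of the partial sums runs over a square of index pairs, the partial sum of
  the product over the triangle i + j < N. The remaining pairs have i + j \<ge> N, and with Gauss
  bounds at \<sigma>/2 each of their terms has valuation at least B + C + N \<sigma>/2.\<close>

lemma peval_mult:
  assumes "disc_conv f" "disc_conv g"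
  shows "peval v (f * g) x = peval v f x * peval v g x"
proof (rule peval_eqI[OF disc_conv_mult[OF assms]])
  obtain B C where B: "gauss_ge (\<sigma>/2) B f" and C: "gauss_ge (\<sigma>/2) C g"
    using assms \<sigma> unfolding disc_conv_def by (meson half_gt_zero)
  define t where "t = (\<lambda>i j. (fps_nth f i * x ^ i) * (fps_nth g j * x ^ j))"
  have 1: "psum (f * g) x N = (\<Sum>(i,j)\<in>{(i,j). i + j < N}. t i j)" for N
    unfolding sum.triangle_reindex psum_def fps_mult_nth t_def
    by (intro sum.cong refl)
      (auto simp: sum_distrib_left atLeast0AtMost mult_ac power_add[symmetric] intro!: sum.cong)
  have 2: "psum f x N * psum g x N = (\<Sum>(i,j)\<in>{..<N}\<times>{..<N}. t i j)" for N
    unfolding psum_def t_def by (simp add: sum_product sum.cartesian_product)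
  have 3: "psum f x N * psum g x N - psum (f * g) x N
      = (\<Sum>(i,j)\<in>{..<N}\<times>{..<N} - {(i,j). i + j < N}. t i j)" for N
    unfolding 1 2 by (subst sum_diff) auto
  have 4: "vge (psum f x N * psum g x N - psum (f * g) x N) (B + C + real N * (\<sigma>/2))" for N
    unfolding 3
  proof (rule vge_sum)
    fix ij assume "ij \<in> {..<N} \<times> {..<N} - {(i, j). i + j < N}"
    then obtain i j where ij: "ij = (i, j)" "\<not> i + j < N" by (cases ij) auto
    have "vge (t i j) ((B + real i * (\<sigma> - \<sigma>/2)) + (C + real j * (\<sigma> - \<sigma>/2)))"
      unfolding t_def by (intro vge_mult gauss_ge_term B C x)
    moreover have "real N * (\<sigma>/2) \<le> (real i + real j) * (\<sigma>/2)"
      using ij(2) \<sigma> by (intro mult_right_mono) auto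
    ultimately show "vge (case ij of (i, j) \<Rightarrow> t i j) (B + C + real N * (\<sigma>/2))"
      unfolding ij by (auto elim!: vge_mono simp: algebra_simps)
  qed
  have "limK (\<lambda>N. psum f x N * psum g x N - psum (f * g) x N) 0"
    unfolding limK_def
  proof
    fix e
    show "\<forall>\<^sub>F N in sequentially. vge (psum f x N * psum g x N - psum (f * g) x N - 0) e"
      using eventually_linear_ge[OF half_gt_zero[OF \<sigma>], of e "B + C"]
      by eventually_elim (auto intro: vge_mono[OF 4])
  qed
  from limK_diff[OF limK_mult[OF limK_peval limK_peval] this, OF assms(1) x \<sigma> assms(2) x \<sigma>]
  show "limK (psum (f * g) x) (peval v f x * peval v g x)" by simp
qed

lemma peval_prod:
  "(\<And>i. i \<in> A \<Longrightarrow> disc_conv (f i)) \<Longrightarrow> peval v (\<Prod>i\<in>A. f i) x = (\<Prod>i\<in>A. peval v (f i) x)"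
proof (induction A rule: infinite_finite_induct)
  case (insert y F)
  then show ?case by (auto simp: peval_mult disc_conv_prod)
qed (use peval_const[of 1] in auto)

lemma peval_vge:
  assumes "disc_conv f" "gauss_ge \<sigma> B f"
  shows "vge (peval v f x) B"
proof (rule limK_vge[OF limK_peval[OF assms(1) x \<sigma>]])
  show "vge (psum f x n) B" for n
    unfolding psum_def using gauss_ge_term[OF assms(2) x] by (intro vge_sum) simp
qed

end

text \<open>Convergence in every Gauss norm, i.e. uniformly on every smaller closed disc.\<close>

definition glim :: "(nat \<Rightarrow> 'k fps) \<Rightarrow> 'k fps \<Rightarrow> bool" where
  "glim F f \<longleftrightarrow> (\<forall>\<rho>>0. \<forall>e. \<forall>\<^sub>F n in sequentially. gauss_ge \<rho> e (F n - f))"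

lemma glim_nth: "glim F f \<Longrightarrow> limK (\<lambda>n. fps_nth (F n) k) (fps_nth f k)"
  unfolding limK_def
proof
  fix e assume *: "glim F f"
  have "\<forall>\<^sub>F n in sequentially. gauss_ge 1 (e + real k) (F n - f)"
    using * unfolding glim_def by simp
  then show "\<forall>\<^sub>F n in sequentially. vge (F n $ k - f $ k) e"
    by eventually_elim (auto dest: gauss_ge_nth[where k = k])
qed

lemma glim_unique: "glim F f \<Longrightarrow> glim F g \<Longrightarrow> f = g"
  by (rule fps_ext) (meson glim_nth limK_unique)

lemma glim_const: "glim (\<lambda>n. f) f"
  by (simp add: glim_def)

lemma glim_gauss_ge: "glim F f \<Longrightarrow> \<forall>\<^sub>F n in sequentially. gauss_ge \<rho> B (F n) \<Longrightarrow> gauss_ge \<rho> B f"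
  unfolding gauss_ge_def
proof
  fix k
  assume *: "glim F f" "\<forall>\<^sub>F n in sequentially. \<forall>k. vge (F n $ k) (B - real k * \<rho>)"
  have "\<forall>\<^sub>F n in sequentially. vge (F n $ k) (B - real k * \<rho>)"
    using *(2) by eventually_elim blast
  with *(1) show "vge (f $ k) (B - real k * \<rho>)"
    using limK_closed[OF glim_nth, of F f k 0 "B - real k * \<rho>"] by simp
qed

lemma glim_disc_conv: "glim F f \<Longrightarrow> (\<And>n. disc_conv (F n)) \<Longrightarrow> disc_conv f"
  unfolding disc_conv_def
proof (intro allI impI)
  fix \<rho> :: real assume *: "glim F f" "\<And>n. \<forall>\<rho>>0. \<exists>B. gauss_ge \<rho> B (F n)" "\<rho> > 0"
  then obtain n where n: "gauss_ge \<rho> 0 (F n - f)"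
    unfolding glim_def by (meson eventually_sequentially order_refl)
  obtain B where "gauss_ge \<rho> B (F n)" using * by blast
  then have "gauss_ge \<rho> (min 0 B) (F n - (F n - f))"
    by (intro gauss_ge_diff[OF gauss_ge_mono gauss_ge_mono[OF n]]) auto
  then show "\<exists>B. gauss_ge \<rho> B f" by auto
qed

text \<open>Each coefficient converges by completeness. The convergence is uniform because the
  telescoped bound on F m - F n holds for all m \<ge> n \<ge> N and, being a condition on single
  coefficients, survives letting m tend to infinity.\<close>

lemma glim_complete:
  assumes "\<And>\<rho> e. \<rho> > 0 \<Longrightarrow> \<forall>\<^sub>F n in sequentially. gauss_ge \<rho> e (F (Suc n) - F n)"
  obtains f where "glim F f"
proof -
  have "\<exists>l. limK (\<lambda>n. fps_nth (F n) k) l" for k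
  proof -
    have "\<forall>\<^sub>F n in sequentially. vge (F (Suc n) $ k - F n $ k) e" for e
    proof -
      have "\<forall>\<^sub>F n in sequentially. gauss_ge 1 (e + real k) (F (Suc n) - F n)" by (rule assms) simp
      then show ?thesis by eventually_elim (auto dest: gauss_ge_nth[where k = k])
    qed
    then show ?thesis by (rule complete_Cauchy) blast
  qed
  then obtain l where l: "\<And>k. limK (\<lambda>n. fps_nth (F n) k) (l k)" by metis
  have "glim F (Abs_fps l)"
    unfolding glim_def
  proof (intro allI impI)
    fix \<rho> e :: real assume "\<rho> > 0"
    then obtain N where N: "\<And>n. n \<ge> N \<Longrightarrow> gauss_ge \<rho> e (F (Suc n) - F n)"
      using assms[of \<rho> e] by (auto simp: eventually_sequentially)
    have tel: "gauss_ge \<rho> e (F (n + i) - F n)" if "n \<ge> N" for n i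
    proof (induction i)
      case (Suc i)
      have "gauss_ge \<rho> e ((F (Suc (n + i)) - F (n + i)) + (F (n + i) - F n))"
        using Suc that by (intro gauss_ge_add N) auto
      then show ?case by simp
    qed simp
    have "gauss_ge \<rho> e (F n - Abs_fps l)" if n: "n \<ge> N" for n
      unfolding gauss_ge_diff_commute[of _ _ "F n"]
    proof (unfold gauss_ge_def, rule allI)
      fix k
      have "\<forall>\<^sub>F m in sequentially. vge (F m $ k - F n $ k) (e - real k * \<rho>)"
        unfolding eventually_sequentially
      proof (intro exI allI impI)
        fix m assume "m \<ge> n"
        then show "vge (F m $ k - F n $ k) (e - real k * \<rho>)"
          using gauss_ge_nth[OF tel[OF n, of "m - n"], of k] by simp
      qed
      from limK_closed[OF l this] show "vge ((Abs_fps l - F n) $ k) (e - real k * \<rho>)" by simp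
    qed
    then show "\<forall>\<^sub>F n in sequentially. gauss_ge \<rho> e (F n - Abs_fps l)"
      by (auto simp: eventually_sequentially)
  qed
  then show ?thesis by (rule that)
qed

lemma glim_mult:
  assumes "glim F f" "glim G g" "disc_conv f" "disc_conv g"
  shows "glim (\<lambda>n. F n * G n) (f * g)"
  unfolding glim_def
proof (intro allI impI)
  fix \<rho> e :: real assume \<rho>: "\<rho> > 0"
  obtain B C where B: "gauss_ge \<rho> B f" and C: "gauss_ge \<rho> C g"
    using assms \<rho> unfolding disc_conv_def by blast
  \<comment> \<open>The two maxima serve three summands: e + 0 for the product of the differences, B
    + (e - B) and (e - C) + C for the mixed terms.\<close>
  have "\<forall>\<^sub>F n in sequentially. gauss_ge \<rho> (max e (e - C)) (F n - f) \<and> gauss_ge \<rho> (max 0 (e - B)) (G n - g)"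
    using assms \<rho> unfolding glim_def by (intro eventually_conj) auto
  then show "\<forall>\<^sub>F n in sequentially. gauss_ge \<rho> e (F n * G n - f * g)"
  proof eventually_elim
    case (elim n)
    have "F n * G n - f * g = (F n - f) * (G n - g) + (f * (G n - g) + (F n - f) * g)"
      by (simp add: algebra_simps)
    moreover have "gauss_ge \<rho> e ((F n - f) * (G n - g))" "gauss_ge \<rho> e (f * (G n - g))" "gauss_ge \<rho> e ((F n - f) * g)"
      using gauss_ge_mono[OF gauss_ge_mult[OF conjunct1[OF elim] conjunct2[OF elim]], of e]
        gauss_ge_mono[OF gauss_ge_mult[OF B conjunct2[OF elim]], of e]
        gauss_ge_mono[OF gauss_ge_mult[OF conjunct1[OF elim] C], of e]
      by auto
    ultimately show ?case by (auto intro: gauss_ge_add)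
  qed
qed

lemma glim_prod:
  assumes "\<And>i. i \<in> A \<Longrightarrow> glim (F i) (f i)" "\<And>i. i \<in> A \<Longrightarrow> disc_conv (f i)"
  shows "glim (\<lambda>n. \<Prod>i\<in>A. F i n) (\<Prod>i\<in>A. f i)"
  using assms
proof (induction A rule: infinite_finite_induct)
  case (insert i A)
  have "glim (\<lambda>n. F i n * (\<Prod>i\<in>A. F i n)) (f i * prod f A)"
    using insert by (intro glim_mult disc_conv_prod) auto
  then show ?case using insert by simp
qed (auto intro: glim_const)

lemma glim_peval:
  assumes "glim F f" "\<And>n. disc_conv (F n)" "vge x \<sigma>" "\<sigma> > 0"
  shows "limK (\<lambda>n. peval v (F n) x) (peval v f x)"
  unfolding limK_def
proof
  fix e
  have f: "disc_conv f" by (rule glim_disc_conv[OF assms(1,2)])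
  have "\<forall>\<^sub>F n in sequentially. gauss_ge \<sigma> e (F n - f)" using assms unfolding glim_def by blast
  then show "\<forall>\<^sub>F n in sequentially. vge (peval v (F n) x - peval v f x) e"
  proof eventually_elim
    case (elim n)
    then show ?case
      using peval_vge[OF assms(3,4) disc_conv_diff[OF assms(2) f]] peval_diff[OF assms(3,4) assms(2) f] by simp
  qed
qed


section \<open>Division by zeros\<close>

text \<open>If val a \<le> \<rho>, the partial sum that defines a coefficient of g is estimated term
  by term, and its worst term is the last one; the loss is val a. If val a \<ge> \<rho>, this
  estimate is too weak, so f(a) = 0 is used to replace the partial sum by minus the tail, whose
  worst term is the next one; the loss is \<rho>.\<close>

lemma divide_linear:
  assumes "disc_conv f" "a \<noteq> 0" "val a > 0" "peval v f a = 0"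
  obtains g where "f = (fps_X - fps_const a) * g"
    "\<And>\<rho> B. gauss_ge \<rho> B f \<Longrightarrow> gauss_ge \<rho> (B - min \<rho> (val a)) g"
proof -
  \<comment> \<open>Comparing coefficients in f = (X - a) g gives f_k = g_(k-1) - a g_k, and this
    solves the recursion. The factorisation is thus formal; the vanishing of f at a enters only in
    the growth of g.\<close>
  define g where "g = Abs_fps (\<lambda>k. - psum f a (Suc k) / a ^ Suc k)"
  have "f $ k = ((fps_X - fps_const a) * g) $ k" for k
    using assms(2) by (cases k) (simp_all add: g_def left_diff_distrib psum_def field_simps)
  then have "f = (fps_X - fps_const a) * g" by (intro fps_ext) blast
  moreover have "gauss_ge \<rho> (B - min \<rho> (val a)) g" if B: "gauss_ge \<rho> B f" for \<rho> B
    unfolding gauss_ge_def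
  proof
    fix k
    have nth: "g $ k = - psum f a (Suc k) * inverse (a ^ Suc k)"
      by (simp add: g_def divide_inverse)
    have inv: "vge (inverse (a ^ Suc k)) (- (real (Suc k) * val a))"
      using assms(2) by (metis nonzero_imp_inverse_nonzero order_refl power_not_zero val_inverse val_power vge_iff)
    have tm: "vge (f $ i * a ^ i) (B + real i * (val a - \<rho>))" for i
      by (rule gauss_ge_term[OF B vge_val])
    consider "val a \<le> \<rho>" | "val a \<ge> \<rho>" by linarith
    then show "vge (g $ k) (B - min \<rho> (val a) - real k * \<rho>)"
    proof cases
      case 1
      have "vge (psum f a (Suc k)) (B + real k * (val a - \<rho>))"
        unfolding psum_def
      proof (rule vge_sum)
        fix i assume "i \<in> {..<Suc k}"
        then have "real k * (val a - \<rho>) \<le> real i * (val a - \<rho>)"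
          using 1 by (intro mult_right_mono_neg) auto
        then show "vge (f $ i * a ^ i) (B + real k * (val a - \<rho>))"
          by (intro vge_mono[OF tm]) simp
      qed
      then have "vge (g $ k) ((B + real k * (val a - \<rho>)) + - (real (Suc k) * val a))"
        unfolding nth using inv by (intro vge_mult) auto
      then show ?thesis using 1 by (simp add: algebra_simps)
    next
      case 2
      have "\<forall>\<^sub>F N in sequentially. vge (psum f a N - psum f a (Suc k)) (B + real (Suc k) * (val a - \<rho>))"
        unfolding eventually_sequentially
      proof (intro exI allI impI)
        fix N assume N: "N \<ge> Suc k"
        have "psum f a N - psum f a (Suc k) = (\<Sum>i\<in>{..<N} - {..<Suc k}. f $ i * a ^ i)"
          unfolding psum_def using N by (subst sum_diff) auto
        also have "vge \<dots> (B + real (Suc k) * (val a - \<rho>))"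
        proof (rule vge_sum)
          fix i assume "i \<in> {..<N} - {..<Suc k}"
          then have "real (Suc k) * (val a - \<rho>) \<le> real i * (val a - \<rho>)"
            using 2 by (intro mult_right_mono) auto
          then show "vge (f $ i * a ^ i) (B + real (Suc k) * (val a - \<rho>))"
            by (intro vge_mono[OF tm]) simp
        qed
        finally show "vge (psum f a N - psum f a (Suc k)) (B + real (Suc k) * (val a - \<rho>))" .
      qed
      from limK_closed[OF limK_peval[OF assms(1) vge_val assms(3)] this]
      have "vge (psum f a (Suc k)) (B + real (Suc k) * (val a - \<rho>))" using assms(4) by simp
      then have "vge (g $ k) ((B + real (Suc k) * (val a - \<rho>)) + - (real (Suc k) * val a))"
        unfolding nth using inv by (intro vge_mult) auto
      then show ?thesis using 2 by (simp add: algebra_simps)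
    qed
  qed
  ultimately show ?thesis by (rule that)
qed

text \<open>Distinctness of the points carries the induction: at a new point the product already
  split off is nonzero, so the quotient found so far still vanishes there.\<close>

lemma divide_prod:
  assumes "finite I" "inj_on a I" "disc_conv f"
    and "\<And>i. i \<in> I \<Longrightarrow> a i \<noteq> 0 \<and> val (a i) > 0 \<and> peval v f (a i) = 0"
  shows "\<exists>g. f = (\<Prod>i\<in>I. fps_X - fps_const (a i)) * g \<and>
    (\<forall>\<rho> B. gauss_ge \<rho> B f \<longrightarrow> gauss_ge \<rho> (B - (\<Sum>i\<in>I. min \<rho> (val (a i)))) g)"
  using assms
proof (induction I rule: finite_induct)
  case empty
  then show ?case by (intro exI[of _ f]) auto
next
  case (insert i I)
  then obtain g where g: "f = (\<Prod>i\<in>I. fps_X - fps_const (a i)) * g"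
    and gauss_ge_g: "\<And>\<rho> B. gauss_ge \<rho> B f \<Longrightarrow> gauss_ge \<rho> (B - (\<Sum>i\<in>I. min \<rho> (val (a i)))) g"
    by auto
  have disc_conv: "disc_conv g" using gauss_ge_g insert.prems(2) unfolding disc_conv_def by blast
  have ai: "val (a i) > 0" "a i \<noteq> 0" "peval v f (a i) = 0" using insert.prems by auto
  have "0 = (\<Prod>i'\<in>I. a i - a i') * peval v g (a i)"
    using ai(3) unfolding g
    by (simp add: peval_mult[OF vge_val ai(1)] peval_prod[OF vge_val ai(1)] disc_conv disc_conv_prod disc_conv_linear
        peval_linear[OF vge_val ai(1)])
  moreover have "(\<Prod>i'\<in>I. a i - a i') \<noteq> 0"
    using insert by (auto simp: inj_on_def)
  ultimately have "peval v g (a i) = 0" by simp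
  from divide_linear[OF disc_conv ai(2,1) this] obtain g' where g': "g = (fps_X - fps_const (a i)) * g'"
    "\<And>\<rho> B. gauss_ge \<rho> B g \<Longrightarrow> gauss_ge \<rho> (B - min \<rho> (val (a i))) g'" by blast
  show ?case
  proof (intro exI conjI allI impI)
    show "f = (\<Prod>i\<in>insert i I. fps_X - fps_const (a i)) * g'"
      using insert.hyps by (simp add: g g'(1) mult_ac)
    fix \<rho> B assume "gauss_ge \<rho> B f"
    from g'(2)[OF gauss_ge_g[OF this]] show "gauss_ge \<rho> (B - (\<Sum>i\<in>insert i I. min \<rho> (val (a i)))) g'"
      using insert.hyps by (simp add: algebra_simps)
  qed
qed


section \<open>Roots of unity of prime power order\<close>

text \<open>For k \<ge> 1 this is the p^k-th cyclotomic polynomial, the \<Phi>_k of the logarithms;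
  its degree \<open>cdeg k\<close> is the Euler function of p^k.\<close>

definition cyc :: "nat \<Rightarrow> 'k poly" where
  "cyc k = (\<Sum>i<p. monom 1 (i * p ^ (k - 1)))"

definition cdeg :: "nat \<Rightarrow> nat" where
  "cdeg k = (p - 1) * p ^ (k - 1)"

text \<open>For k = 0 the truncated subtraction makes the two conditions contradictory, so the set
  is empty there.\<close>

definition prim_roots :: "nat \<Rightarrow> 'k set" where
  "prim_roots k = {z. z ^ (p ^ k) = 1 \<and> z ^ (p ^ (k - 1)) \<noteq> 1}"

lemma cdeg_ge_2: "cdeg k \<ge> 2"
proof -
  have "2 * 1 \<le> (p - 1) * p ^ (k - 1)" using p_ge_3 by (intro mult_le_mono) auto
  then show ?thesis by (simp add: cdeg_def)
qed

lemma poly_cyc: "poly (cyc k) y = (\<Sum>i<p. (y ^ (p ^ (k - 1))) ^ i)"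
  by (simp add: cyc_def poly_sum poly_monom power_mult[symmetric] mult.commute)

lemma p_power_pred: "k \<ge> 1 \<Longrightarrow> p ^ k = p ^ (k - 1) * p"
  by (cases k) auto

text \<open>Put w = z^(p^(k-1)) in w^p - 1 = (w - 1)(1 + w + ... + w^(p-1)). At w = 1 the second
  factor is p, which is nonzero in characteristic 0.\<close>

lemma poly_cyc_eq_0_iff: "k \<ge> 1 \<Longrightarrow> poly (cyc k) z = 0 \<longleftrightarrow> z \<in> prim_roots k"
proof -
  assume k: "k \<ge> 1"
  have "z ^ (p ^ k) - 1 = (z ^ (p ^ (k - 1)) - 1) * poly (cyc k) z"
    unfolding poly_cyc p_power_pred[OF k] power_mult
    by (rule power_diff_1_eq)
  moreover have "poly (cyc k) z \<noteq> 0" if "z ^ (p ^ (k - 1)) = 1"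
    using that by (simp add: poly_cyc)
  ultimately show ?thesis by (auto simp: prim_roots_def)
qed

lemma coeff_cyc_top: "coeff (cyc k) (cdeg k) = 1"
proof -
  have "coeff (cyc k) (cdeg k) = (\<Sum>i<p. if i = p - 1 then 1 else 0)"
    unfolding cyc_def coeff_sum by (intro sum.cong) (auto simp: cdeg_def)
  then show ?thesis by simp
qed

lemma degree_cyc_le: "degree (cyc k) \<le> cdeg k"
  unfolding cyc_def cdeg_def
  by (intro degree_sum_le) (auto intro!: order_trans[OF degree_monom_le] mult_le_mono1)

lemma degree_cyc: "degree (cyc k) = cdeg k"
  using degree_cyc_le[of k] le_degree[of "cyc k" "cdeg k"] coeff_cyc_top[of k] by simp

lemma cyc_nz: "cyc k \<noteq> 0"
  using coeff_cyc_top[of k] by auto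

lemma prim_roots_nonempty: "k \<ge> 1 \<Longrightarrow> \<exists>z. z \<in> prim_roots k"
proof -
  assume k: "k \<ge> 1"
  have "degree (cyc k) > 0" using cdeg_ge_2[of k] by (simp add: degree_cyc)
  then show ?thesis using Cp poly_cyc_eq_0_iff[OF k] unfolding Cp_field_def by blast
qed

lemma prim_roots_nz: "z \<in> prim_roots k \<Longrightarrow> z \<noteq> 0"
  by (auto simp: prim_roots_def power_0_left split: if_splits)

lemma root_of_unity_val:
  assumes "z ^ n = 1" "n > 0"
  shows "z \<noteq> 0" "val z = 0"
proof -
  show z: "z \<noteq> 0" using assms by (auto simp: power_0_left)
  show "val z = 0" using val_power[OF z, of n] assms by simp
qed

text \<open>By Bezout, z is killed by the gcd of n and p^k, which is some p^s; s < k would give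
  z^(p^(k-1)) = 1.\<close>

lemma prim_roots_power_eq_1_iff:
  assumes z: "z \<in> prim_roots k"
  shows "z ^ n = 1 \<longleftrightarrow> p ^ k dvd n"
proof
  assume "p ^ k dvd n"
  then show "z ^ n = 1" using z by (auto simp: prim_roots_def power_mult)
next
  assume n: "z ^ n = 1"
  show "p ^ k dvd n"
  proof (cases "n = 0")
    case False
    define g where "g = gcd n (p ^ k)"
    from bezout_nat[OF False, of "p ^ k"] obtain x y where xy: "n * x = p ^ k * y + g"
      unfolding g_def by blast
    have "z ^ (n * x) = 1" "z ^ (p ^ k * y) = 1"
      using n z by (auto simp: power_mult prim_roots_def)
    then have g1: "z ^ g = 1" unfolding xy power_add by simp
    have "g dvd p ^ k" by (simp add: g_def)
    then obtain s where s: "s \<le> k" "g = p ^ s" using divides_primepow_nat[OF prime_p] by blast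
    have "s = k"
    proof (rule ccontr)
      assume "s \<noteq> k"
      then have "p ^ s dvd p ^ (k - 1)" using s by (intro le_imp_power_dvd) auto
      then have "z ^ (p ^ (k - 1)) = 1" using g1 s(2) by (auto simp: power_mult)
      then show False using z by (simp add: prim_roots_def)
    qed
    then have "g = p ^ k" using s by simp
    then show ?thesis unfolding g_def by (metis gcd_dvd1)
  qed simp
qed

text \<open>A count: the listed powers are distinct primitive roots, there are \<open>cdeg k\<close>
  of them, and \<open>cyc k\<close> has no more roots than its degree. Hence the roots of
  \<open>cyc k\<close> are simple and each is a power of any other.\<close>

lemma prim_roots_eq_powers:
  assumes k: "k \<ge> 1" and z: "z \<in> prim_roots k"
  shows "prim_roots k = (\<lambda>i. z ^ i) ` {i. i < p ^ k \<and> \<not> p dvd i}" (is "_ = _ ` ?E")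
    and "finite (prim_roots k)" "card (prim_roots k) = cdeg k"
proof -
  have roots: "prim_roots k = {x. poly (cyc k) x = 0}" using poly_cyc_eq_0_iff[OF k] by auto
  then show fin: "finite (prim_roots k)" using poly_roots_finite[OF cyc_nz] by simp
  have le: "card (prim_roots k) \<le> cdeg k"
    using card_poly_roots_bound[OF cyc_nz, of k] by (simp add: roots degree_cyc)
  have sub: "(\<lambda>i. z ^ i) ` ?E \<subseteq> prim_roots k"
  proof clarify
    fix i assume i: "\<not> p dvd i"
    have "z ^ (i * p ^ k) = 1" using z by (simp add: prim_roots_power_eq_1_iff)
    moreover have "\<not> p ^ k dvd i * p ^ (k - 1)"
      unfolding p_power_pred[OF k] using i by (simp add: mult.commute)
    then have "z ^ (i * p ^ (k - 1)) \<noteq> 1" using z by (simp add: prim_roots_power_eq_1_iff)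
    ultimately show "z ^ i \<in> prim_roots k" by (simp add: prim_roots_def power_mult)
  qed
  have inj: "inj_on (\<lambda>i. z ^ i) ?E"
  proof (rule linorder_inj_onI')
    fix i j assume ij: "i \<in> ?E" "j \<in> ?E" "i < j"
    show "z ^ i \<noteq> z ^ j"
    proof
      assume "z ^ i = z ^ j"
      moreover have "z ^ j = z ^ i * z ^ (j - i)" using ij(3) by (simp flip: power_add)
      ultimately have "z ^ (j - i) = 1" using prim_roots_nz[OF z] by simp
      then have "p ^ k dvd j - i" using prim_roots_power_eq_1_iff[OF z] by simp
      then show False using ij by (auto dest: dvd_imp_le)
    qed
  qed
  have "?E = {..<p ^ k} - (\<lambda>i. p * i) ` {..<p ^ (k - 1)}"
    unfolding p_power_pred[OF k] by (auto simp: mult.commute elim!: dvdE)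
  also have "card \<dots> = p ^ k - p ^ (k - 1)"
    unfolding p_power_pred[OF k]
    by (subst card_Diff_subset) (auto simp: card_image inj_on_def)
  also have "\<dots> = cdeg k" unfolding p_power_pred[OF k] cdeg_def by (simp add: algebra_simps diff_mult_distrib)
  finally have card: "card ((\<lambda>i. z ^ i) ` ?E) = cdeg k" by (simp add: card_image inj)
  then show eq: "prim_roots k = (\<lambda>i. z ^ i) ` ?E"
    using card_seteq[OF fin sub] le by simp
  show "card (prim_roots k) = cdeg k" using card eq by simp
qed

lemma finite_prim_roots: "k \<ge> 1 \<Longrightarrow> finite (prim_roots k)"
  and card_prim_roots: "k \<ge> 1 \<Longrightarrow> card (prim_roots k) = cdeg k"
  using prim_roots_nonempty prim_roots_eq_powers by metis+

lemma cyc_eq_prod: "k \<ge> 1 \<Longrightarrow> cyc k = (\<Prod>z\<in>prim_roots k. [:- z, 1:])"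
proof (rule poly_eqI_degree_lead_coeff[where n = "cdeg k" and A = "prim_roots k"])
  assume k: "k \<ge> 1"
  have deg: "degree (\<Prod>z\<in>prim_roots k. [:- z, 1:]) = cdeg k"
    by (subst degree_prod_sum_eq) (auto simp: card_prim_roots[OF k])
  have "lead_coeff (\<Prod>z\<in>prim_roots k. [:- z, 1:]) = 1"
    unfolding lead_coeff_prod by simp
  then show "coeff (cyc k) (cdeg k) = coeff (\<Prod>z\<in>prim_roots k. [:- z, 1:]) (cdeg k)"
    unfolding deg by (simp add: coeff_cyc_top)
  show "degree (\<Prod>z\<in>prim_roots k. [:- z, 1:]) \<le> cdeg k" using deg by simp
  show "cdeg k \<le> card (prim_roots k)" by (simp add: card_prim_roots[OF k])
  fix z assume z: "z \<in> prim_roots k"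
  then show "poly (cyc k) z = poly (\<Prod>z\<in>prim_roots k. [:- z, 1:]) z"
    using poly_cyc_eq_0_iff[OF k, of z] prod_zero[OF finite_prim_roots[OF k], of "\<lambda>y. z - y"]
    by (auto simp: poly_prod)
qed (rule degree_cyc_le)

lemma val_1_minus_power_ge:
  assumes "vge z 0"
  shows "vge (1 - z ^ i) (val (1 - z))"
proof -
  have "z ^ i - 1 = (z - 1) * (\<Sum>l<i. z ^ l)" by (rule power_diff_1_eq)
  then have "1 - z ^ i = (1 - z) * (\<Sum>l<i. z ^ l)" by (metis minus_diff_eq mult_minus_left)
  moreover have "vge (\<Sum>l<i. z ^ l) 0" using vge_power[OF assms] by (intro vge_sum) simp
  ultimately show ?thesis using vge_mult[OF vge_val] by fastforce
qed

lemma prim_roots_vge: "k \<ge> 1 \<Longrightarrow> z \<in> prim_roots k \<Longrightarrow> vge z 0"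
  using root_of_unity_val[of z "p ^ k"] by (auto simp: prim_roots_def vge_iff)

lemma prim_roots_neq_1: "z \<in> prim_roots k \<Longrightarrow> z \<noteq> 1"
  by (auto simp: prim_roots_def)

text \<open>Any two primitive roots are powers of each other, so each 1 - y is an integral multiple
  of each 1 - x and all these differences have the same valuation. Their product is the value of
  \<open>cyc k\<close> at 1, namely p, so \<open>cdeg k\<close> equal valuations add up to
  1.\<close>

lemma val_prim_root:
  assumes k: "k \<ge> 1" and z: "z \<in> prim_roots k"
  shows "val (z - 1) = 1 / cdeg k"
proof -
  have le: "val (1 - x) \<le> val (1 - y)" if xy: "x \<in> prim_roots k" "y \<in> prim_roots k" for x y
  proof -
    obtain i where "y = x ^ i" using prim_roots_eq_powers(1)[OF k xy(1)] xy(2) by blast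
    then have "vge (1 - y) (val (1 - x))"
      using val_1_minus_power_ge prim_roots_vge[OF k xy(1)] by blast
    then show ?thesis using prim_roots_neq_1[OF xy(2)] by (simp add: vge_iff)
  qed
  have "of_nat p = poly (cyc k) 1" by (simp add: poly_cyc)
  also have "\<dots> = (\<Prod>x\<in>prim_roots k. 1 - x)" by (simp add: cyc_eq_prod[OF k] poly_prod)
  finally have "1 = val (\<Prod>x\<in>prim_roots k. 1 - x)" using val_p by metis
  also have "\<dots> = (\<Sum>x\<in>prim_roots k. val (1 - x))"
    using prim_roots_neq_1 by (intro val_prod finite_prim_roots[OF k]) auto
  also have "\<dots> = (\<Sum>x\<in>prim_roots k. val (1 - z))"
    using le[OF z] le[OF _ z] by (intro sum.cong) (auto intro: antisym)
  finally have "1 = real (cdeg k) * val (1 - z)" by (simp add: card_prim_roots[OF k])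
  moreover have "val (z - 1) = val (1 - z)" by (metis minus_diff_eq val_uminus)
  ultimately show ?thesis by (metis mult_eq_0_iff nonzero_mult_div_cancel_left zero_neq_one)
qed

lemma prim_roots_disjoint:
  assumes "z \<in> prim_roots k" "z \<in> prim_roots l" "k \<ge> 1" "l \<ge> 1"
  shows "k = l"
proof -
  have "p ^ k dvd p ^ l" "p ^ l dvd p ^ k"
    using prim_roots_power_eq_1_iff[OF assms(1), of "p ^ l"] prim_roots_power_eq_1_iff[OF assms(2), of "p ^ l"]
      prim_roots_power_eq_1_iff[OF assms(1), of "p ^ k"] prim_roots_power_eq_1_iff[OF assms(2), of "p ^ k"]
    by simp_all
  then have "p ^ k = p ^ l" by (rule dvd_antisym)
  moreover have "1 < p" using p_ge_3 by simp
  ultimately show ?thesis using power_inject_exp by blast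
qed

lemma one_plus_X_power_nth: "((1 + fps_X :: 'k fps) ^ N) $ n = of_nat (N choose n)"
  by (simp flip: fps_binomial_of_nat add: binomial_gbinomial)

lemma Phi_shift_eq_sum:
  fixes g :: 'k
  assumes "g \<noteq> 0"
  shows "Phi_shift p g k j = (\<Sum>i<p. (fps_const (g powi (- j)) * (1 + fps_X)) ^ (i * p ^ (k - 1)))"
proof (rule fps_ext)
  fix n
  have "g powi (- (j * int (i * p ^ (k - 1)))) = (g powi (- j)) ^ (i * p ^ (k - 1))" for i
    using power_int_mult[of g "- j" "int (i * p ^ (k - 1))"]
    by (metis mult_minus_left power_int_of_nat)
  then show "Phi_shift p g k j $ n =
      (\<Sum>i<p. (fps_const (g powi (- j)) * (1 + fps_X)) ^ (i * p ^ (k - 1))) $ n"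
    by (simp only: Phi_shift_def fps_nth_Abs_fps fps_sum_nth power_mult_distrib fps_const_power
        fps_mult_left_const_nth one_plus_X_power_nth)
qed

text \<open>With u = g^(-j), the substitution Y = u (1 + X) turns the factor Y - z of
  \<open>cyc k\<close> into u (X - (g^j z - 1)); the \<open>cdeg k\<close> factors u form the
  constant.\<close>

lemma Phi_shift_eq_prod:
  fixes g :: 'k
  assumes g: "g \<noteq> 0" and k: "k \<ge> 1"
  shows "Phi_shift p g k j = fps_const ((g powi (- j)) ^ cdeg k) *
    (\<Prod>z\<in>prim_roots k. fps_X - fps_const (g powi j * z - 1))"
proof -
  define u where "u = g powi (- j)"
  have u: "u \<noteq> 0" "g powi j = inverse u" using g by (auto simp: u_def power_int_minus)
  have Y: "fps_of_poly [:u, u:] = fps_const u * (1 + fps_X)"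
    by (simp add: fps_of_poly_pCons algebra_simps)
  have "pcompose (monom 1 n) [:u, u:] = [:u, u:] ^ n" for n
    by (induction n) (simp_all add: monom_Suc pcompose_pCons monom_0 pcompose_1 one_pCons[symmetric])
  then have "Phi_shift p g k j = fps_of_poly (pcompose (cyc k) [:u, u:])"
    unfolding Phi_shift_eq_sum[OF g] cyc_def
    by (simp add: pcompose_sum fps_of_poly_sum fps_of_poly_power Y[unfolded u_def] u_def)
  also have "\<dots> = (\<Prod>z\<in>prim_roots k. fps_of_poly (pcompose [:- z, 1:] [:u, u:]))"
    by (simp only: cyc_eq_prod[OF k] pcompose_prod fps_of_poly_prod)
  also have "\<dots> = (\<Prod>z\<in>prim_roots k. fps_const u * (fps_X - fps_const (g powi j * z - 1)))"
    using u by (intro prod.cong refl fps_ext) (auto simp: pcompose_pCons fps_of_poly_pCons field_simps)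
  also have "\<dots> = fps_const (u ^ cdeg k) * (\<Prod>z\<in>prim_roots k. fps_X - fps_const (g powi j * z - 1))"
    by (simp add: prod.distrib card_prim_roots[OF k] fps_const_power)
  finally show ?thesis by (simp add: u_def)
qed


section \<open>Units and infinite products\<close>

lemma vge_power_minus_1: "vge (x - 1) b \<Longrightarrow> b \<ge> 0 \<Longrightarrow> vge (x ^ n - 1) b"
proof -
  assume *: "vge (x - 1) b" "b \<ge> 0"
  have "vge ((x - 1) + 1) 0" using * by (intro vge_add vge_1) (auto elim: vge_mono)
  then have "vge (\<Sum>l<n. x ^ l) 0" using vge_power[of x 0] by (intro vge_sum) simp
  from vge_mult[OF *(1) this] show ?thesis using power_diff_1_eq[of x n] by simp
qed

lemma geometric_sum_minus: "(\<Sum>i<n. x ^ i) - of_nat n = (\<Sum>i<n. x ^ i - (1::'b::comm_ring_1))"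
  by (simp add: sum_subtractf)

text \<open>The cofactor S = 1 + x + ... + x^(p-1) is congruent to p modulo p^2: S - p is (x - 1)
  times a quantity that is p(p-1)/2 modulo p. As p is odd, p(p-1)/2 is divisible by p, so both
  factors have valuation at least 1.\<close>

lemma val_power_p_minus_1:
  assumes "x \<noteq> 1" "val (x - 1) \<ge> 1"
  shows "x ^ p \<noteq> 1" "val (x ^ p - 1) = val (x - 1) + 1"
proof -
  define S where "S = (\<Sum>i<p. x ^ i)"
  have vx: "vge (x - 1) 1" using assms by (simp add: vge_iff)
  define D where "D = (\<Sum>i<p. \<Sum>l<i. x ^ l - 1)"
  have "S - of_nat p = (\<Sum>i<p. (x - 1) * (\<Sum>l<i. x ^ l))"
    unfolding S_def geometric_sum_minus power_diff_1_eq[of x] ..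
  also have "\<dots> = (x - 1) * (of_nat (\<Sum>i<p. i) + D)"
    by (simp add: D_def sum_distrib_left[symmetric] geometric_sum_minus[symmetric] sum_subtractf)
  finally have S: "S - of_nat p = (x - 1) * (of_nat (\<Sum>i<p. i) + D)" .
  obtain q where q: "p = 2 * q + 1" using odd_p by (rule oddE)
  have "(\<Sum>i<2 * n + 1. i) = (2 * n + 1) * n" for n :: nat
    by (induction n) (auto simp: algebra_simps)
  then have "(\<Sum>i<p. i) = p * q" unfolding q .
  then have "vge (of_nat (\<Sum>i<p. i)) 1" using vge_of_nat_dvd[of 1 "\<Sum>i<p. i"] by simp
  moreover have "vge D 1" unfolding D_def
    using vge_power_minus_1[OF vx] by (intro vge_sum) auto
  ultimately have "vge (S - of_nat p) 2"
    unfolding S using vge_mult[OF vx vge_add] by fastforce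
  from val_close[OF this] have "S \<noteq> 0" "val S = 1" by auto
  moreover have "x ^ p - 1 = (x - 1) * S" unfolding S_def by (rule power_diff_1_eq)
  ultimately show "val (x ^ p - 1) = val (x - 1) + 1" "x ^ p \<noteq> 1"
    using assms by (auto simp: val_mult)
qed

text \<open>Here the cofactor 1 + x + ... + x^(s-1) is congruent modulo p to s, a unit.\<close>

lemma val_power_coprime_minus_1:
  assumes "x \<noteq> 1" "val (x - 1) \<ge> 1" "\<not> p dvd s"
  shows "x ^ s \<noteq> 1" "val (x ^ s - 1) = val (x - 1)"
proof -
  define S where "S = (\<Sum>i<s. x ^ i)"
  have vx: "vge (x - 1) 1" using assms by (simp add: vge_iff)
  have "vge (S - of_nat s) 1"
    unfolding S_def geometric_sum_minus using vge_power_minus_1[OF vx] by (intro vge_sum) auto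
  moreover have "s \<noteq> 0" using assms(3) by (cases "s = 0") auto
  ultimately have "S \<noteq> 0" "val S = 0"
    using val_close[of S "of_nat s" 1] val_of_nat_coprime[OF assms(3)] by auto
  moreover have "x ^ s - 1 = (x - 1) * S" unfolding S_def by (rule power_diff_1_eq)
  ultimately show "val (x ^ s - 1) = val (x - 1)" "x ^ s \<noteq> 1"
    using assms by (auto simp: val_mult)
qed

lemma val_power_p_power_minus_1:
  assumes "x \<noteq> 1" "val (x - 1) \<ge> 1"
  shows "x ^ (p ^ k) \<noteq> 1 \<and> val (x ^ (p ^ k) - 1) = val (x - 1) + real k"
proof (induction k)
  case (Suc k)
  then show ?case
    using val_power_p_minus_1[of "x ^ (p ^ k)"] assms
    by (simp add: power_mult[symmetric] mult.commute)
qed (use assms in simp)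

lemma val_power_minus_1:
  assumes "x \<noteq> 1" "val (x - 1) \<ge> 1" "s > 0"
  obtains k where "p ^ k dvd s" "x ^ s \<noteq> 1" "val (x ^ s - 1) = val (x - 1) + real k"
proof -
  obtain s' where s': "s = p ^ multiplicity p s * s'" "\<not> p dvd s'"
    using multiplicity_decompose'[of s p] assms(3) p_ge_3 by auto
  define k where "k = multiplicity p s"
  note * = val_power_p_power_minus_1[OF assms(1,2), of k]
  have "val (x ^ (p ^ k) - 1) \<ge> 1" using * assms(2) by simp
  from val_power_coprime_minus_1[OF _ this s'(2)] * that[of k] show ?thesis
    using s'(1) by (metis k_def dvd_triv_left power_mult)
qed

section \<open>The p-adic integers and their unit groups inside the field\<close>

lemma Zp_iff: "x \<in> Zp v \<longleftrightarrow> (\<forall>e. \<exists>k. vge (x - of_int k) e)"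
  by (simp add: Zp_def vge_def)

lemma Zp_vge: "x \<in> Zp v \<Longrightarrow> vge x 0"
proof -
  assume "x \<in> Zp v"
  then obtain k where "vge (x - of_int k) 0" unfolding Zp_iff by blast
  from vge_add[OF this vge_of_int[of k]] show ?thesis by simp
qed

lemma Zp_of_int: "of_int k \<in> Zp v"
  unfolding Zp_iff by (metis diff_self vge_0)

lemma Zp_mult: "x \<in> Zp v \<Longrightarrow> y \<in> Zp v \<Longrightarrow> x * y \<in> Zp v"
  unfolding Zp_iff
proof
  fix e
  assume *: "\<forall>e. \<exists>k. vge (x - of_int k) e" "\<forall>e. \<exists>k. vge (y - of_int k) e"
  from *(1) have "vge x 0" using Zp_vge unfolding Zp_iff by blast
  obtain k l where kl: "vge (x - of_int k) e" "vge (y - of_int l) e" using * by metis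
  have "vge (x * (y - of_int l) + of_int l * (x - of_int k)) e"
    using vge_mult[OF \<open>vge x 0\<close> kl(2)] vge_mult[OF vge_of_int[of l] kl(1)] by (intro vge_add) auto
  then have "vge (x * y - of_int (k * l)) e" by (simp add: algebra_simps)
  then show "\<exists>k. vge (x * y - of_int k) e" by blast
qed

lemma Zpu_iff: "x \<in> Zpu v \<longleftrightarrow> x \<in> Zp v \<and> x \<noteq> 0 \<and> val x = 0"
  by (cases "x = 0") (auto simp: Zpu_def v_eq_val)

lemma Zpu_mult: "x \<in> Zpu v \<Longrightarrow> y \<in> Zpu v \<Longrightarrow> x * y \<in> Zpu v"
  by (auto simp: Zpu_iff Zp_mult val_mult)

lemma Zpu_1: "1 \<in> Zpu v"
  using Zp_of_int[of 1] by (auto simp: Zpu_iff)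

lemma Zpu_power: "x \<in> Zpu v \<Longrightarrow> x ^ n \<in> Zpu v"
  by (induction n) (auto intro: Zpu_1 Zpu_mult)

lemma Um_iff: "x \<in> Um v m \<longleftrightarrow> x \<in> Zpu v \<and> vge (x - 1) (real m)"
  by (simp add: Um_def vge_def)

section \<open>Convergent infinite products\<close>

lemma gauss_ge_power_minus_1:
  assumes "gauss_ge \<rho> b (Z - 1)" "b \<ge> 0"
  shows "gauss_ge \<rho> b (Z ^ i - 1)"
proof -
  have Z: "gauss_ge \<rho> 0 ((Z - 1) + 1)" using assms by (intro gauss_ge_add gauss_ge_1) (auto elim: gauss_ge_mono)
  have "gauss_ge \<rho> 0 (Z ^ l)" for l
    using gauss_ge_prod[of "{..<l}" \<rho> "\<lambda>_. 0" "\<lambda>_. Z"] Z by simp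
  then have "gauss_ge \<rho> 0 (\<Sum>l<i. Z ^ l)" by (intro gauss_ge_sum) auto
  from gauss_ge_mult[OF assms(1) this] show ?thesis using power_diff_1_eq[of Z i] by simp
qed

lemma fps_of_nat_p: "(of_nat p :: 'k fps) = fps_const (of_nat p)"
  by (rule fps_of_nat[symmetric])

text \<open>Writing \<open>Z ^ p - 1 = (Z - 1) * (1 + Z + \<dots> + Z ^ (p - 1))\<close>, the second factor is
  congruent to \<open>p\<close> modulo \<open>Z - 1\<close>, so every \<open>p\<close>-th power gains at least \<open>b\<close>.\<close>

lemma gauss_ge_p_power_minus_1:
  assumes "gauss_ge \<rho> b (Z - 1)" "0 \<le> b" "b \<le> 1"
  shows "gauss_ge \<rho> (real (k + 1) * b) (Z ^ (p ^ k) - 1)"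
proof (induction k)
  case (Suc k)
  define W where "W = Z ^ (p ^ k)"
  have W: "gauss_ge \<rho> (real (k + 1) * b) (W - 1)" using Suc by (simp add: W_def)
  have "b \<le> real (k + 1) * b" using assms(2) by (simp add: algebra_simps)
  then have W': "gauss_ge \<rho> b (W - 1)" using W gauss_ge_mono by blast
  have "gauss_ge \<rho> b (of_nat p + (\<Sum>i<p. W ^ i - 1))"
    unfolding fps_of_nat_p using vge_mono[OF vge_p] assms(3)
    by (intro gauss_ge_add gauss_ge_sum gauss_ge_power_minus_1[OF W' assms(2)] gauss_ge_const) auto
  then have "gauss_ge \<rho> b (\<Sum>i<p. W ^ i)" by (simp add: geometric_sum_minus[symmetric])
  from gauss_ge_mult[OF W this] have "gauss_ge \<rho> (real (k + 1) * b + b) (W ^ p - 1)"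
    by (simp only: power_diff_1_eq[of W p])
  then show ?case by (simp add: W_def power_mult[symmetric] algebra_simps)
qed (use assms in simp)

text \<open>From some N on the factors have Gauss valuation at least 0, so all later partial
  products keep the bound of the N-th one; consecutive partial products then differ by a bounded
  series times F (M + 1) - 1.\<close>

lemma glim_partial_prod:
  assumes disc_conv: "\<And>m. disc_conv (F m)"
    and lim: "\<And>\<rho> e. \<rho> > 0 \<Longrightarrow> \<forall>\<^sub>F m in sequentially. gauss_ge \<rho> e (F m - 1)"
  obtains f where "glim (\<lambda>M. \<Prod>m\<in>{1..M}. F m) f"
proof (rule glim_complete)
  fix \<rho> e :: real assume \<rho>: "\<rho> > 0"
  define P where "P = (\<lambda>M. \<Prod>m\<in>{1..M}. F m)"
  obtain N where N: "\<And>m. m \<ge> N \<Longrightarrow> gauss_ge \<rho> 0 (F m - 1)"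
    using lim[OF \<rho>, of 0] by (auto simp: eventually_sequentially)
  have "disc_conv (P N)" unfolding P_def by (intro disc_conv_prod disc_conv)
  then obtain B where B: "gauss_ge \<rho> B (P N)" using \<rho> unfolding disc_conv_def by blast
  have B': "gauss_ge \<rho> B (P (N + i))" for i
  proof (induction i)
    case (Suc i)
    have "gauss_ge \<rho> 0 (F (Suc (N + i)) - 1 + 1)" using N by (intro gauss_ge_add gauss_ge_1) auto
    from gauss_ge_mult[OF Suc this] show ?case by (simp add: P_def)
  qed (use B in simp)
  have "\<forall>\<^sub>F m in sequentially. gauss_ge \<rho> (e - B) (F (Suc m) - 1)"
    using lim[OF \<rho>, of "e - B"] eventually_sequentially_Suc[of "\<lambda>m. gauss_ge \<rho> (e - B) (F m - 1)"] by simp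
  then have "\<forall>\<^sub>F M in sequentially. gauss_ge \<rho> e (P (Suc M) - P M)"
    using eventually_ge_at_top[of N]
  proof eventually_elim
    case (elim M)
    have "P (Suc M) - P M = P M * (F (Suc M) - 1)" by (simp add: P_def algebra_simps)
    then show ?case using gauss_ge_mult[OF B'[of "M - N"] elim(1)] elim(2) by simp
  qed
  then show "\<forall>\<^sub>F M in sequentially. gauss_ge \<rho> e ((\<Prod>m\<in>{1..Suc M}. F m) - (\<Prod>m\<in>{1..M}. F m))"
    by (simp only: P_def)
qed

text \<open>From some index on the values of the factors are congruent to 1 modulo p, hence of
  valuation 0. The values of the partial products then have constant finite valuation and cannot
  tend to 0.\<close>

lemma peval_glim_partial_prod_nz:
  assumes disc_conv: "\<And>m. disc_conv (F m)"
    and lim: "\<And>\<rho> e. \<rho> > 0 \<Longrightarrow> \<forall>\<^sub>F m in sequentially. gauss_ge \<rho> e (F m - 1)"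
    and f: "glim (\<lambda>M. \<Prod>m\<in>{1..M}. F m) f"
    and x: "vge x \<sigma>" "\<sigma> > 0"
    and nz: "\<And>m. m \<ge> 1 \<Longrightarrow> peval v (F m) x \<noteq> 0"
  shows "peval v f x \<noteq> 0"
proof
  assume 0: "peval v f x = 0"
  define P where "P = (\<lambda>M. \<Prod>m\<in>{1..M}. peval v (F m) x)"
  have P: "limK P 0"
    using glim_peval[OF f disc_conv_prod[OF disc_conv] x] 0 by (simp add: peval_prod[OF x] disc_conv P_def)
  have Pnz: "P M \<noteq> 0" for M using nz by (simp add: P_def)
  obtain N where N: "\<And>m. m \<ge> N \<Longrightarrow> gauss_ge \<sigma> 1 (F m - 1)"
    using lim[OF x(2), of 1] by (auto simp: eventually_sequentially)
  have val: "val (peval v (F m) x) = 0" if "m \<ge> N" for m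
  proof -
    have "vge (peval v (F m - fps_const 1) x) 1"
      using N[OF that] by (intro peval_vge[OF x] disc_conv_diff disc_conv disc_conv_const) auto
    then have "vge (peval v (F m) x - 1) 1"
      by (simp only: peval_diff[OF x disc_conv disc_conv_const] peval_const[OF x])
    from val_close(2)[OF this] show ?thesis by simp
  qed
  have const: "val (P (N + i)) = val (P N)" for i
  proof (induction i)
    case (Suc i)
    have "P (N + Suc i) = P (N + i) * peval v (F (Suc (N + i))) x" by (simp add: P_def)
    then show ?case using Suc val[of "Suc (N + i)"] Pnz nz by (simp add: val_mult)
  qed simp
  have "\<forall>\<^sub>F M in sequentially. vge (P M - 0) (val (P N) + 1)" using P unfolding limK_def by blast
  then obtain M where "M \<ge> N" "vge (P M) (val (P N) + 1)"
    unfolding eventually_sequentially by (metis diff_zero linear)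
  then show False using const[of "M - N"] Pnz[of M] by (simp add: vge_iff)
qed


section \<open>The logarithms\<close>

lemma disc_conv_sum: "(\<And>i. i \<in> A \<Longrightarrow> disc_conv (f i)) \<Longrightarrow> disc_conv (\<Sum>i\<in>A. f i)"
proof (induction A rule: infinite_finite_induct)
  case (insert x F) then show ?case by (auto intro: disc_conv_add)
qed (use disc_conv_const[of 0] in auto)

lemma fps_const_prod: "fps_const (\<Prod>i\<in>A. f i) = (\<Prod>i\<in>A. fps_const (f i :: 'b::comm_ring_1))"
  by (induction A rule: infinite_finite_induct) (auto simp flip: fps_const_mult)

lemma disc_conv_power: "disc_conv f \<Longrightarrow> disc_conv (f ^ n)"
  using disc_conv_prod[of "{..<n}" "\<lambda>_. f"] by simp

end

locale padic_gen = padic_field p v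
  for p :: nat and v :: "'k::field_char_0 \<Rightarrow> ereal" +
  fixes \<gamma> :: 'k
  assumes gen: "top_gen v \<gamma>"
begin

section \<open>The topological generator and its powers\<close>

lemma gamma_Zpu: "\<gamma> \<in> Zpu v" and vge_gamma_minus_1: "vge (\<gamma> - 1) 1"
  using gen by (auto simp: top_gen_def Um_iff)

lemma gamma_nz [simp]: "\<gamma> \<noteq> 0" and val_gamma [simp]: "val \<gamma> = 0"
  using gamma_Zpu by (auto simp: Zpu_iff)

lemma gamma_approx: "u \<in> Um v 1 \<Longrightarrow> \<exists>k. vge (\<gamma> ^ k - u) e"
  using gen by (auto simp: top_gen_def vge_def)

text \<open>Some power \<gamma>^k agrees with 1 + p modulo p^2, so val (\<gamma>^k - 1) = 1. As
  \<gamma>^k - 1 is an integral multiple of \<gamma> - 1, the latter cannot have larger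
  valuation.\<close>

lemma gamma_neq_1: "\<gamma> \<noteq> 1" and val_gamma_minus_1: "val (\<gamma> - 1) = 1"
proof -
  have p1: "vge (of_nat p) 1" by (rule vge_p)
  then have "vge (1 + of_nat p - 1) 1" by simp
  from val_close[OF this] have "val (1 + of_nat p) = 0" "(1 + of_nat p :: 'k) \<noteq> 0" by auto
  moreover have "1 + of_nat p \<in> Zp v" using Zp_of_int[of "1 + int p"] by simp
  ultimately have "1 + of_nat p \<in> Um v 1" using p1 by (simp add: Um_iff Zpu_iff)
  from gamma_approx[OF this] obtain k where "vge (\<gamma> ^ k - (1 + of_nat p)) 2" by blast
  then have "vge (\<gamma> ^ k - 1 - of_nat p) 2" by (simp add: algebra_simps)
  from val_close[OF this] have k: "\<gamma> ^ k - 1 \<noteq> 0" "val (\<gamma> ^ k - 1) = 1" by auto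
  then show nz: "\<gamma> \<noteq> 1" by auto
  have 1: "val (\<gamma> - 1) \<ge> 1" using vge_gamma_minus_1 nz by (simp add: vge_iff)
  have "vge (\<gamma> ^ k - 1) (val (\<gamma> - 1))" using 1 by (intro vge_power_minus_1 vge_val) auto
  then show "val (\<gamma> - 1) = 1" using 1 k by (simp add: vge_iff)
qed

lemma gamma_power_eq_1_iff: "\<gamma> ^ s = 1 \<longleftrightarrow> s = 0"
proof (cases "s = 0")
  case False
  then show ?thesis using val_power_minus_1[OF gamma_neq_1, of s] val_gamma_minus_1 by auto
qed simp

lemma gamma_power_dvd:
  assumes "vge (\<gamma> ^ s - 1) (real k + 1)"
  shows "p ^ k dvd s"
proof (cases "s = 0")
  case False
  obtain k' where k': "p ^ k' dvd s" "\<gamma> ^ s \<noteq> 1" "val (\<gamma> ^ s - 1) = val (\<gamma> - 1) + real k'"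
    using val_power_minus_1[OF gamma_neq_1, of s] val_gamma_minus_1 False by auto
  then have "k \<le> k'" using assms by (simp add: vge_iff val_gamma_minus_1)
  then show ?thesis using k'(1) by (meson dvd_trans le_imp_power_dvd)
qed simp

lemma vge_gamma_p_power: "vge (\<gamma> ^ (p ^ k) - 1) (real k + 1)"
  using val_power_p_power_minus_1[OF gamma_neq_1, of k] val_gamma_minus_1 by (simp add: vge_iff)

lemma gamma_powi_eq_1: "\<gamma> powi n = 1 \<Longrightarrow> n = 0"
  using gamma_power_eq_1_iff[of "nat n"] gamma_power_eq_1_iff[of "nat (- n)"]
  by (cases "n \<ge> 0") (simp_all add: power_int_def power_inverse)

lemma val_gamma_powi: "val (\<gamma> powi n) = 0"
  by (auto simp: power_int_def val_power val_inverse)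

lemma vge_gamma_powi: "vge (\<gamma> powi n) 0"
  by (simp add: vge_iff val_gamma_powi)

lemma vge_gamma_powi_minus_1: "vge (\<gamma> powi n - 1) 1"
proof (cases "n \<ge> 0")
  case True
  then show ?thesis using vge_power_minus_1[OF vge_gamma_minus_1] by (simp add: power_int_def)
next
  case False
  define x where "x = \<gamma> ^ nat (- n)"
  have x: "x \<noteq> 0" "val (inverse x) = 0" "vge (x - 1) 1"
    using vge_power_minus_1[OF vge_gamma_minus_1] by (auto simp: x_def val_inverse val_power)
  have "vge (inverse x * - (x - 1)) 1"
    using vge_mult[of "inverse x" 0 "x - 1" 1] x vge_val[of "inverse x"] by (simp only: mult_minus_right vge_uminus) simp
  also have "inverse x * - (x - 1) = inverse x - 1" using x by (simp add: algebra_simps)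
  finally show ?thesis using False by (simp add: power_int_def x_def power_inverse)
qed

text \<open>Two roles meet in this point: for z of p-power order and the right parity it is a zero
  of the logarithm, and for z = \<theta> \<gamma> it is where \<open>integ\<close> evaluates the
  component of x^j \<theta>.\<close>

definition pt :: "int \<Rightarrow> 'k \<Rightarrow> 'k" where
  "pt j z = \<gamma> powi j * z - 1"

text \<open>A common power N kills both roots of unity and leaves an equation between powers of
  \<gamma>, which has infinite order.\<close>

lemma pt_inj:
  assumes "pt j z = pt j' z'" "z ^ (p ^ a) = 1" "z' ^ (p ^ b) = 1"
  shows "j = j'" "z = z'"
proof -
  define N where "N = p ^ (a + b)"
  have N: "z ^ N = 1" "z' ^ N = 1" "N > 0"
    unfolding N_def power_add using assms by (auto simp: power_mult mult.commute[of "p ^ a"])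
      (metis assms(2) mult.commute power_mult power_one)
  have eq: "\<gamma> powi j * z = \<gamma> powi j' * z'" using assms by (simp add: pt_def)
  then have "(\<gamma> powi j) ^ N * z ^ N = (\<gamma> powi j') ^ N * z' ^ N" by (metis power_mult_distrib)
  then have "\<gamma> powi (j * int N) = \<gamma> powi (j' * int N)" using N by (simp add: power_int_mult)
  then have "\<gamma> powi (j * int N - j' * int N) = 1" by (simp add: power_int_diff)
  from gamma_powi_eq_1[OF this] have "(j - j') * int N = 0" by (simp add: left_diff_distrib)
  then show "j = j'" using N by simp
  then show "z = z'" using eq by simp
qed

text \<open>Passing from z - 1 to \<gamma>^j z - 1 changes it by an element of valuation at least 1,
  while val (z - 1) = 1 / \<open>cdeg k\<close> is at most 1/2. So the valuation of the zero does
  not depend on j.\<close>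

lemma pt_prim_root:
  assumes "k \<ge> 1" "z \<in> prim_roots k"
  shows "pt j z \<noteq> 0" "val (pt j z) = 1 / cdeg k"
proof -
  have "vge ((\<gamma> powi j - 1) * z) (1 + 0)"
    by (intro vge_mult vge_gamma_powi_minus_1 prim_roots_vge[OF assms])
  then have 1: "vge (pt j z - (z - 1)) 1" by (simp add: pt_def algebra_simps)
  have "z - 1 \<noteq> 0" using prim_roots_neq_1[OF assms(2)] by simp
  moreover have "val (z - 1) < 1" using cdeg_ge_2[of k] by (simp add: val_prim_root[OF assms])
  ultimately show "pt j z \<noteq> 0" "val (pt j z) = 1 / cdeg k"
    using val_close[OF 1] val_prim_root[OF assms] by auto
qed

definition Phi_factor :: "nat \<Rightarrow> int \<Rightarrow> 'k fps" where
  "Phi_factor k j = fps_const (1 / of_nat p) * Phi_shift p \<gamma> k j"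

lemma Phi_factor_eq_prod:
  "k \<ge> 1 \<Longrightarrow> Phi_factor k j = fps_const ((\<gamma> powi (- j)) ^ cdeg k / of_nat p) *
     (\<Prod>z\<in>prim_roots k. fps_X - fps_const (pt j z))"
  by (simp add: Phi_factor_def Phi_shift_eq_prod pt_def mult.assoc[symmetric])

lemma disc_conv_Phi_factor: "disc_conv (Phi_factor k j)"
proof -
  have "disc_conv (fps_const 1 + fps_X)" by (intro disc_conv_const disc_conv_add disc_conv_X)
  then show ?thesis
    unfolding Phi_factor_def Phi_shift_eq_sum[OF gamma_nz]
    by (intro disc_conv_mult disc_conv_const disc_conv_sum disc_conv_power) simp
qed

text \<open>With Y = \<gamma>^(-j) (1 + X) and Z = Y^(p^(k-1)), the difference is (1/p) times the
  sum of Z^i - 1 over i < p. Y - 1 has Gauss valuation at least min 1 \<rho>, each of the k - 1 p-th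
  powers adds as much again, and the division by p costs 1.\<close>

lemma gauss_ge_Phi_factor_minus_1:
  assumes "k \<ge> 1" "\<rho> > 0"
  shows "gauss_ge \<rho> (real k * min 1 \<rho> - 1) (Phi_factor k j - 1)"
proof -
  define b where "b = min 1 \<rho>"
  have b: "0 \<le> b" "b \<le> 1" "b \<le> \<rho>" using assms(2) by (auto simp: b_def)
  define u where "u = \<gamma> powi (- j)"
  define Y where "Y = fps_const u * (1 + fps_X)"
  have "Y - 1 = fps_const (u - 1) + fps_const u * fps_X"
    unfolding Y_def by (simp add: algebra_simps flip: fps_const_sub)
  moreover have "gauss_ge \<rho> b (fps_const (u - 1))"
    unfolding u_def using vge_mono[OF vge_gamma_powi_minus_1] b by (intro gauss_ge_const) auto
  moreover have "gauss_ge \<rho> b (fps_const u * fps_X)"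
    using gauss_ge_mult[OF gauss_ge_const[OF vge_gamma_powi[of "- j"]] gauss_ge_X] b gauss_ge_mono by (fastforce simp: u_def)
  ultimately have Y: "gauss_ge \<rho> b (Y - 1)" by (auto intro: gauss_ge_add)
  define Z where "Z = Y ^ (p ^ (k - 1))"
  have "gauss_ge \<rho> (real (k - 1 + 1) * b) (Z - 1)"
    unfolding Z_def by (rule gauss_ge_p_power_minus_1[OF Y b(1,2)])
  then have Z: "gauss_ge \<rho> (real k * b) (Z - 1)" using assms(1) by simp
  have "gauss_ge \<rho> (-1 + real k * b) (fps_const (1 / of_nat p) * (\<Sum>i<p. Z ^ i - 1))"
    using b by (intro gauss_ge_mult gauss_ge_const gauss_ge_sum gauss_ge_power_minus_1[OF Z])
      (auto simp: vge_iff val_divide)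
  also have "fps_const (1 / of_nat p) * (\<Sum>i<p. Z ^ i - 1) = Phi_factor k j - 1"
  proof -
    have "(\<Sum>i<p. Z ^ i) = Phi_shift p \<gamma> k j"
      unfolding Phi_shift_eq_sum[OF gamma_nz] Z_def Y_def u_def
      by (simp add: power_mult[symmetric] mult.commute)
    moreover have "fps_const (1 / of_nat p) * (of_nat p :: 'k fps) = 1"
      unfolding fps_of_nat_p by simp
    ultimately show ?thesis by (simp add: geometric_sum_minus[symmetric] right_diff_distrib Phi_factor_def)
  qed
  finally show ?thesis by (simp add: b_def)
qed

definition idx :: "bool \<Rightarrow> nat \<Rightarrow> nat" where
  "idx pos m = (if pos then 2 * m else 2 * m - 1)"

lemma idx_ge: "m \<ge> 1 \<Longrightarrow> idx pos m \<ge> 1" "idx pos m \<ge> m"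
  by (auto simp: idx_def)

lemma Phi_factor_tendsto_1:
  assumes "\<rho> > 0"
  shows "\<forall>\<^sub>F m in sequentially. gauss_ge \<rho> e (Phi_factor (idx pos m) j - 1)"
proof -
  have "min 1 \<rho> > 0" using assms by simp
  from eventually_linear_ge[OF this, of e "-1"] eventually_ge_at_top[of 1]
  show ?thesis
  proof eventually_elim
    case (elim m)
    have "real m * min 1 \<rho> \<le> real (idx pos m) * min 1 \<rho>"
      using idx_ge(2)[of m pos] assms by (intro mult_right_mono) auto
    with elim show ?case by (intro gauss_ge_mono[OF gauss_ge_Phi_factor_minus_1[OF idx_ge(1) assms]]) auto
  qed
qed

definition partial_log_pj :: "bool \<Rightarrow> int \<Rightarrow> nat \<Rightarrow> 'k fps" where
  "partial_log_pj pos j M = fps_const (1 / of_nat p) * (\<Prod>m\<in>{1..M}. Phi_factor (idx pos m) j)"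

lemma disc_conv_partial_log_pj: "disc_conv (partial_log_pj pos j M)"
  unfolding partial_log_pj_def by (intro disc_conv_mult disc_conv_const disc_conv_prod disc_conv_Phi_factor)

text \<open>\<open>log_pj\<close> is defined by a coefficientwise THE-limit; this shows that the
  limit exists and is a limit in every Gauss norm. The product f without the leading 1/p is kept
  because the nonvanishing argument needs factors tending to 1.\<close>

lemma log_pj_limit:
  obtains f where "glim (\<lambda>M. \<Prod>m\<in>{1..M}. Phi_factor (idx pos m) j) f"
    "log_pj p v \<gamma> pos j = fps_const (1 / of_nat p) * f" "disc_conv f" "glim (partial_log_pj pos j) (log_pj p v \<gamma> pos j)"
proof -
  obtain f where f: "glim (\<lambda>M. \<Prod>m\<in>{1..M}. Phi_factor (idx pos m) j) f"
    by (rule glim_partial_prod[OF disc_conv_Phi_factor Phi_factor_tendsto_1])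
  have disc_conv: "disc_conv f" by (rule glim_disc_conv[OF f]) (intro disc_conv_prod disc_conv_Phi_factor)
  have lim: "glim (partial_log_pj pos j) (fps_const (1 / of_nat p) * f)"
    unfolding partial_log_pj_def[abs_def] by (intro glim_mult glim_const f disc_conv disc_conv_const)
  have "log_pj p v \<gamma> pos j = fps_const (1 / of_nat p) * f"
  proof (rule fps_ext)
    fix n
    show "log_pj p v \<gamma> pos j $ n = (fps_const (1 / of_nat p) * f) $ n"
      using The_limK[OF glim_nth[OF lim, of n]]
      by (simp only: log_pj_def fps_nth_Abs_fps partial_log_pj_def Phi_factor_def idx_def)
  qed
  with f disc_conv lim show ?thesis using that by auto
qed

lemma glim_log_pj: "glim (partial_log_pj pos j) (log_pj p v \<gamma> pos j)"
  by (rule log_pj_limit)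

lemma disc_conv_log_pj: "disc_conv (log_pj p v \<gamma> pos j)"
  by (rule glim_disc_conv[OF glim_log_pj disc_conv_partial_log_pj])

lemma peval_log_pj_nz:
  assumes x: "vge x \<sigma>" "\<sigma> > 0"
    and nz: "\<And>m z. m \<ge> 1 \<Longrightarrow> z \<in> prim_roots (idx pos m) \<Longrightarrow> x \<noteq> pt j z"
  shows "peval v (log_pj p v \<gamma> pos j) x \<noteq> 0"
proof -
  obtain f where f: "glim (\<lambda>M. \<Prod>m\<in>{1..M}. Phi_factor (idx pos m) j) f"
    "log_pj p v \<gamma> pos j = fps_const (1 / of_nat p) * f" "disc_conv f"
    by (rule log_pj_limit)
  have "peval v (Phi_factor (idx pos m) j) x \<noteq> 0" if "m \<ge> 1" for m
    unfolding Phi_factor_eq_prod[OF idx_ge(1)[OF that]]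
    using nz[OF that] finite_prim_roots[OF idx_ge(1)[OF that]]
    by (subst peval_mult[OF x] peval_prod[OF x] peval_const[OF x] peval_linear[OF x],
        (intro disc_conv_mult disc_conv_const disc_conv_prod disc_conv_linear)+)
      (auto simp: peval_prod[OF x] disc_conv_linear peval_linear[OF x] peval_const[OF x])
  from peval_glim_partial_prod_nz[OF disc_conv_Phi_factor Phi_factor_tendsto_1 f(1) x this]
  show ?thesis unfolding f(2) by (simp add: peval_mult[OF x disc_conv_const f(3)] peval_const[OF x])
qed

definition partial_log_Pi :: "bool \<Rightarrow> int set \<Rightarrow> nat \<Rightarrow> 'k fps" where
  "partial_log_Pi pos C M = (\<Prod>j\<in>C. partial_log_pj pos j M)"

lemma glim_log_Pi: "glim (partial_log_Pi pos C) (log_Pi p v \<gamma> pos C)"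
  unfolding partial_log_Pi_def[abs_def] log_Pi_def by (intro glim_prod glim_log_pj disc_conv_log_pj)

lemma disc_conv_log_Pi: "disc_conv (log_Pi p v \<gamma> pos C)"
  unfolding log_Pi_def by (intro disc_conv_prod disc_conv_log_pj)

text \<open>\<open>card C * (defect \<rho> pos M + 1)\<close> is minus the Gauss valuation at radius \<open>\<rho>\<close> of the
  \<open>M\<close>-th partial product of the logarithm.\<close>

definition defect :: "real \<Rightarrow> bool \<Rightarrow> nat \<Rightarrow> real" where
  "defect \<rho> pos M = (\<Sum>m=1..M. 1 - min (real (cdeg (idx pos m)) * \<rho>) 1)"

text \<open>Triples ((j, m), z) index the zeros, so that products and sums split by j and by level
  m. That different triples give different points is established when they are divided out.\<close>

abbreviation "zeros pos C M \<equiv> (SIGMA jm:C \<times> {1..M}. prim_roots (idx pos (snd jm)))"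

text \<open>Each j contributes M factors 1/p from the \<Phi>-factors and one from the front of the
  logarithm; the powers of \<gamma> are units. This gives the M + 1 in the valuation of c.\<close>

lemma partial_log_Pi_eq_prod:
  assumes "finite C"
  obtains c where "c \<noteq> 0" "val c = - (real (card C) * (real M + 1))"
    "partial_log_Pi pos C M = fps_const c * (\<Prod>i\<in>zeros pos C M. fps_X - fps_const (pt (fst (fst i)) (snd i)))"
proof -
  define c where "c = (\<Prod>j\<in>C. 1 / of_nat p * (\<Prod>m\<in>{1..M}. (\<gamma> powi (- j)) ^ cdeg (idx pos m) / of_nat p))"
  have "partial_log_pj pos j M = fps_const (1 / of_nat p * (\<Prod>m\<in>{1..M}. (\<gamma> powi (- j)) ^ cdeg (idx pos m) / of_nat p)) *
     (\<Prod>m\<in>{1..M}. \<Prod>z\<in>prim_roots (idx pos m). fps_X - fps_const (pt j z))" for j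
  proof -
    have "(\<Prod>m\<in>{1..M}. Phi_factor (idx pos m) j) = (\<Prod>m\<in>{1..M}. fps_const ((\<gamma> powi (- j)) ^ cdeg (idx pos m) / of_nat p) *
      (\<Prod>z\<in>prim_roots (idx pos m). fps_X - fps_const (pt j z)))"
      by (intro prod.cong refl Phi_factor_eq_prod idx_ge) auto
    then show ?thesis
      unfolding partial_log_pj_def prod.distrib fps_const_prod[symmetric] fps_const_mult[symmetric] by (simp add: mult_ac)
  qed
  then have "partial_log_Pi pos C M = fps_const c * (\<Prod>j\<in>C. \<Prod>m\<in>{1..M}. \<Prod>z\<in>prim_roots (idx pos m). fps_X - fps_const (pt j z))"
    unfolding partial_log_Pi_def c_def fps_const_prod[where A = C] by (simp only: prod.distrib[symmetric])
  also have "(\<Prod>j\<in>C. \<Prod>m\<in>{1..M}. \<Prod>z\<in>prim_roots (idx pos m). fps_X - fps_const (pt j z))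
     = (\<Prod>i\<in>zeros pos C M. fps_X - fps_const (pt (fst (fst i)) (snd i)))"
    using assms finite_prim_roots idx_ge(1)
    by (subst prod.cartesian_product, unfold case_prod_unfold, subst prod.Sigma) (auto simp: case_prod_unfold)
  finally have 1: "partial_log_Pi pos C M = fps_const c * (\<Prod>i\<in>zeros pos C M. fps_X - fps_const (pt (fst (fst i)) (snd i)))" .
  have 2: "c \<noteq> 0" unfolding c_def using assms by auto
  have "val c = (\<Sum>j\<in>C. -1 + (\<Sum>m\<in>{1..M}. - 1))"
    unfolding c_def using assms
    by (subst val_prod)
      (auto intro!: sum.cong simp: val_mult val_prod val_divide val_power val_gamma_powi)
  also have "\<dots> = - (real (card C) * (real M + 1))" by (simp add: algebra_simps)
  finally show ?thesis using that 1 2 by blast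
qed

lemma finite_zeros: "finite C \<Longrightarrow> finite (zeros pos C M)"
  using finite_prim_roots idx_ge(1) by (intro finite_SigmaI) auto

text \<open>A level k consists of \<open>cdeg k\<close> zeros of valuation 1 /
  \<open>cdeg k\<close>. Together they give min (\<open>cdeg k\<close> \<rho>) 1, which is 1 minus
  the corresponding summand of the defect.\<close>

lemma sum_min_zeros:
  assumes "finite C"
  shows "(\<Sum>i\<in>zeros pos C M. min \<rho> (val (pt (fst (fst i)) (snd i)))) = real (card C) * (real M - defect \<rho> pos M)"
proof -
  have "(\<Sum>i\<in>zeros pos C M. min \<rho> (val (pt (fst (fst i)) (snd i))))
    = (\<Sum>jm\<in>C \<times> {1..M}. \<Sum>z\<in>prim_roots (idx pos (snd jm)). min \<rho> (val (pt (fst jm) z)))"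
    using assms finite_prim_roots idx_ge(1) by (subst sum.Sigma) (auto simp: case_prod_unfold)
  also have "\<dots> = (\<Sum>jm\<in>C \<times> {1..M}. min (real (cdeg (idx pos (snd jm))) * \<rho>) 1)"
  proof (intro sum.cong refl)
    fix jm assume jm: "jm \<in> C \<times> {1..M}"
    define k where "k = idx pos (snd jm)"
    have k: "k \<ge> 1" unfolding k_def using jm by (intro idx_ge) auto
    have "(\<Sum>z\<in>prim_roots k. min \<rho> (val (pt (fst jm) z))) = (\<Sum>z\<in>prim_roots k. min \<rho> (1 / cdeg k))"
      using pt_prim_root(2)[OF k] by (intro sum.cong) auto
    also have "\<dots> = real (cdeg k) * min \<rho> (1 / cdeg k)" by (simp add: card_prim_roots[OF k])
    also have "\<dots> = min (real (cdeg k) * \<rho>) 1"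
      using cdeg_ge_2[of k] by (auto simp: min_def field_simps)
    finally show "(\<Sum>z\<in>prim_roots (idx pos (snd jm)). min \<rho> (val (pt (fst jm) z))) =
        min (real (cdeg (idx pos (snd jm))) * \<rho>) 1" by (simp add: k_def)
  qed
  also have "\<dots> = (\<Sum>j\<in>C. \<Sum>m\<in>{1..M}. min (real (cdeg (idx pos m)) * \<rho>) 1)"
    by (subst sum.cartesian_product) (simp add: case_prod_unfold)
  also have "\<dots> = real (card C) * (real M - defect \<rho> pos M)"
    by (simp add: defect_def sum_subtractf)
  finally show ?thesis .
qed

lemma gauss_ge_partial_log_Pi:
  assumes "finite C"
  shows "gauss_ge \<rho> (- (real (card C) * (defect \<rho> pos M + 1))) (partial_log_Pi pos C M)"
proof -
  obtain c where c: "c \<noteq> 0" "val c = - (real (card C) * (real M + 1))"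
    "partial_log_Pi pos C M = fps_const c * (\<Prod>i\<in>zeros pos C M. fps_X - fps_const (pt (fst (fst i)) (snd i)))"
    by (rule partial_log_Pi_eq_prod[OF assms])
  from gauss_ge_mult[OF gauss_ge_const[OF vge_val[of c]] gauss_ge_prod[OF gauss_ge_linear],
      of \<rho> "\<lambda>i. pt (fst (fst i)) (snd i)" "zeros pos C M"]
  show ?thesis unfolding c(2,3) sum_min_zeros[OF assms] by (simp add: algebra_simps)
qed

text \<open>For each j the zeros cost M - \<open>defect \<rho> pos M\<close> while the inverse of
  the constant gains M + 1. The two M cancel, and what remains is a gain that can be estimated
  independently of M.\<close>

lemma divide_partial_log_Pi:
  assumes "finite C" "disc_conv f"
    and 0: "\<And>j m z. j \<in> C \<Longrightarrow> m \<ge> 1 \<Longrightarrow> z \<in> prim_roots (idx pos m) \<Longrightarrow> peval v f (pt j z) = 0"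
  shows "\<exists>g. f = partial_log_Pi pos C M * g \<and>
    (\<forall>\<rho> B. gauss_ge \<rho> B f \<longrightarrow> gauss_ge \<rho> (B + real (card C) * (defect \<rho> pos M + 1)) g)"
proof -
  obtain c where c: "c \<noteq> 0" "val c = - (real (card C) * (real M + 1))"
    "partial_log_Pi pos C M = fps_const c * (\<Prod>i\<in>zeros pos C M. fps_X - fps_const (pt (fst (fst i)) (snd i)))"
    by (rule partial_log_Pi_eq_prod[OF assms(1)])
  let ?a = "\<lambda>i. pt (fst (fst i)) (snd i)"
  have "inj_on ?a (zeros pos C M)"
  proof (rule inj_onI)
    fix i i' assume i: "i \<in> zeros pos C M" "i' \<in> zeros pos C M" "?a i = ?a i'"
    have z: "snd i \<in> prim_roots (idx pos (snd (fst i)))" "snd i' \<in> prim_roots (idx pos (snd (fst i')))"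
      and m: "snd (fst i) \<ge> 1" "snd (fst i') \<ge> 1" using i(1,2) by auto
    have eq: "fst (fst i) = fst (fst i')" "snd i = snd i'"
      using pt_inj[OF i(3)] z by (auto simp: prim_roots_def)
    have "idx pos (snd (fst i)) = idx pos (snd (fst i'))"
      using prim_roots_disjoint z m idx_ge(1) eq(2) by metis
    then have "snd (fst i) = snd (fst i')" using m by (auto simp: idx_def split: if_splits)
    with eq show "i = i'" by (simp add: prod_eq_iff)
  qed
  moreover have "?a i \<noteq> 0 \<and> val (?a i) > 0 \<and> peval v f (?a i) = 0" if "i \<in> zeros pos C M" for i
  proof -
    have "snd (fst i) \<ge> 1" "fst (fst i) \<in> C" and z: "snd i \<in> prim_roots (idx pos (snd (fst i)))"
      using that by auto
    then show ?thesis
      using pt_prim_root[OF idx_ge(1) z] 0[OF _ _ z] cdeg_ge_2[of "idx pos (snd (fst i))"] by auto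
  qed
  ultimately obtain g where g: "f = (\<Prod>i\<in>zeros pos C M. fps_X - fps_const (?a i)) * g"
    "\<And>\<rho> B. gauss_ge \<rho> B f \<Longrightarrow> gauss_ge \<rho> (B - real (card C) * (real M - defect \<rho> pos M)) g"
    using divide_prod[OF finite_zeros[OF assms(1)] _ assms(2), of ?a] unfolding sum_min_zeros[OF assms(1)]
    by blast
  show ?thesis
  proof (intro exI conjI allI impI)
    show "f = partial_log_Pi pos C M * (fps_const (inverse c) * g)"
      unfolding c(3) using c(1) g(1) by (simp add: mult_ac flip: mult.assoc)
    fix \<rho> B assume "gauss_ge \<rho> B f"
    from gauss_ge_mult[OF gauss_ge_const[OF vge_val[of "inverse c"]] g(2)[OF this]]
    show "gauss_ge \<rho> (B + real (card C) * (defect \<rho> pos M + 1)) (fps_const (inverse c) * g)"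
      by (simp add: val_inverse[OF c(1)] c(2) algebra_simps)
  qed
qed


section \<open>Characters\<close>

lemma vge_fermat: "vge (of_nat a ^ p - of_nat a) 1"
proof (induction a)
  case (Suc a)
  have "{..p} = insert 0 (insert p {1..<p})" using p_pos by auto
  then have "(of_nat a + 1) ^ p = of_nat a ^ p + 1 + (\<Sum>k\<in>{1..<p}. of_nat (p choose k) * of_nat a ^ k :: 'k)"
    by (simp add: binomial_ring)
  moreover have "vge (\<Sum>k\<in>{1..<p}. of_nat (p choose k) * of_nat a ^ k) 1"
  proof (rule vge_sum)
    fix k assume "k \<in> {1..<p}"
    then have "p ^ 1 dvd p choose k" using dvd_choose_prime[OF _ _ _ prime_p, of k] by simp
    from vge_mult[OF vge_of_nat_dvd[OF this] vge_of_nat[of "a ^ k"]]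
    show "vge (of_nat (p choose k) * of_nat a ^ k) 1" by simp
  qed
  ultimately show ?case
    using vge_add[OF Suc, of "\<Sum>k\<in>{1..<p}. of_nat (p choose k) * of_nat a ^ k"]
    by (simp add: algebra_simps)
qed (simp add: power_0_left)

lemma vge_fermat_unit: "\<not> p dvd a \<Longrightarrow> vge (of_nat a ^ (p - 1) - 1) 1"
proof -
  assume a: "\<not> p dvd a"
  then have a0: "(of_nat a :: 'k) \<noteq> 0" by (cases "a = 0") auto
  have "of_nat a ^ p = of_nat a * (of_nat a ^ (p - 1) :: 'k)" by (simp flip: power_Suc)
  then have "of_nat a ^ (p - 1) - 1 = inverse (of_nat a) * (of_nat a ^ p - of_nat a :: 'k)"
    using a0 by (simp add: field_simps)
  moreover have "vge (inverse (of_nat a)) 0"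
    using a0 by (simp add: vge_iff val_inverse val_of_nat_coprime[OF a])
  ultimately show ?thesis using vge_mult[OF _ vge_fermat] by fastforce
qed

lemma vge_p_power_minus_1:
  assumes "vge (x - 1) 1"
  shows "vge (x ^ (p ^ k) - 1) (real k + 1)"
proof (cases "x = 1")
  case False
  then show ?thesis
    using val_power_p_power_minus_1[of x k] assms by (simp add: vge_iff)
qed simp

text \<open>The representative is the limit of x n = a^(p^n). The step from x n to x (n + 1)
  multiplies by (a^(p-1))^(p^n), which tends to 1 because a^(p-1) is 1 modulo p; for the same reason
  the limit has (p-1)-st power 1.\<close>

lemma teichmueller_exists:
  assumes a: "\<not> p dvd a"
  shows "\<exists>t\<in>Zpu v. t ^ (p - 1) = 1 \<and> vge (t - of_nat a) 1"
proof -
  define x where "x n = (of_nat a :: 'k) ^ (p ^ n)" for n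
  have y: "vge (of_nat a ^ (p - 1) - 1) 1" by (rule vge_fermat_unit[OF a])
  have pm: "x n ^ (p - 1) = (of_nat a ^ (p - 1)) ^ (p ^ n)" for n
    by (simp add: x_def power_mult[symmetric] mult.commute)
  have pm1: "vge (x n ^ (p - 1) - 1) (real n + 1)" for n
    unfolding pm by (rule vge_p_power_minus_1[OF y])
  have ev: "\<forall>\<^sub>F n in sequentially. vge (x n ^ (p - 1) - 1) e" for e
    using eventually_linear_ge[OF zero_less_one, of e 1]
    by eventually_elim (rule vge_mono[OF pm1], simp)
  have x0: "vge (x n) 0" for n
    using vge_of_nat[of "a ^ (p ^ n)"] by (simp add: x_def)
  have step: "x (Suc n) - x n = x n * (x n ^ (p - 1) - 1)" for n
  proof -
    have "x (Suc n) = x n ^ p" by (simp add: x_def power_mult[symmetric] mult.commute)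
    also have "\<dots> = x n * x n ^ (p - 1)" by (simp flip: power_Suc)
    finally show ?thesis by (simp add: algebra_simps)
  qed
  have "\<forall>\<^sub>F n in sequentially. vge (x (Suc n) - x n) e" for e
    using ev[of e] unfolding step
    by eventually_elim (use vge_mult[OF x0] in fastforce)
  then obtain t where t: "limK x t" by (rule complete_Cauchy)
  have d: "vge (x n - of_nat a) 1" for n
  proof (induction n)
    case (Suc n)
    have "vge (x (Suc n) - x n) (0 + 1)"
      unfolding step using pm1[of n] by (intro vge_mult x0) (auto elim: vge_mono)
    from vge_add[OF this[simplified] Suc] show ?case by simp
  qed (simp add: x_def)
  have ta: "vge (t - of_nat a) 1" by (rule limK_closed[OF t]) (simp add: d)
  have "limK (\<lambda>n. x n ^ (p - 1)) 1" using ev unfolding limK_def by blast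
  then have t1: "t ^ (p - 1) = 1" using limK_power[OF t] limK_unique by blast
  have "t \<in> Zp v" unfolding Zp_iff
  proof
    fix e
    have "\<forall>\<^sub>F n in sequentially. vge (x n - t) e" using t unfolding limK_def by blast
    then obtain n where "vge (x n - t) e" by (auto simp: eventually_sequentially)
    then have "vge (t - of_int (int a ^ (p ^ n))) e" by (simp add: x_def vge_diff_commute)
    then show "\<exists>k. vge (t - of_int k) e" by blast
  qed
  moreover have "t \<noteq> 0" "val t = 0" using root_of_unity_val[OF t1] p_ge_3 by auto
  ultimately show ?thesis using ta t1 by (auto simp: Zpu_iff)
qed

text \<open>If u = t / s were different from 1, then 1 + u + ... + u^(p-2) = 0; but u is close to 1,
  so this sum is close to p - 1, a unit.\<close>

lemma root_of_unity_eqI: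
  assumes "t ^ (p - 1) = 1" "s ^ (p - 1) = 1" "vge (t - s) e" "e > 0"
  shows "t = s"
proof (rule ccontr)
  assume ts: "t \<noteq> s"
  have s: "s \<noteq> 0" "val s = 0" using root_of_unity_val[OF assms(2)] p_ge_3 by auto
  define u where "u = t / s"
  have u: "u ^ (p - 1) = 1" "u \<noteq> 1" using ts s assms by (auto simp: u_def power_divide)
  have "u - 1 = (t - s) * inverse s" using s by (simp add: u_def field_simps)
  moreover have "vge (inverse s) 0" using s by (simp add: vge_iff val_inverse)
  ultimately have u1: "vge (u - 1) e" using vge_mult[OF assms(3)] by fastforce
  have "(u - 1) * (\<Sum>i<p - 1. u ^ i) = 0" using power_diff_1_eq[of u "p - 1"] u by simp
  then have S: "(\<Sum>i<p - 1. u ^ i) = 0" using u by simp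
  have "vge ((\<Sum>i<p - 1. u ^ i) - of_nat (p - 1)) e"
    unfolding geometric_sum_minus using vge_power_minus_1[OF u1] assms(4) by (intro vge_sum) auto
  then have "vge (of_nat (p - 1)) e" unfolding S by simp
  moreover have "\<not> p dvd p - 1" using p_ge_3 by (auto dest: dvd_imp_le)
  ultimately show False
    using val_of_nat_coprime[of "p - 1"] p_ge_3 assms(4) by (auto simp: vge_iff)
qed

lemma v_pos_iff: "v x > 0 \<longleftrightarrow> (\<exists>e>0. vge x e)"
proof (cases "x = 0")
  case True
  then show ?thesis by (auto intro: exI[of _ 1])
next
  case False
  then show ?thesis by (auto simp: vge_iff v_eq_val intro: exI[of _ "val x"])
qed

lemma teich:
  assumes "\<not> p dvd a"
  shows "teich p v a \<in> Zpu v" "teich p v a ^ (p - 1) = 1" "vge (teich p v a - of_nat a) 1"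
proof -
  obtain t where t: "t \<in> Zpu v" "t ^ (p - 1) = 1" "vge (t - of_nat a) 1"
    using teichmueller_exists[OF assms] by blast
  have "teich p v a = t"
    unfolding teich_def
  proof (rule the_equality)
    show "t ^ (p - 1) = 1 \<and> 0 < v (t - of_nat a)" using t by (auto simp: v_pos_iff intro: exI[of _ 1])
    fix s assume s: "s ^ (p - 1) = 1 \<and> 0 < v (s - of_nat a)"
    then obtain e where "e > 0" "vge (s - of_nat a) e" unfolding v_pos_iff by blast
    then have "vge (s - of_nat a - (t - of_nat a)) (min e 1)"
      by (intro vge_diff[OF vge_mono[of "s - of_nat a" e] vge_mono[OF t(3)]]) auto
    then show "s = t" using root_of_unity_eqI[of s t "min e 1"] s t(2) \<open>e > 0\<close> by simp
  qed
  then show "teich p v a \<in> Zpu v" "teich p v a ^ (p - 1) = 1" "vge (teich p v a - of_nat a) 1"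
    using t by auto
qed

lemma teich_eqI:
  assumes "\<not> p dvd a" "t ^ (p - 1) = 1" "vge (t - of_nat a) 1"
  shows "teich p v a = t"
  using root_of_unity_eqI[OF teich(2)[OF assms(1)] assms(2), of 1]
    vge_trans_diff[OF teich(3)[OF assms(1)], of t] assms(3) by (simp add: vge_diff_commute)

lemma teich_1: "teich p v 1 = 1"
  using p_ge_3 by (intro teich_eqI) auto

lemma teich_mod: "\<not> p dvd a \<Longrightarrow> teich p v (a mod p) = teich p v a"
proof (rule teich_eqI)
  assume a: "\<not> p dvd a"
  then show "\<not> p dvd a mod p" "teich p v a ^ (p - 1) = 1" using teich by (auto simp: dvd_mod_iff)
  have "int p dvd int a - int (a mod p)" by (simp add: of_nat_mod)
  from vge_of_int_dvd[OF this] have "vge (of_nat a - of_nat (a mod p)) 1" by simp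
  with teich(3)[OF a] show "vge (teich p v a - of_nat (a mod p)) 1" by (rule vge_trans_diff)
qed

lemma p_not_dvd_mult: "\<not> p dvd a \<Longrightarrow> \<not> p dvd b \<Longrightarrow> \<not> p dvd a * b"
  using prime_p by (simp add: prime_dvd_mult_iff)

lemma vge_mult_diff:
  assumes "vge (x - x') e" "vge (y - y') e" "vge x' 0" "vge y 0"
  shows "vge (x * y - x' * y') e"
proof -
  have "x * y - x' * y' = (x - x') * y + x' * (y - y')" by (simp add: algebra_simps)
  then show ?thesis
    using vge_add[of "(x - x') * y" e "x' * (y - y')"] vge_mult[OF assms(1,4)] vge_mult[OF assms(3,2)] by simp
qed

lemma teich_mult: "\<not> p dvd a \<Longrightarrow> \<not> p dvd b \<Longrightarrow> teich p v (a * b) = teich p v a * teich p v b"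
proof (rule teich_eqI)
  assume *: "\<not> p dvd a" "\<not> p dvd b"
  then show "\<not> p dvd a * b" by (rule p_not_dvd_mult)
  show "(teich p v a * teich p v b) ^ (p - 1) = 1" using teich(2)[OF *(1)] teich(2)[OF *(2)] by (simp add: power_mult_distrib)
  have "vge (teich p v b) 0" using teich(1)[OF *(2)] Zp_vge by (auto simp: Zpu_iff)
  then show "vge (teich p v a * teich p v b - of_nat (a * b)) 1"
    using vge_mult_diff[OF teich(3)[OF *(1)] teich(3)[OF *(2)]] by simp
qed

lemma teich_nz: "\<not> p dvd a \<Longrightarrow> teich p v a \<noteq> 0"
  using teich(1) by (auto simp: Zpu_iff)

lemma Zpu_residue:
  assumes "x \<in> Zpu v"
  obtains a where "\<not> p dvd a" "vge (x - of_nat a) 1"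
proof -
  obtain k where k: "vge (x - of_int k) 1" using assms by (auto simp: Zpu_iff Zp_iff)
  define a where "a = nat (k mod int p)"
  have ka: "int a = k mod int p" by (simp add: a_def)
  have "int p dvd k - int a" by (simp add: ka)
  from vge_of_int_dvd[OF this] have "vge (of_int k - of_nat a) 1" by simp
  with k have xa: "vge (x - of_nat a) 1" by (rule vge_trans_diff)
  have "\<not> p dvd a"
  proof
    assume "p dvd a"
    then have "vge (of_nat a) 1" using vge_of_nat_dvd[of 1 a] by simp
    with xa have "vge x 1" using vge_add by fastforce
    then show False using assms by (simp add: Zpu_iff vge_iff)
  qed
  with xa show ?thesis by (rule that[rotated])
qed

section \<open>Finite-order characters, their components and their values at the generator\<close>

lemma fo_char_1: "fo_char v \<theta> \<Longrightarrow> \<theta> 1 = 1"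
proof -
  assume *: "fo_char v \<theta>"
  then have "\<theta> (1 * 1) = \<theta> 1 * \<theta> 1" using Zpu_1 unfolding fo_char_def by blast
  moreover have "\<theta> 1 \<noteq> 0" using * Zpu_1 unfolding fo_char_def by (metis power_0_left zero_neq_one not_gr_zero)
  ultimately show ?thesis by simp
qed

lemma fo_char_mult: "fo_char v \<theta> \<Longrightarrow> x \<in> Zpu v \<Longrightarrow> y \<in> Zpu v \<Longrightarrow> \<theta> (x * y) = \<theta> x * \<theta> y"
  unfolding fo_char_def by blast

lemma fo_char_power: "fo_char v \<theta> \<Longrightarrow> x \<in> Zpu v \<Longrightarrow> \<theta> (x ^ n) = \<theta> x ^ n"
  by (induction n) (auto simp: fo_char_1 fo_char_mult Zpu_power)

lemma dchar_psi_of: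
  assumes "fo_char v \<theta>"
  shows "dchar p (psi_of p v j \<theta>)"
  unfolding dchar_def
proof (intro conjI allI impI)
  show "psi_of p v j \<theta> a = psi_of p v j \<theta> (a mod p)" for a
    by (auto simp: psi_of_def teich_mod dvd_mod_iff)
  show "psi_of p v j \<theta> 1 = 1"
    using p_ge_3 fo_char_1[OF assms] by (auto simp: psi_of_def teich_1[simplified])
  show "psi_of p v j \<theta> (a * b) = psi_of p v j \<theta> a * psi_of p v j \<theta> b" for a b
  proof (cases "p dvd a \<or> p dvd b")
    case False
    then show ?thesis
      by (auto simp: psi_of_def p_not_dvd_mult teich_mult fo_char_mult[OF assms] teich power_int_mult_distrib)
  qed (auto simp: psi_of_def)
qed (simp add: psi_of_def)


text \<open>Congruence of the two powers modulo p^(k+1) forces p^k to divide the difference of the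
  exponents. Hence z^s depends only on \<gamma>^s modulo p^(k+1), which is what makes the character
  built below well defined.\<close>

lemma gamma_power_cong:
  fixes z :: 'k
  assumes "vge (\<gamma> ^ s - \<gamma> ^ t) (real k + 1)" "z ^ (p ^ k) = 1"
  shows "z ^ s = z ^ t"
proof -
  have *: "z ^ s = z ^ t" if st: "s \<le> t" and d: "vge (\<gamma> ^ t - \<gamma> ^ s) (real k + 1)" for s t
  proof -
    have "\<gamma> ^ (t - s) - 1 = inverse (\<gamma> ^ s) * (\<gamma> ^ t - \<gamma> ^ s)"
      using st by (simp add: power_diff field_simps)
    moreover have "vge (inverse (\<gamma> ^ s)) 0" by (simp add: vge_iff val_inverse val_power)
    ultimately have "vge (\<gamma> ^ (t - s) - 1) (real k + 1)" using vge_mult[OF _ d] by fastforce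
    from gamma_power_dvd[OF this] obtain q where "t - s = p ^ k * q" by (rule dvdE)
    then have "z ^ (t - s) = 1" using assms(2) by (metis power_mult power_one)
    then show ?thesis using st by (metis le_add_diff_inverse mult.right_neutral power_add)
  qed
  show ?thesis
  proof (cases "s \<le> t")
    case True
    then show ?thesis using assms(1) by (intro *) (simp_all only: vge_diff_commute[of "\<gamma> ^ t"])
  next
    case False
    then show ?thesis using *[of t s] assms(1) by simp
  qed
qed

text \<open>The decomposition x = \<omega>(x) \<gamma>^(s(x)) truncated modulo p^(k+1), with a
  natural exponent s. This precision is what fixes z^s when z^(p^k) = 1.\<close>

definition decomp :: "nat \<Rightarrow> 'k \<Rightarrow> nat \<Rightarrow> nat \<Rightarrow> bool" where
  "decomp k x a s \<longleftrightarrow> \<not> p dvd a \<and> vge (x - teich p v a * \<gamma> ^ s) (real k + 1)"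

lemma decomp_exists:
  assumes x: "x \<in> Zpu v"
  shows "\<exists>a s. decomp k x a s"
proof -
  obtain a where a: "\<not> p dvd a" "vge (x - of_nat a) 1" by (rule Zpu_residue[OF x])
  define t where "t = teich p v a"
  have t: "t \<in> Zpu v" "t ^ (p - 1) = 1" "vge (t - of_nat a) 1" "t \<noteq> 0"
    using teich[OF a(1)] teich_nz[OF a(1)] by (auto simp: t_def)
  \<comment> \<open>The inverse of t, written as a power of t so that it lies in
    \<open>Zpu v\<close> without further argument.\<close>
  define t' where "t' = t ^ (p - 2)"
  have "p - 1 = Suc (p - 2)" using p_ge_3 by simp
  then have tt': "t * t' = 1" using t(2) by (simp add: t'_def)
  have t': "t' \<in> Zpu v" using t(1) by (simp add: t'_def Zpu_power)
  have xt: "vge (x - t) 1" using a(2) t(3) vge_trans_diff vge_diff_commute by blast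
  have "vge ((x - t) * t') (1 + 0)" using xt Zp_vge t' by (intro vge_mult) (auto simp: Zpu_iff)
  then have "vge (x * t' - 1) 1" using tt' by (simp add: algebra_simps)
  then have "x * t' \<in> Um v 1" using x t' by (simp add: Um_iff Zpu_mult)
  from gamma_approx[OF this] obtain s where "vge (\<gamma> ^ s - x * t') (real k + 1)" by blast
  then have "vge (t * (\<gamma> ^ s - x * t')) (0 + (real k + 1))"
    using t(1) Zp_vge by (intro vge_mult) (auto simp: Zpu_iff)
  also have "t * (\<gamma> ^ s - x * t') = t * \<gamma> ^ s - x * (t * t')" by (simp add: algebra_simps)
  finally have "vge (x - t * \<gamma> ^ s) (real k + 1)" by (simp add: tt' vge_diff_commute)
  then show ?thesis using a(1) by (auto simp: decomp_def t_def)
qed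

text \<open>Modulo p the powers of \<gamma> disappear, so a and b agree modulo p and the
  Teichmueller parts coincide. Dividing by them leaves \<gamma>^s and \<gamma>^t congruent modulo
  p^(k+1).\<close>

lemma decomp_unique:
  fixes z :: 'k
  assumes "decomp k x a s" "decomp k x b t" "z ^ (p ^ k) = 1"
  shows "a mod p = b mod p" "teich p v a = teich p v b" "z ^ s = z ^ t"
proof -
  have ab: "\<not> p dvd a" "\<not> p dvd b" using assms by (auto simp: decomp_def)
  have d: "vge (teich p v a * \<gamma> ^ s - teich p v b * \<gamma> ^ t) (real k + 1)"
    using assms(1,2) vge_trans_diff vge_diff_commute unfolding decomp_def by metis
  have g: "vge (\<gamma> ^ i - 1) 1" for i using vge_power_minus_1[OF vge_gamma_minus_1] by simp
  have e: "vge (teich p v a * \<gamma> ^ s - of_nat a * 1) 1" if "\<not> p dvd a" for a s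
    using teich(3)[OF that] g[of s] by (rule vge_mult_diff) (auto simp: vge_iff val_power)
  have "vge (of_nat a - of_nat b) 1"
    using vge_trans_diff[OF e[OF ab(1), of s, unfolded vge_diff_commute[of _ "of_nat a * 1"]]
        vge_trans_diff[OF vge_mono[OF d] e[OF ab(2), of t]]] by simp
  from vge_of_nat_diff_imp[OF this] show m: "a mod p = b mod p" by simp
  then show T: "teich p v a = teich p v b" using teich_mod ab by metis
  define c where "c = teich p v b"
  have c: "c \<noteq> 0" "val c = 0" using teich(1)[OF ab(2)] by (auto simp: Zpu_iff c_def)
  have "\<gamma> ^ s - \<gamma> ^ t = inverse c * (c * \<gamma> ^ s - c * \<gamma> ^ t)"
    using c by (simp add: field_simps)
  moreover have "vge (inverse c) 0" using c by (simp add: vge_iff val_inverse)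
  ultimately have "vge (\<gamma> ^ s - \<gamma> ^ t) (real k + 1)"
    using vge_mult[OF _ d[unfolded T, folded c_def]] by fastforce
  then show "z ^ s = z ^ t" using assms(3) by (rule gamma_power_cong)
qed

lemma decomp_mult:
  assumes "decomp k x a s" "decomp k y b t" "y \<in> Zpu v"
  shows "decomp k (x * y) (a * b) (s + t)"
proof -
  have ab: "\<not> p dvd a" "\<not> p dvd b" using assms by (auto simp: decomp_def)
  have T: "teich p v a * \<gamma> ^ s \<in> Zpu v" using ab teich gamma_Zpu by (intro Zpu_mult Zpu_power)
  have "vge (x * y - (teich p v a * \<gamma> ^ s) * (teich p v b * \<gamma> ^ t)) (real k + 1)"
    using assms T Zp_vge by (intro vge_mult_diff) (auto simp: decomp_def Zpu_iff)
  then show ?thesis using ab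
    by (simp add: decomp_def p_not_dvd_mult teich_mult power_add mult_ac)
qed

text \<open>Every pair \<open>(\<psi>, z)\<close> comes from a finite-order character: on \<open>x = \<omega>(a) \<gamma>\<^sup>s\<close> it is
  \<open>\<psi>(a) \<omega>(a)\<^sup>-\<^sup>j z\<^sup>s\<close>.\<close>

lemma character_exists:
  assumes \<psi>: "dchar p \<psi>" and k: "k \<ge> 1" and z: "z \<in> prim_roots k"
  obtains \<theta> where "fo_char v \<theta>" "conductor_exp v \<theta> (k + 1)" "\<theta> \<gamma> = z" "psi_of p v j \<theta> = \<psi>"
proof -
  have zk: "z ^ (p ^ k) = 1" "z ^ (p ^ (k - 1)) \<noteq> 1" using z by (auto simp: prim_roots_def)
  define F where "F a s = \<psi> a * teich p v a powi (- j) * z ^ s" for a s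
  define \<theta> where "\<theta> x = (case (SOME q. decomp k x (fst q) (snd q)) of (a, s) \<Rightarrow> F a s)" for x
  have dmod: "\<psi> a = \<psi> (a mod p)" for a using \<psi> by (simp add: dchar_def)
  have \<theta>: "\<theta> x = F a s" if d: "decomp k x a s" for x a s
  proof -
    define q where "q = (SOME q. decomp k x (fst q) (snd q))"
    have "decomp k x (fst (a, s)) (snd (a, s))" using d by simp
    then have "decomp k x (fst q) (snd q)" unfolding q_def by (rule someI)
    from decomp_unique[OF this d zk(1)] have "F (fst q) (snd q) = F a s"
      unfolding F_def using dmod by metis
    then show ?thesis by (simp add: \<theta>_def case_prod_unfold q_def)
  qed
  have mult: "\<psi> (a * b) = \<psi> a * \<psi> b" for a b using \<psi> by (simp add: dchar_def)
  have psi1: "\<psi> 1 = 1" using \<psi> by (simp add: dchar_def)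
  have psipow: "\<psi> (a ^ n) = \<psi> a ^ n" for a n by (induction n) (simp_all add: mult psi1[simplified])
  have 1: "fo_char v \<theta>"
    unfolding fo_char_def
  proof (intro conjI ballI exI)
    fix x y assume xy: "x \<in> Zpu v" "y \<in> Zpu v"
    obtain a s b t where d: "decomp k x a s" "decomp k y b t" using decomp_exists xy by metis
    have ab: "\<not> p dvd a" "\<not> p dvd b" using d by (auto simp: decomp_def)
    show "\<theta> (x * y) = \<theta> x * \<theta> y"
      unfolding \<theta>[OF d(1)] \<theta>[OF d(2)] \<theta>[OF decomp_mult[OF d xy(2)]] F_def
      by (simp add: mult teich_mult[OF ab] power_int_mult_distrib power_add mult_ac)
  next
    \<comment> \<open>The factor p - 1 kills the values of \<psi> and the Teichmueller part, the
      factor p^k kills the powers of z.\<close>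
    show "0 < (p - 1) * p ^ k" using p_ge_3 by simp
  next
    fix x assume "x \<in> Zpu v"
    then obtain a s where d: "decomp k x a s" using decomp_exists by metis
    then have a: "\<not> p dvd a" by (simp add: decomp_def)
    have "vge (of_nat (a ^ (p - 1)) - of_nat 1) 1" using vge_fermat_unit[OF a] by simp
    from vge_of_nat_diff_imp[OF this] have "\<psi> a ^ (p - 1) = 1"
      using dmod[of "a ^ (p - 1)"] dmod[of 1] psi1 psipow by simp
    moreover have "(teich p v a powi (- j)) ^ (p - 1) = (teich p v a ^ (p - 1)) powi (- j)"
      by (metis mult.commute power_int_mult power_int_of_nat)
    then have "(teich p v a powi (- j)) ^ (p - 1) = 1" using teich(2)[OF a] by simp
    moreover have "(z ^ s) ^ (p ^ k) = 1" using zk(1) by (metis mult.commute power_mult power_one)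
    ultimately show "\<theta> x ^ ((p - 1) * p ^ k) = 1"
      unfolding \<theta>[OF d] F_def power_mult_distrib
      by (metis (no_types, lifting) mult.commute mult_1 power_mult power_one)
  qed
  have n1: "\<not> p dvd 1" using p_ge_3 by auto
  have 2: "\<theta> x = 1" if "vge (x - 1) (real k + 1)" for x
    using \<theta>[of x 1 0] that teich_1 psi1 n1 by (simp add: decomp_def F_def)
  have 3: "\<theta> (\<gamma> ^ s) = z ^ s" for s
    using \<theta>[of "\<gamma> ^ s" 1 s] teich_1 psi1 n1 by (simp add: decomp_def F_def)
  have 4: "\<theta> (teich p v a) = \<psi> a * teich p v a powi (- j)" if "\<not> p dvd a" for a
    using \<theta>[of "teich p v a" a 0] that by (simp add: decomp_def F_def)
  have "conductor_exp v \<theta> (k + 1)"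
  proof -
    \<comment> \<open>This element shows that the conductor exponent is not smaller: its image
      z^(p^(k-1)) is not 1, as z is primitive.\<close>
    have "\<gamma> ^ (p ^ (k - 1)) \<in> Um v k"
      using vge_gamma_p_power[of "k - 1"] k gamma_Zpu by (simp add: Um_iff Zpu_power of_nat_diff)
    moreover have "\<theta> (\<gamma> ^ (p ^ (k - 1))) \<noteq> 1" using 3 zk(2) by simp
    moreover have "\<theta> x = 1" if "x \<in> Um v (k + 1)" for x
      using that by (intro 2) (simp add: Um_iff add.commute)
    ultimately show ?thesis unfolding conductor_exp_def by auto
  qed
  moreover have "psi_of p v j \<theta> = \<psi>"
  proof
    fix a
    show "psi_of p v j \<theta> a = \<psi> a"
    proof (cases "p dvd a")
      case True
      then show ?thesis using \<psi> by (simp add: psi_of_def dchar_def)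
    next
      case False
      then show ?thesis using teich_nz[OF False] by (simp add: psi_of_def 4 power_int_minus)
    qed
  qed
  ultimately show ?thesis using that[OF 1] 3[of 1] by simp
qed

text \<open>If the order of \<theta> \<gamma> divided p^(m-2), then \<theta> would be trivial on all
  of U_(m-1), because an element there is a power \<gamma>^s modulo p^m with p^(m-2) dividing s. For
  m = 1 the first claim reads \<theta> \<gamma> = 1.\<close>

lemma character_gamma:
  assumes \<theta>: "fo_char v \<theta>" and m: "conductor_exp v \<theta> m"
  shows "\<theta> \<gamma> ^ (p ^ (m - 1)) = 1" "m \<ge> 2 \<Longrightarrow> \<theta> \<gamma> \<in> prim_roots (m - 1)"
proof -
  have m1: "m \<ge> 1" and triv: "\<And>x. x \<in> Um v m \<Longrightarrow> \<theta> x = 1"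
    and nontriv: "\<exists>x\<in>Um v (m - 1). \<theta> x \<noteq> 1"
    using m by (auto simp: conductor_exp_def)
  have "\<gamma> ^ (p ^ (m - 1)) \<in> Um v m"
    using vge_gamma_p_power[of "m - 1"] m1 gamma_Zpu by (simp add: Um_iff Zpu_power of_nat_diff)
  from triv[OF this] show 1: "\<theta> \<gamma> ^ (p ^ (m - 1)) = 1"
    by (simp add: fo_char_power[OF \<theta> gamma_Zpu])
  assume m2: "m \<ge> 2"
  have "\<theta> \<gamma> ^ (p ^ (m - 1 - 1)) \<noteq> 1"
  proof
    assume tr: "\<theta> \<gamma> ^ (p ^ (m - 1 - 1)) = 1"
    obtain x where x: "x \<in> Um v (m - 1)" "\<theta> x \<noteq> 1" using nontriv by blast
    have xZ: "x \<in> Zpu v" "vge (x - 1) (real (m - 1))" using x(1) by (auto simp: Um_iff)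
    have "vge (x - 1) 1" by (rule vge_mono[OF xZ(2)]) (use m2 in simp)
    then have "x \<in> Um v 1" using xZ by (simp add: Um_iff)
    from gamma_approx[OF this] obtain s where s: "vge (\<gamma> ^ s - x) (real m)" by blast
    have "vge (\<gamma> ^ s - 1) (real (m - 1))"
      by (rule vge_trans_diff[OF vge_mono[OF s] xZ(2)]) simp
    then have "vge (\<gamma> ^ s - 1) (real (m - 2) + 1)" using m2 by (simp add: of_nat_diff)
    from gamma_power_dvd[OF this] have sd: "p ^ (m - 2) dvd s" .
    \<comment> \<open>\<gamma>^t is an inverse of \<gamma>^s modulo p^m with a natural exponent: s +
      t = s p^(m-1), and \<gamma>^(p^(m-1)) is 1 modulo p^m. Being a multiple of s, t is divisible
      by p^(m-2) as well.\<close>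
    define t where "t = s * (p ^ (m - 1) - 1)"
    have st: "s + t = s * p ^ (m - 1)"
      unfolding t_def by (metis Suc_pred' mult_Suc_right p_pos zero_less_power)
    have g: "vge (\<gamma> ^ (s + t) - 1) (real m)"
    proof -
      have "vge ((\<gamma> ^ (p ^ (m - 1))) ^ s - 1) (real (m - 1) + 1)"
        using vge_gamma_p_power[of "m - 1"] by (rule vge_power_minus_1) simp
      then show ?thesis using m1 by (simp add: st power_mult[symmetric] mult.commute of_nat_diff)
    qed
    have "vge ((x - \<gamma> ^ s) * \<gamma> ^ t) (real m + 0)"
      using s by (intro vge_mult) (auto simp: vge_diff_commute vge_iff val_power)
    then have "vge (x * \<gamma> ^ t - \<gamma> ^ (s + t)) (real m)" by (simp add: algebra_simps power_add)
    with g have "vge (x * \<gamma> ^ t - 1) (real m)" using vge_trans_diff by blast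
    then have "x * \<gamma> ^ t \<in> Um v m" using xZ(1) gamma_Zpu by (simp add: Um_iff Zpu_mult Zpu_power)
    from triv[OF this] have "\<theta> x * \<theta> \<gamma> ^ t = 1"
      using xZ(1) gamma_Zpu by (simp add: fo_char_mult[OF \<theta>] fo_char_power[OF \<theta>] Zpu_power)
    moreover have "p ^ (m - 2) dvd t" using sd by (simp add: t_def)
    then obtain q where "t = p ^ (m - 1 - 1) * q" by (auto simp: numeral_2_eq_2)
    then have "\<theta> \<gamma> ^ t = 1" using tr by (simp only: power_mult power_one)
    ultimately show False using x(2) by simp
  qed
  with 1 show "\<theta> \<gamma> \<in> prim_roots (m - 1)" by (simp add: prim_roots_def)
qed


section \<open>Growth\<close>

lemma less_p_power_ell: "k < p ^ ell p k"
  unfolding ell_def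
proof (rule LeastI)
  have "k < 2 ^ k" by (rule less_exp)
  also have "(2::nat) ^ k \<le> p ^ k" using p_ge_3 by (intro power_mono) auto
  finally show "k < p ^ k" .
qed

lemma p_power_le_of_less_ell: "i < ell p k \<Longrightarrow> p ^ i \<le> k"
  unfolding ell_def using not_less_Least by (metis linorder_not_less)

lemma Rplus_iff: "Rplus p v s f \<longleftrightarrow> (\<exists>B. \<forall>k. vge (fps_nth f k) (B - s * real (ell p k)))"
proof -
  have "(ereal B \<le> v x + ereal c) \<longleftrightarrow> vge x (B - c)" for B c x
    unfolding vge_def by (cases "v x") auto
  then show ?thesis unfolding Rplus_def by simp
qed

lemma gauss_ge_mono_radius: "gauss_ge \<rho> B f \<Longrightarrow> \<rho> \<le> \<sigma> \<Longrightarrow> gauss_ge \<sigma> B f"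
  unfolding gauss_ge_def
proof
  fix k assume *: "\<forall>k. vge (f $ k) (B - real k * \<rho>)" "\<rho> \<le> \<sigma>"
  have "real k * \<rho> \<le> real k * \<sigma>" using *(2) by (intro mult_left_mono) auto
  then show "vge (f $ k) (B - real k * \<sigma>)" using vge_mono[OF spec[OF *(1), of k]] by simp
qed

text \<open>Only coefficients with \<open>ell p k\<close> = h + 1 + u need an argument. There k
  \<ge> p^(h+u), so the term k / p^h is at least 3^u \<ge> u^2, and s u \<le> s^2 + u^2 absorbs the
  excess. The constant thus drops by s for the extra 1 and by s^2.\<close>

lemma Rplus_imp_gauss_ge:
  assumes "Rplus p v s f" "s \<ge> 0"
  obtains C where "\<And>h. gauss_ge (1 / real p ^ h) (C - s * real h) f"
proof -
  obtain B where B: "\<And>k. vge (f $ k) (B - s * real (ell p k))"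
    using assms(1) unfolding Rplus_iff by blast
  have sq: "real u * real u \<le> 3 ^ u" for u :: nat
  proof (induction u rule: less_induct)
    case (less u)
    consider "u = 0" | "u = 1" | "u = 2" | "u \<ge> 3" by linarith
    then show ?case
    proof cases
      case 4
      then obtain w where w: "u = Suc w" "w \<ge> 2" by (cases u) auto
      have "2 * real w \<le> real w * real w" using w by (intro mult_right_mono) auto
      moreover have "real u * real u = real w * real w + 2 * real w + 1"
        unfolding w(1) by (simp add: algebra_simps)
      ultimately have "real u * real u \<le> 3 * (real w * real w)" using w(2) by linarith
      also have "\<dots> \<le> 3 * 3 ^ w" using less[of w] w by simp
      finally show ?thesis using w by simp
    qed auto
  qed
  have "gauss_ge (1 / real p ^ h) (B - s - s * s - s * real h) f" for h
    unfolding gauss_ge_def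
  proof
    fix k
    define l where "l = ell p k"
    have "s * real l \<le> s + s * s + s * real h + real k * (1 / real p ^ h)"
    proof (cases "l \<le> h")
      case True
      then have "s * real l \<le> s * real h" using assms(2) by (intro mult_left_mono) auto
      moreover have "0 \<le> real k * (1 / real p ^ h)" "0 \<le> s * s" by auto
      ultimately show ?thesis using assms(2) by linarith
    next
      case False
      then obtain u where u: "l = Suc (h + u)" by (metis add_Suc less_natE linorder_not_less)
      have "p ^ (h + u) \<le> k" using u by (intro p_power_le_of_less_ell) (simp add: l_def)
      then have "real p ^ (h + u) \<le> real k" by (metis of_nat_le_iff of_nat_power)
      then have "real p ^ u \<le> real k * (1 / real p ^ h)" by (simp add: power_add field_simps)
      moreover have "(3::real) ^ u \<le> real p ^ u" using p_ge_3 by (intro power_mono) auto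
      moreover have "s * real u \<le> s * s + real u * real u"
      proof -
        have "0 \<le> (s - real u) * (s - real u)" by simp
        moreover have "0 \<le> s * real u" using assms(2) by simp
        ultimately show ?thesis by (simp add: algebra_simps)
      qed
      ultimately show ?thesis using sq[of u] by (simp add: u algebra_simps)
    qed
    then show "vge (f $ k) (B - s - s * s - s * real h - real k * (1 / real p ^ h))"
      by (intro vge_mono[OF B]) (simp add: l_def)
  qed
  then show ?thesis by (rule that)
qed

text \<open>The k-th coefficient is read off at the radius with h = \<open>ell p k\<close>, where k
  / p^h < 1, so that only 1 is lost.\<close>

lemma Rplus_if_gauss_ge:
  assumes "\<And>h. gauss_ge (1 / real p ^ h) (C - s * real h) f"
  shows "Rplus p v s f"
  unfolding Rplus_iff
proof (intro exI allI)
  fix k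
  define h where "h = ell p k"
  have "real k < real p ^ h" using less_p_power_ell[of k] by (metis h_def of_nat_less_iff of_nat_power)
  then have "real k * (1 / real p ^ h) \<le> 1" by (simp add: field_simps)
  then show "vge (f $ k) (C - 1 - s * real (ell p k))"
    using gauss_ge_nth[OF assms[of h], of k] by (auto elim!: vge_mono simp: h_def)
qed

lemma Rplus_imp_disc_conv:
  assumes "Rplus p v s f" "s \<ge> 0"
  shows "disc_conv f"
  unfolding disc_conv_def
proof (intro allI impI)
  fix \<rho> :: real assume "\<rho> > 0"
  moreover have "1 / real p < 1" using p_ge_3 by simp
  ultimately obtain h where "(1 / real p) ^ h < \<rho>" using real_arch_pow_inv by blast
  then have "1 / real p ^ h \<le> \<rho>" by (simp add: power_divide)
  then show "\<exists>B. gauss_ge \<rho> B f" using Rplus_imp_gauss_ge[OF assms] gauss_ge_mono_radius by metis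
qed

lemma Rplus_add:
  assumes "Rplus p v s f" "Rplus p v s g"
  shows "Rplus p v s (f + g)"
proof -
  obtain B C where B: "\<And>k. vge (f $ k) (B - s * real (ell p k))" "\<And>k. vge (g $ k) (C - s * real (ell p k))"
    using assms unfolding Rplus_iff by blast
  have "vge ((f + g) $ k) (min B C - s * real (ell p k))" for k
    using vge_mono[OF B(1)[of k]] vge_mono[OF B(2)[of k]] by (auto intro!: vge_add)
  then show ?thesis unfolding Rplus_iff by blast
qed

lemma Rplus_cmult:
  assumes "Rplus p v s f"
  shows "Rplus p v s (fps_const c * f)"
proof -
  obtain B where B: "\<And>k. vge (f $ k) (B - s * real (ell p k))"
    using assms unfolding Rplus_iff by blast
  have "vge ((fps_const c * f) $ k) (val c + B - s * real (ell p k))" for k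
    using vge_mult[OF vge_val[of c] B[of k]] by (simp add: algebra_simps)
  then show ?thesis unfolding Rplus_iff by blast
qed

lemma Rplus_diff:
  assumes "Rplus p v s f" "Rplus p v s g"
  shows "Rplus p v s (f - g)"
  using Rplus_add[OF assms(1) Rplus_cmult[OF assms(2), of "-1"]] by (simp flip: fps_const_neg)


section \<open>Size of the logarithm at radius p^(-h)\<close>

lemma defect_nonneg: "defect \<rho> pos M \<ge> 0"
  unfolding defect_def by (intro sum_nonneg) auto

lemma defect_le: "defect (1 / real p ^ h) pos M \<le> (real h + 1) / 2"
proof -
  \<comment> \<open>H bounds the number of indices of either parity up to h. For m > H the index
    exceeds h, so \<open>cdeg\<close> is at least p^h and the summand vanishes.\<close>
  define H where "H = (h + 1) div 2"
  have "defect (1 / real p ^ h) pos M \<le> (\<Sum>m=1..M. if m \<le> H then 1 else 0)"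
    unfolding defect_def
  proof (intro sum_mono)
    fix m assume "m \<in> {1..M}"
    show "1 - min (real (cdeg (idx pos m)) * (1 / real p ^ h)) 1 \<le> (if m \<le> H then 1 else 0)"
    proof (cases "m \<le> H")
      case True
      then show ?thesis by simp
    next
      case False
      then have "h \<le> idx pos m - 1" by (auto simp: idx_def H_def)
      then have "1 * p ^ h \<le> (p - 1) * p ^ (idx pos m - 1)"
        using p_ge_3 by (intro mult_le_mono power_increasing) auto
      then have "real (p ^ h) \<le> real (cdeg (idx pos m))" unfolding cdeg_def by (metis mult_1 of_nat_le_iff)
      then show ?thesis using False by (simp add: field_simps)
    qed
  qed
  also have "\<dots> = real (card {m \<in> {1..M}. m \<le> H})" by (simp add: sum.If_cases Int_def)
  also have "\<dots> \<le> real (card {1..H})" by (intro of_nat_mono card_mono) auto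
  also have "\<dots> \<le> (real h + 1) / 2" unfolding H_def by simp
  finally show ?thesis .
qed

text \<open>The H = h div 2 smallest indices are at most h, and the m-th summand falls short of 1 by
  at most (1/2)^(H-m). The geometric series bounds the total shortfall by 2, and rounding h/2 down
  costs another 1/2. M \<ge> h ensures that all H summands occur.\<close>

lemma defect_ge:
  assumes "M \<ge> h"
  shows "defect (1 / real p ^ h) pos M \<ge> real h / 2 - 5 / 2"
proof -
  define H where "H = h div 2"
  have geo: "(\<Sum>m=1..N. (1/2::real) ^ (N - m)) \<le> 2" for N :: nat
  proof (induction N)
    case (Suc N)
    have "(\<Sum>m=1..Suc N. (1/2::real) ^ (Suc N - m)) = (\<Sum>m=1..N. (1/2) * (1/2) ^ (N - m)) + 1"
      by (auto simp: Suc_diff_le intro!: sum.cong)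
    also have "\<dots> = (1/2) * (\<Sum>m=1..N. (1/2) ^ (N - m)) + 1" by (simp only: sum_distrib_left)
    finally show ?case using Suc by simp
  qed simp
  have "real H - 2 \<le> (\<Sum>m=1..H. 1 - (1/2::real) ^ (H - m))"
    using geo[of H] by (simp add: sum_subtractf)
  also have "\<dots> \<le> (\<Sum>m=1..H. 1 - min (real (cdeg (idx pos m)) * (1 / real p ^ h)) 1)"
  proof (intro sum_mono diff_left_mono)
    fix m assume m: "m \<in> {1..H}"
    define k where "k = idx pos m"
    have k: "k \<ge> 1" "H - m \<le> h - k" "k \<le> h" using m by (auto simp: k_def idx_def H_def)
    have "cdeg k \<le> p * p ^ (k - 1)" unfolding cdeg_def by (intro mult_right_mono) auto
    also have "\<dots> = p ^ k" using p_power_pred[OF k(1)] by simp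
    finally have "real (cdeg k) \<le> real p ^ k" by (metis of_nat_le_iff of_nat_power)
    then have "real (cdeg k) * (1 / real p ^ h) \<le> real p ^ k * (1 / real p ^ h)"
      by (intro mult_right_mono) auto
    also have "\<dots> = (1 / real p) ^ (h - k)" using k(3) by (simp add: power_diff power_divide)
    also have "\<dots> \<le> (1 / 2) ^ (h - k)" using p_ge_3 by (intro power_mono) (auto simp: field_simps)
    also have "\<dots> \<le> (1 / 2) ^ (H - m)" using k(2) by (intro power_decreasing) auto
    finally show "min (real (cdeg (idx pos m)) * (1 / real p ^ h)) 1 \<le> (1/2) ^ (H - m)"
      by (auto simp: k_def)
  qed
  also have "\<dots> \<le> defect (1 / real p ^ h) pos M"
    unfolding defect_def using assms by (intro sum_mono2) (auto simp: H_def)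
  finally have "real H - 2 \<le> defect (1 / real p ^ h) pos M" .
  moreover have "real h / 2 - 1 / 2 \<le> real H" unfolding H_def by linarith
  ultimately show ?thesis by simp
qed

text \<open>The bound on the partial products is uniform in M and so passes to the limit. The
  constant 3/2 is the 1/2 from \<open>defect_le\<close> plus the 1 for the leading factor
  1/p.\<close>

lemma Rplus_log_Pi:
  assumes "finite C"
  shows "Rplus p v (real (card C) / 2) (log_Pi p v \<gamma> pos C)"
proof (rule Rplus_if_gauss_ge)
  fix h
  have "gauss_ge (1 / real p ^ h) (- (real (card C) * 3 / 2) - real (card C) / 2 * real h) (partial_log_Pi pos C M)" for M
  proof (rule gauss_ge_mono[OF gauss_ge_partial_log_Pi[OF assms]])
    have "real (card C) * (defect (1 / real p ^ h) pos M + 1) \<le> real (card C) * ((real h + 1) / 2 + 1)"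
      using defect_le by (intro mult_left_mono add_right_mono) auto
    then show "- (real (card C) * 3 / 2) - real (card C) / 2 * real h
        \<le> - (real (card C) * (defect (1 / real p ^ h) pos M + 1))" by (simp add: field_simps)
  qed
  then show "gauss_ge (1 / real p ^ h) (- (real (card C) * 3 / 2) - real (card C) / 2 * real h) (log_Pi p v \<gamma> pos C)"
    by (intro glim_gauss_ge[OF glim_log_Pi]) simp
qed

lemma peval_log_Pi_nz:
  assumes x: "vge x \<sigma>" "\<sigma> > 0" and "finite C"
    and nz: "\<And>j m z. j \<in> C \<Longrightarrow> m \<ge> 1 \<Longrightarrow> z \<in> prim_roots (idx pos m) \<Longrightarrow> x \<noteq> pt j z"
  shows "peval v (log_Pi p v \<gamma> pos C) x \<noteq> 0"
  unfolding log_Pi_def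
  using peval_log_pj_nz[OF x] nz \<open>finite C\<close> by (simp add: peval_prod[OF x] disc_conv_log_pj)

text \<open>The point 0 is never of the form \<gamma>^j z - 1 with z primitive of level at least 1,
  so the logarithm does not vanish there. As power series over a field form a domain, this gives
  uniqueness of the quotients.\<close>

lemma log_Pi_nz: "finite C \<Longrightarrow> log_Pi p v \<gamma> pos C \<noteq> 0"
proof
  assume "finite C" and 0: "log_Pi p v \<gamma> pos C = 0"
  have "peval v (log_Pi p v \<gamma> pos C) 0 \<noteq> 0"
    using pt_prim_root(1) idx_ge(1) \<open>finite C\<close> by (intro peval_log_Pi_nz[of 0 1]) (auto, metis)
  then show False using peval_const[of 0 1 0] 0 by simp
qed

lemma partial_log_Pi_nz: "finite C \<Longrightarrow> partial_log_Pi pos C M \<noteq> 0"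
proof -
  assume C: "finite C"
  obtain c where c: "c \<noteq> 0"
    "partial_log_Pi pos C M = fps_const c * (\<Prod>i\<in>zeros pos C M. fps_X - fps_const (pt (fst (fst i)) (snd i)))"
    by (rule partial_log_Pi_eq_prod[OF C])
  have "fps_X - fps_const a \<noteq> 0" for a :: 'k
  proof
    assume "fps_X - fps_const a = 0"
    then have "(fps_X - fps_const a) $ 1 = 0" by simp
    then show False by simp
  qed
  then show ?thesis using c finite_zeros[OF C] by simp
qed

text \<open>The quotients by the partial products converge because consecutive ones differ by the
  factors of the logarithm, which tend to \<open>1\<close>.\<close>

lemma divide_log_Pi:
  assumes C: "finite C" and r: "r \<ge> 0" and f: "Rplus p v r f"
    and 0: "\<And>j m z. j \<in> C \<Longrightarrow> m \<ge> 1 \<Longrightarrow> z \<in> prim_roots (idx pos m) \<Longrightarrow> peval v f (pt j z) = 0"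
  obtains g where "f = log_Pi p v \<gamma> pos C * g" "Rplus p v (r - real (card C) / 2) g" "disc_conv g"
proof -
  have cdf: "disc_conv f" by (rule Rplus_imp_disc_conv[OF f r])
  obtain g where g: "\<And>M. f = partial_log_Pi pos C M * g M"
    and gauss_ge_g: "\<And>M \<rho> B. gauss_ge \<rho> B f \<Longrightarrow> gauss_ge \<rho> (B + real (card C) * (defect \<rho> pos M + 1)) (g M)"
  proof -
    have "\<forall>M. \<exists>g. f = partial_log_Pi pos C M * g \<and>
      (\<forall>\<rho> B. gauss_ge \<rho> B f \<longrightarrow> gauss_ge \<rho> (B + real (card C) * (defect \<rho> pos M + 1)) g)"
      by (intro allI divide_partial_log_Pi C cdf 0)
    then show ?thesis using that by metis
  qed
  \<comment> \<open>Since the defect is nonnegative, every Gauss bound for f is shared by all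
    quotients; this uniformity makes the differences of consecutive quotients tend to 0.\<close>
  have gauss_ge_g': "gauss_ge \<rho> B (g M)" if "gauss_ge \<rho> B f" for \<rho> B M
    by (rule gauss_ge_mono[OF gauss_ge_g[OF that]]) (use defect_nonneg[of \<rho> pos M] in simp)
  have cdg: "disc_conv (g M)" for M using cdf gauss_ge_g' unfolding disc_conv_def by blast
  define Q where "Q m = (\<Prod>j\<in>C. Phi_factor (idx pos m) j)" for m
  have "glim (\<lambda>m. Phi_factor (idx pos m) j) 1" for j
    unfolding glim_def using Phi_factor_tendsto_1 by blast
  then have "glim (\<lambda>m. \<Prod>j\<in>C. Phi_factor (idx pos m) j) (\<Prod>j\<in>C. 1)"
    using disc_conv_const[of 1] by (intro glim_prod) auto
  then have Q: "glim Q 1" by (simp add: Q_def[abs_def])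
  have step: "g (Suc M) - g M = (1 - Q (Suc M)) * g (Suc M)" for M
  proof -
    have "partial_log_Pi pos C (Suc M) = partial_log_Pi pos C M * Q (Suc M)"
      by (simp add: partial_log_Pi_def partial_log_pj_def Q_def mult.assoc flip: prod.distrib)
    then have "partial_log_Pi pos C M * g M = partial_log_Pi pos C M * (Q (Suc M) * g (Suc M))"
      using g[of M] g[of "Suc M"] by (metis mult.assoc)
    then have "g M = Q (Suc M) * g (Suc M)" using partial_log_Pi_nz[OF C] by simp
    then show ?thesis by (simp add: algebra_simps)
  qed
  have "\<forall>\<^sub>F M in sequentially. gauss_ge \<rho> e (g (Suc M) - g M)" if \<rho>: "\<rho> > 0" for \<rho> e
  proof -
    obtain B where B: "gauss_ge \<rho> B f" using cdf \<rho> unfolding disc_conv_def by blast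
    have "\<forall>\<^sub>F M in sequentially. gauss_ge \<rho> (e - B) (Q M - 1)" using Q \<rho> unfolding glim_def by blast
    then have "\<forall>\<^sub>F M in sequentially. gauss_ge \<rho> (e - B) (Q (Suc M) - 1)"
      using eventually_sequentially_Suc[of "\<lambda>M. gauss_ge \<rho> (e - B) (Q M - 1)"] by simp
    then show ?thesis
    proof eventually_elim
      case (elim M)
      from gauss_ge_mult[OF elim[unfolded gauss_ge_diff_commute[of _ _ _ 1]] gauss_ge_g'[OF B, of "Suc M"]]
      show ?case unfolding step by simp
    qed
  qed
  then obtain g0 where g0: "glim g g0" by (rule glim_complete)
  have cdg0: "disc_conv g0" by (rule glim_disc_conv[OF g0 cdg])
  have "glim (\<lambda>M. partial_log_Pi pos C M * g M) (log_Pi p v \<gamma> pos C * g0)"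
    by (intro glim_mult glim_log_Pi g0 disc_conv_log_Pi cdg0)
  then have "glim (\<lambda>M. f) (log_Pi p v \<gamma> pos C * g0)" by (simp flip: g)
  then have eq: "f = log_Pi p v \<gamma> pos C * g0" using glim_unique glim_const by blast
  obtain B where B: "\<And>h. gauss_ge (1 / real p ^ h) (B - r * real h) f" using Rplus_imp_gauss_ge[OF f r] by blast
  have "Rplus p v (r - real (card C) / 2) g0"
  proof (rule Rplus_if_gauss_ge)
    fix h
    have "\<forall>\<^sub>F M in sequentially.
      gauss_ge (1 / real p ^ h) ((B - real (card C) * (3 / 2)) - (r - real (card C) / 2) * real h) (g M)"
      using eventually_ge_at_top[of h]
    proof eventually_elim
      case (elim M)
      \<comment> \<open>The 3/2 is the 5/2 of \<open>defect_ge\<close> less the 1 gained from the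
        leading factor 1/p; the term h/2 lowers the order by \<open>card C\<close> / 2.\<close>
      have "real (card C) * (real h / 2 - 3 / 2) \<le> real (card C) * (defect (1 / real p ^ h) pos M + 1)"
        using defect_ge[OF elim, of pos] by (intro mult_left_mono) auto
      then show ?case by (intro gauss_ge_mono[OF gauss_ge_g[OF B]]) (simp add: algebra_simps)
    qed
    then show "gauss_ge (1 / real p ^ h) ((B - real (card C) * (3 / 2)) - (r - real (card C) / 2) * real h) g0"
      by (rule glim_gauss_ge[OF g0])
  qed
  with eq cdg0 show ?thesis using that by blast
qed

lemma character_point:
  assumes "fo_char v \<theta>" "conductor_exp v \<theta> m"
  obtains \<sigma> where "\<sigma> > 0" "vge (pt j (\<theta> \<gamma>)) \<sigma>"
proof (cases "m \<ge> 2")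
  case True
  note z = character_gamma(2)[OF assms True]
  have "m - 1 \<ge> 1" using True by simp
  from pt_prim_root(2)[OF this z, of j] cdeg_ge_2[of "m - 1"] have "val (pt j (\<theta> \<gamma>)) > 0" by simp
  then show ?thesis using that vge_val by blast
next
  case False
  then have "m = 1" using assms(2) by (auto simp: conductor_exp_def)
  then have "\<theta> \<gamma> = 1" using character_gamma(1)[OF assms] by simp
  then show ?thesis using that[of 1] vge_gamma_powi_minus_1 by (simp add: pt_def)
qed

text \<open>\<theta> \<gamma> has order exactly p^(m-1), and m - 1 has the wrong parity to be a
  level of the logarithm in question. For m = 1 the value is 1, which is primitive of no
  level.\<close>

lemma character_point_not_zero:
  assumes \<theta>: "fo_char v \<theta>" "conductor_exp v \<theta> m" and par: "even m \<longleftrightarrow> pos"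
    and m': "m' \<ge> 1" "z \<in> prim_roots (idx pos m')"
  shows "pt j (\<theta> \<gamma>) \<noteq> pt j' z"
proof
  assume eq: "pt j (\<theta> \<gamma>) = pt j' z"
  have "z ^ (p ^ idx pos m') = 1" using m' by (simp add: prim_roots_def)
  from pt_inj(2)[OF eq character_gamma(1)[OF \<theta>] this] have z: "\<theta> \<gamma> = z" .
  show False
  proof (cases "m \<ge> 2")
    case True
    then have "m - 1 = idx pos m'"
      using prim_roots_disjoint[OF character_gamma(2)[OF \<theta> True, unfolded z] m'(2)] idx_ge(1)[OF m'(1)] by simp
    then have "m = Suc (idx pos m')" using True by simp
    then show False using par m'(1) by (auto simp: idx_def split: if_splits)
  next
    case False
    then have "m = 1" using \<theta>(2) by (auto simp: conductor_exp_def)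
    then have "z = 1" using character_gamma(1)[OF \<theta>] z by simp
    then show False using prim_roots_neq_1[OF m'(2)] by simp
  qed
qed

end

section \<open>Factorisation, growth and interpolation of the given distributions\<close>

theorem mainTheorem6:
  fixes p n :: nat and v :: "'k::field_char_0 \<Rightarrow> ereal" and \<gamma> :: 'k
    and \<mu> :: "nat \<Rightarrow> int" and w :: int and sat :: "nat \<Rightarrow> 'k" and lam :: 'k
    and r :: real
    and La Lb :: "'k dist"
    and \<xi> :: "int \<Rightarrow> 'k" and c :: "int \<Rightarrow> ('k \<Rightarrow> 'k) \<Rightarrow> 'k"
    and Lval :: "('k \<Rightarrow> 'k) \<Rightarrow> int \<Rightarrow> 'k"
    and h :: "nat \<Rightarrow> int" and Crit :: "int set" and \<alpha> \<beta> :: 'k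
  defines "h \<equiv> (\<lambda>i. \<mu> i + int (2 * n) - int i)"
    and "Crit \<equiv> {\<mu> (n + 1) .. \<mu> n}"
    and "\<alpha> \<equiv> (\<Prod>i\<in>{n+1..2*n}. sat i)"
    and "\<beta> \<equiv> sat n * (\<Prod>i\<in>{n+2..2*n}. sat i)"
  assumes p_prime: "prime p" and p_odd: "odd p" and n_pos: "n \<ge> 1"
    and Cp: "Cp_field p v"
    and gen: "top_gen v \<gamma>"
    and dominant: "\<forall>i\<in>{1..<2*n}. \<mu> (i + 1) \<le> \<mu> i"
    and pure: "\<forall>i\<in>{1..2*n}. \<mu> i + \<mu> (2 * n + 1 - i) = w"
    and sat_nz: "\<forall>i\<in>{1..2*n}. sat i \<noteq> 0"
    and sat_order: "\<forall>i\<in>{1..<2*n}. v (sat (i + 1)) \<le> v (sat i)"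
    and sat_pair: "\<forall>i\<in>{1..2*n}. sat i * sat (2 * n + 1 - i) = lam"
    and lam_val: "v lam = ereal (real (2 * n) - 1 + real_of_int w)"
    and hida: "\<forall>j\<in>{0..2*n}. (\<Sum>i\<in>{1..j}. v (sat (2 * n + 1 - i)))
                   \<ge> ereal (real_of_int (\<Sum>i\<in>{1..j}. h (2 * n + 1 - i)))"
    and hida_end: "(\<Sum>i\<in>{1..2*n}. v (sat (2 * n + 1 - i)))
                   = ereal (real_of_int (\<Sum>i\<in>{1..2*n}. h (2 * n + 1 - i)))"
    and pollack: "sat n + sat (n + 1) = 0"
    and r_def: "v \<alpha> = ereal (r + real_of_int (\<Sum>i\<in>{n+1..2*n}. h i))"
    and r_small: "r < real (card Crit)"
    and La_ord: "in_Ds p v r La" and Lb_ord: "in_Ds p v r Lb"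
    and \<xi>_nz: "\<forall>j. \<xi> j \<noteq> 0" and c_nz: "\<forall>j \<theta>. c j \<theta> \<noteq> 0"
    and La_interp: "\<forall>j\<in>Crit. \<forall>\<theta> m. fo_char v \<theta> \<and> conductor_exp v \<theta> m \<longrightarrow>
        integ p v \<gamma> La j \<theta> = \<xi> j * c j \<theta> * inverse (\<alpha> ^ m) * Lval \<theta> j"
    and Lb_interp: "\<forall>j\<in>Crit. \<forall>\<theta> m. fo_char v \<theta> \<and> conductor_exp v \<theta> m \<longrightarrow>
        integ p v \<gamma> Lb j \<theta> = \<xi> j * c j \<theta> * inverse (\<beta> ^ m) * Lval \<theta> j"
  shows "Rplus p v (real (card Crit) / 2) (log_Pi p v \<gamma> True Crit) \<and>
         Rplus p v (real (card Crit) / 2) (log_Pi p v \<gamma> False Crit) \<and>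
         (\<exists>Lplus Lminus :: 'k dist.
            is_dist p v Lplus \<and> is_dist p v Lminus \<and>
            (\<forall>\<psi>. dchar p \<psi> \<longrightarrow>
               fps_const (1/2) * (La \<psi> + Lb \<psi>) = log_Pi p v \<gamma> True Crit * Lplus \<psi> \<and>
               fps_const (1/2) * (La \<psi> - Lb \<psi>) = log_Pi p v \<gamma> False Crit * Lminus \<psi>) \<and>
            (\<forall>Lp' Lm' :: 'k dist. is_dist p v Lp' \<and> is_dist p v Lm' \<and>
               (\<forall>\<psi>. dchar p \<psi> \<longrightarrow>
                  fps_const (1/2) * (La \<psi> + Lb \<psi>) = log_Pi p v \<gamma> True Crit * Lp' \<psi> \<and>
                  fps_const (1/2) * (La \<psi> - Lb \<psi>) = log_Pi p v \<gamma> False Crit * Lm' \<psi>)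
               \<longrightarrow> (\<forall>\<psi>. dchar p \<psi> \<longrightarrow> Lp' \<psi> = Lplus \<psi> \<and> Lm' \<psi> = Lminus \<psi>)) \<and>
            (\<forall>\<psi>. dchar p \<psi> \<longrightarrow>
               La \<psi> = log_Pi p v \<gamma> True Crit * Lplus \<psi> + log_Pi p v \<gamma> False Crit * Lminus \<psi>) \<and>
            in_Ds p v (r - real (card Crit) / 2) Lplus \<and>
            in_Ds p v (r - real (card Crit) / 2) Lminus \<and>
            (r = real (card Crit) / 2 \<longrightarrow> in_Ds p v 0 Lplus \<and> in_Ds p v 0 Lminus) \<and>
            (\<forall>j\<in>Crit. \<forall>\<theta> m. fo_char v \<theta> \<and> conductor_exp v \<theta> m \<longrightarrow>
               (m \<ge> 2 \<and> even m \<longrightarrow>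
                  peval v (log_Pi p v \<gamma> True Crit) (\<gamma> powi j * \<theta> \<gamma> - 1) \<noteq> 0 \<and>
                  integ p v \<gamma> Lplus j \<theta> =
                    \<xi> j * c j \<theta> * inverse (\<alpha> ^ m) * Lval \<theta> j /
                    peval v (log_Pi p v \<gamma> True Crit) (\<gamma> powi j * \<theta> \<gamma> - 1)) \<and>
               (odd m \<longrightarrow>
                  peval v (log_Pi p v \<gamma> False Crit) (\<gamma> powi j * \<theta> \<gamma> - 1) \<noteq> 0 \<and>
                  integ p v \<gamma> Lminus j \<theta> =
                    \<xi> j * c j \<theta> * inverse (\<alpha> ^ m) * Lval \<theta> j /
                    peval v (log_Pi p v \<gamma> False Crit) (\<gamma> powi j * \<theta> \<gamma> - 1))))"
proof -
  interpret padic_gen p v \<gamma>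
    by unfold_locales (use p_prime p_odd Cp gen in auto)
  have finC: "finite Crit" by (simp add: Crit_def)
  have \<mu>_le: "\<mu> (n + 1) \<le> \<mu> n" using dominant n_pos by auto
  have cardC: "real (card Crit) = real_of_int (\<mu> n - \<mu> (n + 1) + 1)"
    using \<mu>_le by (simp add: Crit_def)
  have split: "{n+1..2*n} = insert (n+1) {n+2..2*n}" using n_pos by auto
  have \<alpha>_eq: "\<alpha> = sat (n + 1) * (\<Prod>i\<in>{n+2..2*n}. sat i)"
    unfolding \<alpha>_def split by simp
  have sat_n: "sat n = - sat (n + 1)" using pollack by (simp add: eq_neg_iff_add_eq_0)
  have \<beta>_eq: "\<beta> = - \<alpha>" by (simp add: \<beta>_def \<alpha>_eq sat_n)
  have nz: "sat i \<noteq> 0" if "i \<in> {1..2*n}" for i using sat_nz that by blast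
  have \<alpha>_nz: "\<alpha> \<noteq> 0" unfolding \<alpha>_def using nz by auto

  \<comment> \<open>Hida's inequality at j = n - 1 shows that \<alpha>_(n+2) ... \<alpha>_(2n)
    contributes at least 0 to r. The Pollack condition and the pairing give 2 v(\<alpha>_(n+1)) =
    v(\<lambda>) = 2n - 1 + \<mu>_n + \<mu>_(n+1), and subtracting h_(n+1) leaves exactly (\<mu>_n -
    \<mu>_(n+1) + 1) / 2.\<close>
  have r_ge: "r \<ge> real (card Crit) / 2"
  proof -
    have reindex: "(\<Sum>i\<in>{1..n-1}. F (2 * n + 1 - i)) = (\<Sum>i\<in>{n+2..2*n}. F i)" for F :: "nat \<Rightarrow> real"
      by (rule sum.reindex_bij_witness[of _ "\<lambda>i. 2 * n + 1 - i" "\<lambda>i. 2 * n + 1 - i"]) (use n_pos in auto)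
    have "(\<Sum>i\<in>{1..n-1}. v (sat (2 * n + 1 - i))) = ereal (\<Sum>i\<in>{1..n-1}. val (sat (2 * n + 1 - i)))"
      unfolding sum_ereal[symmetric] by (intro sum.cong refl v_eq_val nz) auto
    moreover have "n - 1 \<in> {0..2*n}" by simp
    ultimately have "real_of_int (\<Sum>i\<in>{1..n-1}. h (2 * n + 1 - i)) \<le> (\<Sum>i\<in>{1..n-1}. val (sat (2 * n + 1 - i)))"
      using hida by (metis ereal_less_eq(3))
    then have le: "(\<Sum>i\<in>{n+2..2*n}. real_of_int (h i)) \<le> (\<Sum>i\<in>{n+2..2*n}. val (sat i))"
      unfolding of_int_sum reindex[of "\<lambda>i. real_of_int (h i)"] reindex[of "\<lambda>i. val (sat i)"] .
    have n1: "n \<in> {1..2*n}" "n + 1 \<in> {1..2*n}" using n_pos by auto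
    have pair: "sat n * sat (n + 1) = lam" using sat_pair n1(1) by fastforce
    have w: "\<mu> n + \<mu> (n + 1) = w" using pure n1(1) by fastforce
    have "val lam = real (2 * n) - 1 + real_of_int w" using lam_val by (simp add: val_def)
    moreover have "val lam = 2 * val (sat (n + 1))"
      using val_mult[OF nz[OF n1(1)] nz[OF n1(2)]] unfolding pair by (simp add: sat_n)
    ultimately have v1: "2 * val (sat (n + 1)) = real (2 * n) - 1 + real_of_int (\<mu> n + \<mu> (n + 1))"
      using w by simp
    have "val \<alpha> = val (sat (n + 1)) + (\<Sum>i\<in>{n+2..2*n}. val (sat i))"
    proof -
      have "(\<Prod>i\<in>{n+2..2*n}. sat i) \<noteq> 0" using nz by auto
      moreover have "val (\<Prod>i\<in>{n+2..2*n}. sat i) = (\<Sum>i\<in>{n+2..2*n}. val (sat i))"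
        by (intro val_prod nz) auto
      ultimately show ?thesis unfolding \<alpha>_eq using nz[OF n1(2)] by (simp add: val_mult)
    qed
    moreover have "val \<alpha> = r + (real_of_int (h (n + 1)) + (\<Sum>i\<in>{n+2..2*n}. real_of_int (h i)))"
      using r_def unfolding split by (simp add: val_def)
    ultimately show ?thesis using le v1 by (simp add: cardC h_def)
  qed
  then have r0: "r \<ge> 0" using of_nat_0_le_iff[of "card Crit", where ?'a = real] by linarith

  have La: "Rplus p v r (La \<psi>)" and Lb: "Rplus p v r (Lb \<psi>)" if "dchar p \<psi>" for \<psi>
    using La_ord Lb_ord that by (auto simp: in_Ds_def)
  have cdL: "disc_conv (La \<psi>)" "disc_conv (Lb \<psi>)" if "dchar p \<psi>" for \<psi>
    using La[OF that] Lb[OF that] Rplus_imp_disc_conv r0 by auto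

  define G where "G pos \<psi> = fps_const (1/2) * (if pos then La \<psi> + Lb \<psi> else La \<psi> - Lb \<psi>)" for pos \<psi>
  have G_Rplus: "Rplus p v r (G pos \<psi>)" if "dchar p \<psi>" for pos \<psi>
    unfolding G_def using La[OF that] Lb[OF that] by (auto intro: Rplus_cmult Rplus_add Rplus_diff)
  \<comment> \<open>Since \<beta>^(-m) = (-1)^m \<alpha>^(-m), half the sum keeps the even m and
    half the difference keeps the odd m, each with the full value.\<close>
  have G_val: "peval v (G pos (psi_of p v j \<theta>)) (pt j (\<theta> \<gamma>)) =
      (if even m \<longleftrightarrow> pos then \<xi> j * c j \<theta> * inverse (\<alpha> ^ m) * Lval \<theta> j else 0)"
    if j: "j \<in> Crit" and \<theta>: "fo_char v \<theta>" "conductor_exp v \<theta> m" for pos j \<theta> m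
  proof -
    define \<psi> where "\<psi> = psi_of p v j \<theta>"
    obtain \<sigma> where \<sigma>: "\<sigma> > 0" "vge (pt j (\<theta> \<gamma>)) \<sigma>" by (rule character_point[OF \<theta>])
    note x = \<sigma>(2,1)
    have cds: "disc_conv (La \<psi>)" "disc_conv (Lb \<psi>)" using cdL dchar_psi_of[OF \<theta>(1)] by (auto simp: \<psi>_def)
    have "peval v (La \<psi>) (pt j (\<theta> \<gamma>)) = \<xi> j * c j \<theta> * inverse (\<alpha> ^ m) * Lval \<theta> j"
      using La_interp j \<theta> by (auto simp: integ_def pt_def \<psi>_def)
    moreover have "peval v (Lb \<psi>) (pt j (\<theta> \<gamma>)) = \<xi> j * c j \<theta> * inverse (\<beta> ^ m) * Lval \<theta> j"
      using Lb_interp j \<theta> by (auto simp: integ_def pt_def \<psi>_def)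
    moreover have "inverse (\<beta> ^ m) = (if even m then inverse (\<alpha> ^ m) else - inverse (\<alpha> ^ m))"
      by (simp add: \<beta>_eq)
    ultimately show ?thesis
      unfolding G_def \<psi>_def[symmetric]
      by (auto simp: peval_mult[OF x] peval_const[OF x] peval_add[OF x] peval_diff[OF x] disc_conv_const cds
          disc_conv_add disc_conv_diff)
  qed
  \<comment> \<open>For the given component \<psi> the character is chosen depending on j, so that
    its twist by x^j lies in \<psi>. Its conductor exponent is one more than the level of z, hence
    of the parity where \<open>G_val\<close> gives 0.\<close>
  have G_zero: "peval v (G pos \<psi>) (pt j z) = 0"
    if \<psi>: "dchar p \<psi>" and j: "j \<in> Crit" and m: "m \<ge> 1" and z: "z \<in> prim_roots (idx pos m)" for pos \<psi> j m z
  proof -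
    obtain \<theta> where \<theta>: "fo_char v \<theta>" "conductor_exp v \<theta> (idx pos m + 1)" "\<theta> \<gamma> = z" "psi_of p v j \<theta> = \<psi>"
      by (rule character_exists[OF \<psi> idx_ge(1)[OF m] z])
    have "even (idx pos m + 1) \<longleftrightarrow> \<not> pos" using m by (auto simp: idx_def)
    then show ?thesis using G_val[OF j \<theta>(1,2), of pos] \<theta>(3,4) by simp
  qed
  have ex: "\<exists>g. G pos \<psi> = log_Pi p v \<gamma> pos Crit * g \<and> Rplus p v (r - real (card Crit) / 2) g \<and> disc_conv g"
    if "dchar p \<psi>" for pos \<psi>
    by (rule divide_log_Pi[OF finC r0 G_Rplus[OF that, of pos], where pos = pos])
      (rule G_zero[OF that], assumption+, blast)
  define L where "L pos \<psi> = (SOME g. G pos \<psi> = log_Pi p v \<gamma> pos Crit * g \<and>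
    Rplus p v (r - real (card Crit) / 2) g \<and> disc_conv g)" for pos \<psi>
  have L: "G pos \<psi> = log_Pi p v \<gamma> pos Crit * L pos \<psi>"
    and L_Rplus: "Rplus p v (r - real (card Crit) / 2) (L pos \<psi>)"
    and L_disc_conv: "disc_conv (L pos \<psi>)" if "dchar p \<psi>" for pos \<psi>
    using someI_ex[OF ex[OF that, of pos]] by (simp_all add: L_def)
  have L_dist: "is_dist p v (L pos)" for pos
    using L_disc_conv conv_disc_if_disc_conv by (auto simp: is_dist_def)
  have L_in_Ds: "in_Ds p v (r - real (card Crit) / 2) (L pos)" for pos
    using L_dist L_Rplus by (auto simp: in_Ds_def)
  have L_eq: "fps_const (1/2) * (La \<psi> + Lb \<psi>) = log_Pi p v \<gamma> True Crit * L True \<psi>"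
    "fps_const (1/2) * (La \<psi> - Lb \<psi>) = log_Pi p v \<gamma> False Crit * L False \<psi>" if "dchar p \<psi>" for \<psi>
    using L[OF that, of True] L[OF that, of False] by (simp_all add: G_def)
  have unique: "f = L pos \<psi>" if "dchar p \<psi>" "G pos \<psi> = log_Pi p v \<gamma> pos Crit * f" for pos \<psi> f
    using that L[OF that(1), of pos] log_Pi_nz[OF finC, of pos] by simp
  have La_sum: "La \<psi> = log_Pi p v \<gamma> True Crit * L True \<psi> + log_Pi p v \<gamma> False Crit * L False \<psi>"
    if "dchar p \<psi>" for \<psi>
  proof -
    have "fps_const (1/2) * (La \<psi> + Lb \<psi>) + fps_const (1/2) * (La \<psi> - Lb \<psi>) = fps_const (1/2 + 1/2) * La \<psi>"
      unfolding fps_const_add[symmetric] by (simp only: algebra_simps)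
    then show ?thesis unfolding L_eq[OF that] by simp
  qed
  have interp: "peval v (log_Pi p v \<gamma> pos Crit) (\<gamma> powi j * \<theta> \<gamma> - 1) \<noteq> 0 \<and>
      integ p v \<gamma> (L pos) j \<theta> = \<xi> j * c j \<theta> * inverse (\<alpha> ^ m) * Lval \<theta> j /
        peval v (log_Pi p v \<gamma> pos Crit) (\<gamma> powi j * \<theta> \<gamma> - 1)"
    if j: "j \<in> Crit" and \<theta>: "fo_char v \<theta>" "conductor_exp v \<theta> m" and par: "even m \<longleftrightarrow> pos" for pos j \<theta> m
  \<comment> \<open>The value of the logarithm at the character's point is nonzero by parity, so
    evaluating the factorisation of \<open>G\<close> there can be solved for the value of
    \<open>L\<close>.\<close>
  proof -
    define x where "x = pt j (\<theta> \<gamma>)"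
    obtain \<sigma> where "\<sigma> > 0" "vge x \<sigma>" unfolding x_def by (rule character_point[OF \<theta>])
    note \<sigma> = this(2,1)
    have nz: "peval v (log_Pi p v \<gamma> pos Crit) x \<noteq> 0"
      unfolding x_def using character_point_not_zero[OF \<theta> par]
      by (intro peval_log_Pi_nz[OF \<sigma>[unfolded x_def] finC]) auto
    have d: "dchar p (psi_of p v j \<theta>)" by (rule dchar_psi_of[OF \<theta>(1)])
    have "peval v (log_Pi p v \<gamma> pos Crit) x * peval v (L pos (psi_of p v j \<theta>)) x
        = \<xi> j * c j \<theta> * inverse (\<alpha> ^ m) * Lval \<theta> j"
      using G_val[OF j \<theta>, of pos] par unfolding L[OF d] x_def[symmetric]
      by (simp add: peval_mult[OF \<sigma> disc_conv_log_Pi L_disc_conv[OF d]])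
    with nz show ?thesis
      unfolding integ_def x_def pt_def by (metis nonzero_mult_div_cancel_left)
  qed
  show ?thesis
  proof (intro conjI Rplus_log_Pi[OF finC], rule exI[of _ "L True"], rule exI[of _ "L False"], intro conjI)
    show "\<forall>Lp' Lm'. is_dist p v Lp' \<and> is_dist p v Lm' \<and>
        (\<forall>\<psi>. dchar p \<psi> \<longrightarrow>
          fps_const (1/2) * (La \<psi> + Lb \<psi>) = log_Pi p v \<gamma> True Crit * Lp' \<psi> \<and>
          fps_const (1/2) * (La \<psi> - Lb \<psi>) = log_Pi p v \<gamma> False Crit * Lm' \<psi>)
        \<longrightarrow> (\<forall>\<psi>. dchar p \<psi> \<longrightarrow> Lp' \<psi> = L True \<psi> \<and> Lm' \<psi> = L False \<psi>)"
      using unique[of _ True] unique[of _ False] by (simp add: G_def)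
    show "r = real (card Crit) / 2 \<longrightarrow> in_Ds p v 0 (L True) \<and> in_Ds p v 0 (L False)"
      using L_in_Ds by (metis diff_self)
    show "\<forall>j\<in>Crit. \<forall>\<theta> m. fo_char v \<theta> \<and> conductor_exp v \<theta> m \<longrightarrow>
       (m \<ge> 2 \<and> even m \<longrightarrow>
          peval v (log_Pi p v \<gamma> True Crit) (\<gamma> powi j * \<theta> \<gamma> - 1) \<noteq> 0 \<and>
          integ p v \<gamma> (L True) j \<theta> = \<xi> j * c j \<theta> * inverse (\<alpha> ^ m) * Lval \<theta> j /
            peval v (log_Pi p v \<gamma> True Crit) (\<gamma> powi j * \<theta> \<gamma> - 1)) \<and>
       (odd m \<longrightarrow>
          peval v (log_Pi p v \<gamma> False Crit) (\<gamma> powi j * \<theta> \<gamma> - 1) \<noteq> 0 \<and>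
          integ p v \<gamma> (L False) j \<theta> = \<xi> j * c j \<theta> * inverse (\<alpha> ^ m) * Lval \<theta> j /
            peval v (log_Pi p v \<gamma> False Crit) (\<gamma> powi j * \<theta> \<gamma> - 1))"
      using interp[of _ _ _ True] interp[of _ _ _ False] by blast
  qed (use L_eq La_sum L_dist L_in_Ds in blast)+
qed

end
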